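(* Assume that strongly finitary endofunctors on $\mathsf{Met}$ are closed under composition. Then for every finitary variety $\mathcal V$ of quantitative algebras, the free-algebra monad $\mathbb T_{\mathcal V}$ on $\mathsf{Met}$ is strongly finitary.
   Context: $\mathsf{Met}$ is the category of extended metric spaces (distance $\infty$ allowed) and nonexpanding maps, symmetric monoidal closed with $A\otimes B$ carrying the sum metric and $[A,B]$ the supremum metric. All functors and monads are enriched over $\mathsf{Met}$ (nonexpanding on hom-spaces). Every set is regarded as a discrete space (distances $0$ or $\infty$). Let $K:\mathsf{Set}_{\mathrm{fp}}\hookrightarrow\mathsf{Met}$ be the full embedding of finite discrete spaces. An enriched endofunctor $T$ of $\mathsf{Met}$ is strongly finitary if it is the enriched left Kan extension of its restriction along $K$, $T=\mathrm{Lan}_K(T\circ K)$. A monad is strongly finitary if its endofunctor is. A finitary signature $\Sigma$ is a set of operation symbols with arities in $\mathbb N$. A quantitative $\Sigma$-algebra is a metric space $A$ with nonexpanding operations $\sigma_A:A^n\to A$ ($A^n$ with the maximum metric) for $n$-ary $\sigma\in\Sigma$; homomorphisms are nonexpanding maps preserving operations; the category is $\Sigma\text{-}\mathsf{Met}$. With $V$ a countably infinite set of variables and $T_\Sigma V$ the algebra of terms, a quantitative equation is $l=_\varepsilon r$ with $l,r\in T_\Sigma V$ and $\varepsilon\ge0$ rational; $A$ satisfies it if $d(f^\sharp(l),f^\sharp(r))\le\varepsilon$ for every map $f:V\to|A|$, where $f^\sharp$ is the homomorphic extension. A finitary variety of quantitative algebras is a full subcategory of some $\Sigma\text{-}\mathsf{Met}$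 ($\Sigma$ finitary) given by a set of quantitative equations. The forgetful functor $U:\mathcal V\to\mathsf{Met}$ of a variety has a left adjoint $F$; $\mathbb T_{\mathcal V}$ is the resulting monad, carried by $UF$. *)

theory Defs
  imports
    Complex_Main
    "HOL-Library.FuncSet"
    "HOL-Library.Extended_Nonnegative_Real"
begin

unbundle cardinal_syntax

section \<open>The category of extended metric spaces\<close>

text \<open>
  HOL has no type of all sets, so the ambient set theory is a type parameter \<open>'u\<close>, read as the
  class of all sets. By limitation of size, the small subsets of \<open>'u\<close> are those of strictly
  smaller cardinality than \<open>'u\<close> itself. Of the properties of a universe only two are required:
  an infinite set is small, and a union of a small family of small sets is small. For
  inaccessible \<open>|'u|\<close> this is a Grothendieck universe, but strong limits are not needed, so the
  requirement is already met by any type of cardinality \<open>\<aleph>\<^sub>1\<close>. Hom-spaces need not be small; they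
  are handled through their sets of elements and their metric.
\<close>

definition universe :: "'u itself \<Rightarrow> bool" where
  "universe (_ :: 'u itself) \<longleftrightarrow>
     natLeq <o |UNIV :: 'u set| \<and> regularCard |UNIV :: 'u set|"

definition small :: "'u itself \<Rightarrow> 'a set \<Rightarrow> bool" where
  "small (_ :: 'u itself) A \<longleftrightarrow> |A| <o |UNIV :: 'u set|"

record 'a emet =
  pts :: "'a set"
  edist :: "'a \<Rightarrow> 'a \<Rightarrow> ennreal"

definition extended_metric :: "'a emet \<Rightarrow> bool" where
  "extended_metric A \<longleftrightarrow>
     (\<forall>x\<in>pts A. \<forall>y\<in>pts A. edist A x y = 0 \<longleftrightarrow> x = y) \<and>
     (\<forall>x\<in>pts A. \<forall>y\<in>pts A. edist A x y = edist A y x) \<and>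
     (\<forall>x\<in>pts A. \<forall>y\<in>pts A. \<forall>z\<in>pts A. edist A x z \<le> edist A x y + edist A y z)"

definition Met :: "'u emet set" where
  "Met = {A. extended_metric A \<and> small TYPE('u) (pts A)}"

definition nonexpanding :: "'a emet \<Rightarrow> 'b emet \<Rightarrow> ('a \<Rightarrow> 'b) \<Rightarrow> bool" where
  "nonexpanding A B f \<longleftrightarrow>
     f \<in> pts A \<rightarrow> pts B \<and>
     (\<forall>x\<in>pts A. \<forall>y\<in>pts A. edist B (f x) (f y) \<le> edist A x y)"

text \<open>Morphisms are extensional, so that equality of morphisms is equality of functions;
  they are composed with \<^const>\<open>compose\<close>.\<close>

definition Hom :: "'a emet \<Rightarrow> 'b emet \<Rightarrow> ('a \<Rightarrow> 'b) set" where
  "Hom A B = {f \<in> extensional (pts A). nonexpanding A B f}"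

definition Id_on_space :: "'a emet \<Rightarrow> 'a \<Rightarrow> 'a" where
  "Id_on_space A = (\<lambda>x\<in>pts A. x)"

definition hom_dist :: "'a emet \<Rightarrow> 'b emet \<Rightarrow> ('a \<Rightarrow> 'b) \<Rightarrow> ('a \<Rightarrow> 'b) \<Rightarrow> ennreal" where
  "hom_dist A B f g = (SUP x\<in>pts A. edist B (f x) (g x))"

text \<open>The full subcategory of finite discrete spaces; this is \<open>Set\<^sub>f\<^sub>p\<close> as embedded in
  \<open>Met\<close>. It includes the empty space.\<close>

definition Set_fp :: "'u emet set" where
  "Set_fp = {N \<in> Met. finite (pts N) \<and> (\<forall>x\<in>pts N. \<forall>y\<in>pts N. x \<noteq> y \<longrightarrow> edist N x y = \<infinity>)}"


section \<open>Enriched functors, Kan extensions and monads\<close>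

record 'u met_functor =
  Ob :: "'u emet \<Rightarrow> 'u emet"
  Ar :: "'u emet \<Rightarrow> 'u emet \<Rightarrow> ('u \<Rightarrow> 'u) \<Rightarrow> ('u \<Rightarrow> 'u)"

text \<open>Enriched functors to \<open>Met\<close> from the full subcategory of \<open>Met\<close> on a class \<open>D\<close> of objects.\<close>

definition enriched_functor :: "'u emet set \<Rightarrow> 'u met_functor \<Rightarrow> bool" where
  "enriched_functor D F \<longleftrightarrow>
     (\<forall>A\<in>D. Ob F A \<in> Met) \<and>
     (\<forall>A\<in>D. \<forall>B\<in>D. \<forall>f\<in>Hom A B. Ar F A B f \<in> Hom (Ob F A) (Ob F B)) \<and>
     (\<forall>A\<in>D. Ar F A A (Id_on_space A) = Id_on_space (Ob F A)) \<and>
     (\<forall>A\<in>D. \<forall>B\<in>D. \<forall>C\<in>D. \<forall>f\<in>Hom A B. \<forall>g\<in>Hom B C.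
        Ar F A C (compose (pts A) g f) = compose (pts (Ob F A)) (Ar F B C g) (Ar F A B f)) \<and>
     (\<forall>A\<in>D. \<forall>B\<in>D. \<forall>f\<in>Hom A B. \<forall>g\<in>Hom A B.
        hom_dist (Ob F A) (Ob F B) (Ar F A B f) (Ar F A B g) \<le> hom_dist A B f g)"

definition Incl :: "'u met_functor" where
  "Incl = \<lparr>Ob = (\<lambda>A. A), Ar = (\<lambda>A B f. f)\<rparr>"

definition functor_comp :: "'u met_functor \<Rightarrow> 'u met_functor \<Rightarrow> 'u met_functor"
    (infixl "\<circ>\<^sub>F" 55) where
  "T \<circ>\<^sub>F S = \<lparr>Ob = (\<lambda>A. Ob T (Ob S A)),
               Ar = (\<lambda>A B f. Ar T (Ob S A) (Ob S B) (Ar S A B f))\<rparr>"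

text \<open>Enriched naturality over \<open>Met\<close> is ordinary naturality, because maps out of the unit
  object (a one-point space) are points.\<close>

definition nat_trans ::
    "'u emet set \<Rightarrow> 'u met_functor \<Rightarrow> 'u met_functor \<Rightarrow> ('u emet \<Rightarrow> 'u \<Rightarrow> 'u) \<Rightarrow> bool" where
  "nat_trans D F G \<eta> \<longleftrightarrow>
     (\<forall>A\<in>D. \<eta> A \<in> Hom (Ob F A) (Ob G A)) \<and>
     (\<forall>A\<in>D. \<forall>B\<in>D. \<forall>f\<in>Hom A B.
        compose (pts (Ob F A)) (\<eta> B) (Ar F A B f) = compose (pts (Ob F A)) (Ar G A B f) (\<eta> A))"

text \<open>For functors \<open>K, F\<close> on \<open>D\<close> and spaces \<open>X, B\<close>, the hom-space
  \<open>[D\<^sup>o\<^sup>p, Met](Met(K-, X), Met(F-, B))\<close> of the enriched presheaf category.\<close>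

definition presheaf_hom ::
    "'u emet set \<Rightarrow> 'u met_functor \<Rightarrow> 'u met_functor \<Rightarrow> 'u emet \<Rightarrow> 'u emet \<Rightarrow>
     ('u emet \<Rightarrow> ('u \<Rightarrow> 'u) \<Rightarrow> 'u \<Rightarrow> 'u) set" where
  "presheaf_hom D K F X B =
     {\<alpha> \<in> (\<Pi>\<^sub>E N\<in>D. \<Pi>\<^sub>E x\<in>Hom (Ob K N) X. Hom (Ob F N) B).
       (\<forall>N\<in>D. \<forall>x\<in>Hom (Ob K N) X. \<forall>y\<in>Hom (Ob K N) X.
          hom_dist (Ob F N) B (\<alpha> N x) (\<alpha> N y) \<le> hom_dist (Ob K N) X x y) \<and>
       (\<forall>M\<in>D. \<forall>N\<in>D. \<forall>h\<in>Hom M N. \<forall>x\<in>Hom (Ob K N) X.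
          \<alpha> M (compose (pts (Ob K M)) x (Ar K M N h)) =
          compose (pts (Ob F M)) (\<alpha> N x) (Ar F M N h))}"

definition presheaf_hom_dist ::
    "'u emet set \<Rightarrow> 'u met_functor \<Rightarrow> 'u met_functor \<Rightarrow> 'u emet \<Rightarrow> 'u emet \<Rightarrow>
     ('u emet \<Rightarrow> ('u \<Rightarrow> 'u) \<Rightarrow> 'u \<Rightarrow> 'u) \<Rightarrow> ('u emet \<Rightarrow> ('u \<Rightarrow> 'u) \<Rightarrow> 'u \<Rightarrow> 'u) \<Rightarrow> ennreal" where
  "presheaf_hom_dist D K F X B \<alpha> \<beta> =
     (SUP N\<in>D. SUP x\<in>Hom (Ob K N) X. hom_dist (Ob F N) B (\<alpha> N x) (\<beta> N x))"

definition kan_comparison ::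
    "'u emet set \<Rightarrow> 'u met_functor \<Rightarrow> 'u met_functor \<Rightarrow> 'u met_functor \<Rightarrow> ('u emet \<Rightarrow> 'u \<Rightarrow> 'u) \<Rightarrow>
     'u emet \<Rightarrow> ('u \<Rightarrow> 'u) \<Rightarrow> 'u emet \<Rightarrow> ('u \<Rightarrow> 'u) \<Rightarrow> 'u \<Rightarrow> 'u" where
  "kan_comparison D K F L \<eta> X f =
     (\<lambda>N\<in>D. \<lambda>x\<in>Hom (Ob K N) X.
        compose (pts (Ob F N)) f (compose (pts (Ob F N)) (Ar L (Ob K N) X x) (\<eta> N)))"

text \<open>\<open>\<eta> : F \<rightarrow> L \<circ> K\<close> exhibits \<open>L\<close> as the (pointwise) enriched left Kan extension of \<open>F\<close>
  along \<open>K\<close>: it makes \<open>L X\<close> the colimit of \<open>F\<close> weighted by \<open>Met(K-, X)\<close>, that is,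
  \<open>Met(L X, B) \<cong> [D\<^sup>o\<^sup>p, Met](Met(K-, X), Met(F-, B))\<close> isometrically.\<close>

definition left_kan_extension ::
    "'u emet set \<Rightarrow> 'u met_functor \<Rightarrow> 'u met_functor \<Rightarrow> 'u met_functor \<Rightarrow>
     ('u emet \<Rightarrow> 'u \<Rightarrow> 'u) \<Rightarrow> bool" where
  "left_kan_extension D K F L \<eta> \<longleftrightarrow>
     enriched_functor D K \<and> enriched_functor D F \<and> enriched_functor Met L \<and>
     nat_trans D F (L \<circ>\<^sub>F K) \<eta> \<and>
     (\<forall>X\<in>Met. \<forall>B\<in>Met.
        bij_betw (kan_comparison D K F L \<eta> X) (Hom (Ob L X) B) (presheaf_hom D K F X B) \<and>
        (\<forall>f\<in>Hom (Ob L X) B. \<forall>g\<in>Hom (Ob L X) B.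
           presheaf_hom_dist D K F X B
             (kan_comparison D K F L \<eta> X f) (kan_comparison D K F L \<eta> X g) =
           hom_dist (Ob L X) B f g))"

definition strongly_finitary :: "'u met_functor \<Rightarrow> bool" where
  "strongly_finitary T \<longleftrightarrow>
     enriched_functor Met T \<and>
     left_kan_extension Set_fp Incl (T \<circ>\<^sub>F Incl) T (\<lambda>N. Id_on_space (Ob T N))"

record 'u met_monad =
  fun_of :: "'u met_functor"
  unit_of :: "'u emet \<Rightarrow> 'u \<Rightarrow> 'u"
  mult_of :: "'u emet \<Rightarrow> 'u \<Rightarrow> 'u"

definition enriched_monad :: "'u met_monad \<Rightarrow> bool" where
  "enriched_monad M \<longleftrightarrow>
     (let T = fun_of M; \<eta> = unit_of M; \<mu> = mult_of M in
        enriched_functor Met T \<and>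
        nat_trans Met Incl T \<eta> \<and>
        nat_trans Met (T \<circ>\<^sub>F T) T \<mu> \<and>
        (\<forall>X\<in>Met.
           compose (pts (Ob T X)) (\<mu> X) (\<eta> (Ob T X)) = Id_on_space (Ob T X) \<and>
           compose (pts (Ob T X)) (\<mu> X) (Ar T X (Ob T X) (\<eta> X)) = Id_on_space (Ob T X) \<and>
           compose (pts (Ob T (Ob T (Ob T X)))) (\<mu> X) (\<mu> (Ob T X)) =
           compose (pts (Ob T (Ob T (Ob T X)))) (\<mu> X) (Ar T (Ob T (Ob T X)) (Ob T X) (\<mu> X))))"

definition strongly_finitary_monad :: "'u met_monad \<Rightarrow> bool" where
  "strongly_finitary_monad M \<longleftrightarrow> enriched_monad M \<and> strongly_finitary (fun_of M)"


section \<open>Quantitative algebras\<close>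

record 's signature =
  ops :: "'s set"
  arity :: "'s \<Rightarrow> nat"

text \<open>The power \<open>A\<^sup>n\<close> with the maximum metric, on lists of length \<open>n\<close>; the supremum makes
  distances in \<open>A\<^sup>0\<close> equal to \<open>0\<close>.\<close>

definition power_space :: "'a emet \<Rightarrow> nat \<Rightarrow> 'a list emet" where
  "power_space A n =
     \<lparr>pts = {xs. length xs = n \<and> set xs \<subseteq> pts A},
      edist = (\<lambda>xs ys. SUP i\<in>{..<n}. edist A (xs ! i) (ys ! i))\<rparr>"

record ('s, 'u) qalg =
  und :: "'u emet"
  opr :: "'s \<Rightarrow> 'u list \<Rightarrow> 'u"

definition quantitative_algebra :: "'s signature \<Rightarrow> ('s, 'u) qalg \<Rightarrow> bool" where
  "quantitative_algebra \<Sigma> A \<longleftrightarrow>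
     und A \<in> Met \<and>
     (\<forall>\<sigma>\<in>ops \<Sigma>. nonexpanding (power_space (und A) (arity \<Sigma> \<sigma>)) (und A) (opr A \<sigma>))"

definition alg_hom :: "'s signature \<Rightarrow> ('s, 'u) qalg \<Rightarrow> ('s, 'u) qalg \<Rightarrow> ('u \<Rightarrow> 'u) set" where
  "alg_hom \<Sigma> A B =
     {h \<in> Hom (und A) (und B).
        \<forall>\<sigma>\<in>ops \<Sigma>. \<forall>xs\<in>pts (power_space (und A) (arity \<Sigma> \<sigma>)).
          h (opr A \<sigma> xs) = opr B \<sigma> (map h xs)}"

datatype ('s, 'v) trm = Var 'v | App 's "('s, 'v) trm list"

inductive_set terms :: "'s signature \<Rightarrow> ('s, 'v) trm set" for \<Sigma> :: "'s signature" where
  "Var v \<in> terms \<Sigma>"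
| "\<sigma> \<in> ops \<Sigma> \<Longrightarrow> length ts = arity \<Sigma> \<sigma> \<Longrightarrow> (\<And>t. t \<in> set ts \<Longrightarrow> t \<in> terms \<Sigma>) \<Longrightarrow>
   App \<sigma> ts \<in> terms \<Sigma>"

text \<open>The homomorphic extension of \<open>f\<close> to terms.\<close>

primrec sharp :: "('s, 'u) qalg \<Rightarrow> ('v \<Rightarrow> 'u) \<Rightarrow> ('s, 'v) trm \<Rightarrow> 'u" where
  "sharp A f (Var v) = f v"
| "sharp A f (App \<sigma> ts) = opr A \<sigma> (map (sharp A f) ts)"

text \<open>The triple \<open>(l, \<epsilon>, r)\<close> stands for \<open>l =\<^sub>\<epsilon> r\<close>; the variables are the natural numbers.\<close>

type_synonym 's qequation = "('s, nat) trm \<times> rat \<times> ('s, nat) trm"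

definition quantitative_equations :: "'s signature \<Rightarrow> 's qequation set" where
  "quantitative_equations \<Sigma> = {(l, \<epsilon>, r). l \<in> terms \<Sigma> \<and> 0 \<le> \<epsilon> \<and> r \<in> terms \<Sigma>}"

fun satisfies :: "('s, 'u) qalg \<Rightarrow> 's qequation \<Rightarrow> bool" where
  "satisfies A (l, \<epsilon>, r) \<longleftrightarrow>
     (\<forall>f \<in> UNIV \<rightarrow> pts (und A).
        edist (und A) (sharp A f l) (sharp A f r) \<le> ennreal (real_of_rat \<epsilon>))"

text \<open>A variety is given by its class of objects, being a full subcategory.\<close>

definition finitary_variety :: "'s signature \<Rightarrow> ('s, 'u) qalg set \<Rightarrow> bool" where
  "finitary_variety \<Sigma> (\<V> :: ('s, 'u) qalg set) \<longleftrightarrow>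
     small TYPE('u) (ops \<Sigma>) \<and>
     (\<exists>E \<subseteq> quantitative_equations \<Sigma>.
        \<V> = {A. quantitative_algebra \<Sigma> A \<and> (\<forall>e\<in>E. satisfies A e)})"


section \<open>The free-algebra monad\<close>

definition free_algebra_on ::
    "'s signature \<Rightarrow> ('s, 'u) qalg set \<Rightarrow> 'u emet \<Rightarrow> ('s, 'u) qalg \<Rightarrow> ('u \<Rightarrow> 'u) \<Rightarrow> bool" where
  "free_algebra_on \<Sigma> \<V> X A \<eta> \<longleftrightarrow>
     A \<in> \<V> \<and> \<eta> \<in> Hom X (und A) \<and>
     (\<forall>B\<in>\<V>. \<forall>f\<in>Hom X (und B). \<exists>!h. h \<in> alg_hom \<Sigma> A B \<and> compose (pts X) h \<eta> = f)"

text \<open>A choice of values of the left adjoint \<open>F\<close> of the forgetful functor, with the unit; it is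
  unique up to isomorphism.\<close>

definition free_choice ::
    "'s signature \<Rightarrow> ('s, 'u) qalg set \<Rightarrow> 'u emet \<Rightarrow> ('s, 'u) qalg \<times> ('u \<Rightarrow> 'u)" where
  "free_choice \<Sigma> \<V> X = (SOME (A, \<eta>). free_algebra_on \<Sigma> \<V> X A \<eta>)"

definition free_algebra :: "'s signature \<Rightarrow> ('s, 'u) qalg set \<Rightarrow> 'u emet \<Rightarrow> ('s, 'u) qalg" where
  "free_algebra \<Sigma> \<V> X = fst (free_choice \<Sigma> \<V> X)"

definition free_unit :: "'s signature \<Rightarrow> ('s, 'u) qalg set \<Rightarrow> 'u emet \<Rightarrow> 'u \<Rightarrow> 'u" where
  "free_unit \<Sigma> \<V> X = snd (free_choice \<Sigma> \<V> X)"

definition free_extension ::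
    "'s signature \<Rightarrow> ('s, 'u) qalg set \<Rightarrow> 'u emet \<Rightarrow> ('s, 'u) qalg \<Rightarrow> ('u \<Rightarrow> 'u) \<Rightarrow> 'u \<Rightarrow> 'u" where
  "free_extension \<Sigma> \<V> X B f =
     (THE h. h \<in> alg_hom \<Sigma> (free_algebra \<Sigma> \<V> X) B \<and> compose (pts X) h (free_unit \<Sigma> \<V> X) = f)"

definition free_algebra_functor :: "'s signature \<Rightarrow> ('s, 'u) qalg set \<Rightarrow> 'u met_functor" where
  "free_algebra_functor \<Sigma> \<V> =
     \<lparr>Ob = (\<lambda>X. und (free_algebra \<Sigma> \<V> X)),
      Ar = (\<lambda>X Y f. free_extension \<Sigma> \<V> X (free_algebra \<Sigma> \<V> Y)
                      (compose (pts X) (free_unit \<Sigma> \<V> Y) f))\<rparr>"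

text \<open>The multiplication is \<open>U \<epsilon> F\<close>, where the counit \<open>\<epsilon>\<close> at \<open>F X\<close> extends the identity of
  \<open>U F X\<close>.\<close>

definition free_algebra_monad :: "'s signature \<Rightarrow> ('s, 'u) qalg set \<Rightarrow> 'u met_monad" where
  "free_algebra_monad \<Sigma> \<V> =
     \<lparr>fun_of = free_algebra_functor \<Sigma> \<V>,
      unit_of = free_unit \<Sigma> \<V>,
      mult_of = (\<lambda>X. free_extension \<Sigma> \<V> (und (free_algebra \<Sigma> \<V> X)) (free_algebra \<Sigma> \<V> X)
                       (Id_on_space (und (free_algebra \<Sigma> \<V> X))))\<rparr>"

end

theory Submission
  imports Defs
begin

text \<open>
  Let \<open>T\<close> be the free-algebra functor of the variety and \<open>L\<close> the left Kan extension of its restriction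
  to finite discrete spaces. The functor \<open>L\<close> is strongly finitary and there is a comparison
  \<open>L \<rightarrow> T\<close>, invertible at finite discrete spaces; the task is to invert it everywhere. The idea is to
  make \<open>L X\<close> an algebra of the variety. The universal property of \<open>T X\<close> then gives a map
  \<open>T X \<rightarrow> L X\<close>, which is nonexpanding like every homomorphism.

  The algebra structure comes from the hypothesis on composites. The power \<open>X \<mapsto> X\<^sup>n\<close> is
  represented by a finite discrete space, hence strongly finitary by the Yoneda lemma
  (\<open>strongly_finitary_power\<close>), so \<open>X \<mapsto> (L X)\<^sup>n\<close> is strongly finitary too. A natural map from it to
  \<open>L X\<close> is therefore determined by what it does at finite discrete spaces \<open>N\<close>, where \<open>L N \<cong> T N\<close> is
  an algebra: the operations of \<open>T N\<close> extend to operations of \<open>L X\<close> (\<open>operation_exists\<close>). The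
  correspondence of maps is isometric, so a bound \<open>\<epsilon>\<close> on the distance of two terms that holds in
  all \<open>T N\<close> holds in \<open>L X\<close>; so \<open>L X\<close> satisfies the equations of the variety (\<open>alg_model\<close>).

  The map \<open>T X \<rightarrow> L X\<close> obtained from the insertion of generators sends \<open>T x t\<close> to the point of \<open>L X\<close>
  given by \<open>x : N \<rightarrow> X\<close> and \<open>t \<in> T N\<close> (\<open>section_map_T\<close>). Hence the distances in \<open>T X\<close> are at least
  those in \<open>L X\<close>. As every element of \<open>T X\<close> has this form, because terms have finitely many
  variables, \<open>T X\<close> has the universal property of \<open>L X\<close> (\<open>strongly_finitary_T\<close>).

  Free algebras and left Kan extensions are both built by \<open>metric_quotient\<close>: as a set of formal
  expressions with the least distance for which every intended interpretation is nonexpanding. This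
  distance is a supremum over the interpretations, so an inequality that holds in each of them holds
  in the quotient, and each of them factors through the quotient. The monad laws follow from the
  uniqueness of homomorphisms out of free algebras.
\<close>


section \<open>Small sets\<close>

lemma small_subset: "small TYPE('u) B \<Longrightarrow> A \<subseteq> B \<Longrightarrow> small TYPE('u) A"
  unfolding small_def by (meson card_of_mono1 ordLeq_ordLess_trans)

lemma small_image: "small TYPE('u) A \<Longrightarrow> small TYPE('u) (f ` A)"
  unfolding small_def by (meson card_of_image ordLeq_ordLess_trans)

lemma small_nat: "universe TYPE('u) \<Longrightarrow> small TYPE('u) (UNIV :: nat set)"
  unfolding small_def universe_def
  using card_of_nat ordIso_ordLess_trans by blast

lemma infinite_universe: "universe TYPE('u) \<Longrightarrow> infinite (UNIV :: 'u set)"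
  unfolding universe_def using infinite_iff_natLeq_ordLeq ordLess_imp_ordLeq by blast

lemma small_finite: "universe TYPE('u) \<Longrightarrow> finite A \<Longrightarrow> small TYPE('u) A"
  unfolding small_def by (rule finite_ordLess_infinite)
    (auto simp: infinite_universe card_of_well_order_on Field_card_of)

text \<open>This is the regularity of the cardinal of the universe. Products, lists and terms over small
  sets are small because they are small unions.\<close>

lemma small_UN:
  assumes "universe TYPE('u)" "small TYPE('u) I" "\<And>i. i \<in> I \<Longrightarrow> small TYPE('u) (A i)"
  shows "small TYPE('u) (\<Union>i\<in>I. A i)"
  using assms(2,3) unfolding small_def
  by (rule regularCard_UNION_bound[rotated 2])
     (use assms(1) infinite_universe[OF assms(1)] in
       \<open>auto simp: universe_def cinfinite_def Field_card_of card_of_Card_order card_of_card_order_on\<close>)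

lemma small_Times:
  assumes "universe TYPE('u)" "small TYPE('u) A" "small TYPE('u) B"
  shows "small TYPE('u) (A \<times> B)"
proof -
  have "A \<times> B = (\<Union>a\<in>A. Pair a ` B)" by auto
  then show ?thesis using assms by (simp add: small_UN small_image)
qed

lemma small_lists:
  assumes "universe TYPE('u)" "small TYPE('u) A"
  shows "small TYPE('u) {xs. length xs = n \<and> set xs \<subseteq> A}"
proof (induction n)
  case 0
  then show ?case using assms(1) by (auto intro: small_finite)
next
  case (Suc n)
  have "{xs. length xs = Suc n \<and> set xs \<subseteq> A}
      = (\<lambda>(x, xs). x # xs) ` (A \<times> {xs. length xs = n \<and> set xs \<subseteq> A})"
    by (force simp: length_Suc_conv image_iff)
  then show ?case using Suc assms by (simp add: small_Times small_image)
qed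

lemma obtain_small_embedding:
  assumes "small TYPE('u) A"
  obtains j :: "'a \<Rightarrow> 'u" where "inj_on j A"
  using assms unfolding small_def
  by (metis card_of_ordLeq ordLess_imp_ordLeq)


section \<open>Metric spaces and nonexpanding maps\<close>

lemma edist_self: "A \<in> Met \<Longrightarrow> x \<in> pts A \<Longrightarrow> edist A x x = 0"
  by (auto simp: Met_def extended_metric_def)

lemma edist_eq_0: "A \<in> Met \<Longrightarrow> x \<in> pts A \<Longrightarrow> y \<in> pts A \<Longrightarrow> edist A x y = 0 \<Longrightarrow> x = y"
  by (auto simp: Met_def extended_metric_def)

lemma edist_sym: "A \<in> Met \<Longrightarrow> x \<in> pts A \<Longrightarrow> y \<in> pts A \<Longrightarrow> edist A x y = edist A y x"
  by (auto simp: Met_def extended_metric_def)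

lemma edist_triangle:
  "A \<in> Met \<Longrightarrow> x \<in> pts A \<Longrightarrow> y \<in> pts A \<Longrightarrow> z \<in> pts A \<Longrightarrow>
   edist A x z \<le> edist A x y + edist A y z"
  by (auto simp: Met_def extended_metric_def)

lemma Hom_pts: "f \<in> Hom A B \<Longrightarrow> x \<in> pts A \<Longrightarrow> f x \<in> pts B"
  by (auto simp: Hom_def nonexpanding_def)

lemma Hom_edist: "f \<in> Hom A B \<Longrightarrow> x \<in> pts A \<Longrightarrow> y \<in> pts A \<Longrightarrow> edist B (f x) (f y) \<le> edist A x y"
  by (auto simp: Hom_def nonexpanding_def)

lemma Hom_ext: "f \<in> Hom A B \<Longrightarrow> f \<in> extensional (pts A)"
  by (auto simp: Hom_def)

lemma restrict_Hom: "f \<in> Hom A B \<Longrightarrow> restrict f (pts A) = f"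
  by (simp add: Hom_ext extensional_restrict)

lemma HomI:
  assumes "\<And>x. x \<in> pts A \<Longrightarrow> f x \<in> pts B"
    and "\<And>x y. x \<in> pts A \<Longrightarrow> y \<in> pts A \<Longrightarrow> edist B (f x) (f y) \<le> edist A x y"
  shows "(\<lambda>x\<in>pts A. f x) \<in> Hom A B"
  using assms by (auto simp: Hom_def nonexpanding_def)

lemma Hom_eqI:
  assumes "f \<in> Hom A B" "g \<in> Hom A C" "\<And>x. x \<in> pts A \<Longrightarrow> f x = g x"
  shows "f = g"
  using assms by (meson Hom_ext extensionalityI)

lemma compose_Hom: "f \<in> Hom A B \<Longrightarrow> g \<in> Hom B C \<Longrightarrow> compose (pts A) g f \<in> Hom A C"
  unfolding compose_def by (rule HomI) (auto simp: Hom_pts intro: order_trans[OF Hom_edist Hom_edist])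

lemma compose_app: "x \<in> S \<Longrightarrow> compose S g f x = g (f x)"
  by (simp add: compose_def)

lemma Id_Hom: "Id_on_space A \<in> Hom A A"
  by (auto simp: Id_on_space_def Hom_def nonexpanding_def)

lemma Id_on_space_app: "x \<in> pts A \<Longrightarrow> Id_on_space A x = x"
  by (simp add: Id_on_space_def)

lemma hom_dist_le_iff: "hom_dist A B f g \<le> c \<longleftrightarrow> (\<forall>x\<in>pts A. edist B (f x) (g x) \<le> c)"
  by (simp add: hom_dist_def SUP_le_iff)

lemma edist_le_hom_dist: "x \<in> pts A \<Longrightarrow> edist B (f x) (g x) \<le> hom_dist A B f g"
  by (auto simp: hom_dist_def intro: SUP_upper)

lemma hom_dist_precompose_le:
  "x \<in> Hom A B \<Longrightarrow> hom_dist A C (compose (pts A) f x) (compose (pts A) g x) \<le> hom_dist B C f g"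
  by (auto simp: hom_dist_le_iff compose_app Hom_pts edist_le_hom_dist)

lemma hom_dist_postcompose_le:
  assumes "f \<in> Hom B C" "x \<in> Hom A B" "y \<in> Hom A B"
  shows "hom_dist A C (compose (pts A) f x) (compose (pts A) f y) \<le> hom_dist A B x y"
  unfolding hom_dist_le_iff
proof
  fix a assume a: "a \<in> pts A"
  have "edist C (f (x a)) (f (y a)) \<le> edist B (x a) (y a)"
    by (rule Hom_edist[OF assms(1) Hom_pts[OF assms(2) a] Hom_pts[OF assms(3) a]])
  also have "\<dots> \<le> hom_dist A B x y" using a by (rule edist_le_hom_dist)
  finally show "edist C (compose (pts A) f x a) (compose (pts A) f y a) \<le> hom_dist A B x y"
    using a by (simp add: compose_app)
qed

lemma Set_fp_Met: "N \<in> Set_fp \<Longrightarrow> N \<in> Met"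
  by (simp add: Set_fp_def)

lemma Hom_discrete:
  assumes "N \<in> Set_fp" "X \<in> Met" "\<And>i. i \<in> pts N \<Longrightarrow> f i \<in> pts X"
  shows "(\<lambda>i\<in>pts N. f i) \<in> Hom N X"
proof (rule HomI)
  fix i j assume "i \<in> pts N" "j \<in> pts N"
  then show "edist X (f i) (f j) \<le> edist N i j"
    using assms by (cases "i = j") (auto simp: edist_self Set_fp_def)
qed (use assms in auto)

definition discrete :: "'u set \<Rightarrow> 'u emet" where
  "discrete S = \<lparr>pts = S, edist = (\<lambda>x y. if x = y then 0 else \<infinity>)\<rparr>"

lemma pts_discrete [simp]: "pts (discrete S) = S"
  by (simp add: discrete_def)

lemma discrete_Set_fp:
  fixes S :: "'u set"
  assumes "universe TYPE('u)" "finite S"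
  shows "discrete S \<in> Set_fp"
  using assms
  by (auto simp: Set_fp_def discrete_def Met_def extended_metric_def intro: small_finite)

text \<open>Both free algebras and left Kan extensions carry the least distance for which a class of
  prescribed maps is nonexpanding: the supremum of the pulled-back distances, with points at
  distance \<open>0\<close> identified. The pairs \<open>(B, v)\<close> in \<open>I\<close> are the prescribed maps \<open>v\<close> into spaces \<open>B\<close>;
  they may form a proper class. The subset \<open>P0\<close> of representatives keeps \<open>Q\<close> small even when \<open>P\<close>
  is a proper class.\<close>

lemma metric_quotient:
  fixes I :: "('u emet \<times> ('a \<Rightarrow> 'u)) set"
  assumes I: "\<And>B v. (B, v) \<in> I \<Longrightarrow> B \<in> Met \<and> v \<in> P \<rightarrow> pts B"
    and P0: "small TYPE('u) P0" "P0 \<subseteq> P"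
    and rep: "\<And>p. p \<in> P \<Longrightarrow> \<exists>p0\<in>P0. \<forall>(B, v)\<in>I. v p = v p0"
  shows "\<exists>(Q :: 'u emet) q. Q \<in> Met \<and> q ` P = pts Q \<and>
    (\<forall>x\<in>P. \<forall>y\<in>P. edist Q (q x) (q y) = (SUP (B, v)\<in>I. edist B (v x) (v y)))"
proof -
  define d where "d x y = (SUP (B, v)\<in>I. edist B (v x) (v y))" for x y
  have d_le: "d x y \<le> c" if "\<And>B v. (B, v) \<in> I \<Longrightarrow> edist B (v x) (v y) \<le> c" for x y c
    unfolding d_def using that by (auto intro!: SUP_least)
  have d_upper: "edist B (v x) (v y) \<le> d x y" if "(B, v) \<in> I" for B v x y
    unfolding d_def by (rule SUP_upper2[OF that]) simp
  have d_sym: "d x y = d y x" if "x \<in> P" "y \<in> P" for x y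
    unfolding d_def using that I edist_sym
    by (intro SUP_cong) (fastforce simp: Pi_iff)+
  have d_tri: "d x z \<le> d x y + d y z" if "x \<in> P" "y \<in> P" "z \<in> P" for x y z
  proof (rule d_le)
    fix B v assume Bv: "(B, v) \<in> I"
    have "edist B (v x) (v z) \<le> edist B (v x) (v y) + edist B (v y) (v z)"
      using I[OF Bv] that by (intro edist_triangle) auto
    also have "\<dots> \<le> d x y + d y z"
      by (intro add_mono d_upper Bv)
    finally show "edist B (v x) (v z) \<le> d x y + d y z" .
  qed
  have d_cong: "d x z = d y z" if "x \<in> P" "y \<in> P" "z \<in> P" "d x y = 0" for x y z
    using d_tri[of x y z] d_tri[of y x z] d_sym[of x y] that by (intro antisym) auto
  \<comment> \<open>the choice depends only on the class of \<open>p\<close>, hence \<open>r\<close> identifies points at distance \<open>0\<close>\<close>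
  define r where "r p = (SOME p0. p0 \<in> P0 \<and> d p p0 = 0)" for p
  have r: "r p \<in> P0 \<and> d p (r p) = 0" if p: "p \<in> P" for p
  proof -
    obtain p0 where p0: "p0 \<in> P0" "\<forall>(B, v)\<in>I. v p = v p0"
      using rep[OF p] by (elim bexE)
    have "d p p0 \<le> 0"
    proof (rule d_le)
      fix B v assume Bv: "(B, v) \<in> I"
      have "v p = v p0" using bspec[OF p0(2) Bv] by simp
      moreover have "B \<in> Met" "v p \<in> pts B" using I[OF Bv] p by auto
      ultimately show "edist B (v p) (v p0) \<le> 0" using edist_self[of B "v p"] by simp
    qed
    then show ?thesis
      using p0(1) someI[of "\<lambda>p0. p0 \<in> P0 \<and> d p p0 = 0" p0] unfolding r_def by simp
  qed
  have rP: "r p \<in> P" if "p \<in> P" for p using r that P0 by blast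
  have r_eq: "r x = r y" if "x \<in> P" "y \<in> P" "d x y = 0" for x y
  proof -
    have "d x p0 = d y p0" if "p0 \<in> P0" for p0
      using d_cong \<open>x \<in> P\<close> \<open>y \<in> P\<close> \<open>d x y = 0\<close> P0(2) that by blast
    then have "(\<lambda>p0. p0 \<in> P0 \<and> d x p0 = 0) = (\<lambda>p0. p0 \<in> P0 \<and> d y p0 = 0)"
      by auto
    then show ?thesis unfolding r_def by simp
  qed
  have d_r: "d (r x) (r y) = d x y" if "x \<in> P" "y \<in> P" for x y
  proof -
    have "d (r x) (r y) = d x (r y)"
      using d_cong[of x "r x" "r y"] r rP that by simp
    also have "\<dots> = d (r y) x" using d_sym rP that by simp
    also have "\<dots> = d y x" using d_cong[of y "r y" x] r rP that by simp
    finally show ?thesis using d_sym that by simp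
  qed
  obtain j :: "'a \<Rightarrow> 'u" where j: "inj_on j P0"
    using obtain_small_embedding[OF P0(1)] by blast
  define Q where "Q = \<lparr>pts = (\<lambda>p. j (r p)) ` P,
      edist = (\<lambda>a b. d (inv_into P0 j a) (inv_into P0 j b))\<rparr>"
  have Qd: "edist Q (j (r x)) (j (r y)) = d x y" if "x \<in> P" "y \<in> P" for x y
    using that r j d_r by (simp add: Q_def)
  have Qp: "pts Q = (\<lambda>p. j (r p)) ` P" by (simp add: Q_def)
  have "pts Q \<subseteq> j ` P0" using r by (auto simp: Qp)
  then have "small TYPE('u) (pts Q)"
    by (rule small_subset[OF small_image[OF P0(1)]])
  moreover have "extended_metric Q"
    unfolding extended_metric_def Qp ball_simps
  proof (intro conjI ballI)
    fix x y assume xy: "x \<in> P" "y \<in> P"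
    show "(edist Q (j (r x)) (j (r y)) = 0) = (j (r x) = j (r y))"
    proof
      assume "edist Q (j (r x)) (j (r y)) = 0"
      then show "j (r x) = j (r y)" using Qd r_eq xy by simp
    next
      assume "j (r x) = j (r y)"
      then have "r x = r y" using j r xy by (meson inj_onD)
      then have "d x y = d (r x) (r x)" using d_r xy by metis
      also have "\<dots> = d x (r x)" using d_cong[of x "r x" "r x"] r rP xy by simp
      finally show "edist Q (j (r x)) (j (r y)) = 0" using r xy Qd by simp
    qed
  qed (use d_sym d_tri Qd in simp_all)
  ultimately have "Q \<in> Met" by (simp add: Met_def)
  then show ?thesis
    using Qp Qd unfolding d_def by (intro exI[of _ Q] exI[of _ "\<lambda>p. j (r p)"] conjI ballI) simp_all
qed


section \<open>Enriched functors and cocones\<close>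

lemma Incl_simps [simp]: "Ob Incl A = A" "Ar Incl A B f = f"
  by (simp_all add: Incl_def)

lemma functor_comp_simps [simp]:
  "Ob (T \<circ>\<^sub>F S) A = Ob T (Ob S A)"
  "Ar (T \<circ>\<^sub>F S) A B f = Ar T (Ob S A) (Ob S B) (Ar S A B f)"
  by (simp_all add: functor_comp_def)

lemma enriched_functorI:
  assumes "\<And>A. A \<in> D \<Longrightarrow> Ob F A \<in> Met"
    and "\<And>A B f. A \<in> D \<Longrightarrow> B \<in> D \<Longrightarrow> f \<in> Hom A B \<Longrightarrow> Ar F A B f \<in> Hom (Ob F A) (Ob F B)"
    and "\<And>A t. A \<in> D \<Longrightarrow> t \<in> pts (Ob F A) \<Longrightarrow> Ar F A A (Id_on_space A) t = t"
    and "\<And>A B C f g t. A \<in> D \<Longrightarrow> B \<in> D \<Longrightarrow> C \<in> D \<Longrightarrow> f \<in> Hom A B \<Longrightarrow> g \<in> Hom B C \<Longrightarrow>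
      t \<in> pts (Ob F A) \<Longrightarrow> Ar F A C (compose (pts A) g f) t = Ar F B C g (Ar F A B f t)"
    and "\<And>A B f g t. A \<in> D \<Longrightarrow> B \<in> D \<Longrightarrow> f \<in> Hom A B \<Longrightarrow> g \<in> Hom A B \<Longrightarrow>
      t \<in> pts (Ob F A) \<Longrightarrow> edist (Ob F B) (Ar F A B f t) (Ar F A B g t) \<le> hom_dist A B f g"
  shows "enriched_functor D F"
  unfolding enriched_functor_def
proof (intro conjI ballI)
  fix A assume "A \<in> D"
  then show "Ar F A A (Id_on_space A) = Id_on_space (Ob F A)"
    by (intro Hom_eqI[OF assms(2)[OF _ _ Id_Hom] Id_Hom]) (auto simp: Id_on_space_app assms(3))
next
  fix A B C f g assume *: "A \<in> D" "B \<in> D" "C \<in> D" "f \<in> Hom A B" "g \<in> Hom B C"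
  have "Ar F A C (compose (pts A) g f) \<in> Hom (Ob F A) (Ob F C)"
    using * assms(2) compose_Hom by blast
  moreover have "compose (pts (Ob F A)) (Ar F B C g) (Ar F A B f) \<in> Hom (Ob F A) (Ob F C)"
    using * assms(2) by (intro compose_Hom) auto
  ultimately show
    "Ar F A C (compose (pts A) g f) = compose (pts (Ob F A)) (Ar F B C g) (Ar F A B f)"
    by (rule Hom_eqI) (simp add: compose_app assms(4)[OF *])
qed (use assms in \<open>auto simp: hom_dist_le_iff\<close>)

lemma functor_Met: "enriched_functor D F \<Longrightarrow> A \<in> D \<Longrightarrow> Ob F A \<in> Met"
  by (simp add: enriched_functor_def)

lemma functor_Hom:
  "enriched_functor D F \<Longrightarrow> A \<in> D \<Longrightarrow> B \<in> D \<Longrightarrow> f \<in> Hom A B \<Longrightarrow> Ar F A B f \<in> Hom (Ob F A) (Ob F B)"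
  by (simp add: enriched_functor_def)

lemma functor_id:
  "enriched_functor D F \<Longrightarrow> A \<in> D \<Longrightarrow> t \<in> pts (Ob F A) \<Longrightarrow> Ar F A A (Id_on_space A) t = t"
  by (simp add: enriched_functor_def Id_on_space_app)

lemma functor_compose:
  "enriched_functor D F \<Longrightarrow> A \<in> D \<Longrightarrow> B \<in> D \<Longrightarrow> C \<in> D \<Longrightarrow> f \<in> Hom A B \<Longrightarrow> g \<in> Hom B C \<Longrightarrow>
   t \<in> pts (Ob F A) \<Longrightarrow> Ar F A C (compose (pts A) g f) t = Ar F B C g (Ar F A B f t)"
  by (simp add: enriched_functor_def compose_app)

lemma functor_edist:
  assumes "enriched_functor D F" "A \<in> D" "B \<in> D" "f \<in> Hom A B" "g \<in> Hom A B" "t \<in> pts (Ob F A)"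
  shows "edist (Ob F B) (Ar F A B f t) (Ar F A B g t) \<le> hom_dist A B f g"
proof -
  have "hom_dist (Ob F A) (Ob F B) (Ar F A B f) (Ar F A B g) \<le> hom_dist A B f g"
    using assms by (simp add: enriched_functor_def)
  then show ?thesis using assms(6) by (simp add: hom_dist_le_iff)
qed

lemma enriched_functor_subset: "enriched_functor D F \<Longrightarrow> D' \<subseteq> D \<Longrightarrow> enriched_functor D' F"
  unfolding enriched_functor_def by (simp add: subset_iff)

lemma enriched_functor_Incl:
  fixes D :: "'u emet set"
  assumes "D \<subseteq> Met"
  shows "enriched_functor D Incl"
  by (rule enriched_functorI)
     (use assms in \<open>auto simp: Id_on_space_app compose_app edist_le_hom_dist\<close>)

lemma enriched_functor_restrict_Incl:
  "enriched_functor Set_fp (T \<circ>\<^sub>F Incl) \<longleftrightarrow> enriched_functor Set_fp T"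
  by (simp add: enriched_functor_def)

text \<open>The elements of \<open>cocones F X B\<close> are the cocones with vertex \<open>B\<close>, weighted by the homs into \<open>X\<close>,
  of which the value of a left Kan extension of \<open>F\<close> at \<open>X\<close> is the universal one.\<close>

abbreviation cocones ::
    "'u met_functor \<Rightarrow> 'u emet \<Rightarrow> 'u emet \<Rightarrow> ('u emet \<Rightarrow> ('u \<Rightarrow> 'u) \<Rightarrow> 'u \<Rightarrow> 'u) set" where
  "cocones F X B \<equiv> presheaf_hom Set_fp Incl F X B"

lemma cocones_restrict_Incl: "cocones (T \<circ>\<^sub>F Incl) X B = cocones T X B"
  by (simp add: presheaf_hom_def)

lemma cocones_Hom: "\<alpha> \<in> cocones F X B \<Longrightarrow> N \<in> Set_fp \<Longrightarrow> x \<in> Hom N X \<Longrightarrow> \<alpha> N x \<in> Hom (Ob F N) B"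
  by (auto simp: presheaf_hom_def PiE_def Pi_def)

lemma cocones_edist:
  assumes "\<alpha> \<in> cocones F X B" "N \<in> Set_fp" "x \<in> Hom N X" "y \<in> Hom N X" "t \<in> pts (Ob F N)"
  shows "edist B (\<alpha> N x t) (\<alpha> N y t) \<le> hom_dist N X x y"
proof -
  have "hom_dist (Ob F N) B (\<alpha> N x) (\<alpha> N y) \<le> hom_dist N X x y"
    using assms(1-4) by (simp add: presheaf_hom_def)
  then show ?thesis using assms(5) by (simp add: hom_dist_le_iff)
qed

lemma cocones_natural:
  assumes "\<alpha> \<in> cocones F X B" "M \<in> Set_fp" "N \<in> Set_fp" "h \<in> Hom M N" "x \<in> Hom N X"
    "t \<in> pts (Ob F M)"
  shows "\<alpha> M (compose (pts M) x h) t = \<alpha> N x (Ar F M N h t)"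
  using assms by (simp add: presheaf_hom_def compose_app)

lemma cocones_ext:
  assumes "\<alpha> \<in> cocones F X B" "\<beta> \<in> cocones F X B"
    and "\<And>N x t. N \<in> Set_fp \<Longrightarrow> x \<in> Hom N X \<Longrightarrow> t \<in> pts (Ob F N) \<Longrightarrow> \<alpha> N x t = \<beta> N x t"
  shows "\<alpha> = \<beta>"
proof (rule PiE_ext)
  show "\<alpha> \<in> (\<Pi>\<^sub>E N\<in>Set_fp. \<Pi>\<^sub>E x\<in>Hom N X. Hom (Ob F N) B)"
    "\<beta> \<in> (\<Pi>\<^sub>E N\<in>Set_fp. \<Pi>\<^sub>E x\<in>Hom N X. Hom (Ob F N) B)"
    using assms(1,2) by (simp_all add: presheaf_hom_def)
  fix N :: "'a emet" assume N: "N \<in> Set_fp"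
  show "\<alpha> N = \<beta> N"
  proof (rule PiE_ext)
    show "\<alpha> N \<in> (\<Pi>\<^sub>E x\<in>Hom N X. Hom (Ob F N) B)" "\<beta> N \<in> (\<Pi>\<^sub>E x\<in>Hom N X. Hom (Ob F N) B)"
      using assms(1,2) N by (auto simp: presheaf_hom_def)
    fix x assume x: "x \<in> Hom N X"
    show "\<alpha> N x = \<beta> N x"
      using cocones_Hom[OF assms(1) N x] cocones_Hom[OF assms(2) N x]
      by (rule Hom_eqI) (use assms(3) N x in blast)
  qed
qed

lemma coconesI:
  assumes F: "enriched_functor Set_fp F"
    and Hom: "\<And>N x. N \<in> Set_fp \<Longrightarrow> x \<in> Hom N X \<Longrightarrow> (\<lambda>t\<in>pts (Ob F N). \<beta> N x t) \<in> Hom (Ob F N) B"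
    and dist: "\<And>N x y t. N \<in> Set_fp \<Longrightarrow> x \<in> Hom N X \<Longrightarrow> y \<in> Hom N X \<Longrightarrow> t \<in> pts (Ob F N) \<Longrightarrow>
      edist B (\<beta> N x t) (\<beta> N y t) \<le> hom_dist N X x y"
    and nat: "\<And>M N h x t. M \<in> Set_fp \<Longrightarrow> N \<in> Set_fp \<Longrightarrow> h \<in> Hom M N \<Longrightarrow> x \<in> Hom N X \<Longrightarrow>
      t \<in> pts (Ob F M) \<Longrightarrow> \<beta> M (compose (pts M) x h) t = \<beta> N x (Ar F M N h t)"
  shows "(\<lambda>N\<in>Set_fp. \<lambda>x\<in>Hom N X. \<lambda>t\<in>pts (Ob F N). \<beta> N x t) \<in> cocones F X B"
proof -
  have "restrict (\<beta> M (compose (pts M) x h)) (pts (Ob F M))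
      = compose (pts (Ob F M)) (restrict (\<beta> N x) (pts (Ob F N))) (Ar F M N h)"
    if "M \<in> Set_fp" "N \<in> Set_fp" "h \<in> Hom M N" "x \<in> Hom N X" for M N h x
    using nat[OF that] Hom_pts[OF functor_Hom[OF F that(1-3)]]
    by (auto simp: fun_eq_iff compose_def)
  then show ?thesis
    unfolding presheaf_hom_def
    using Hom dist by (auto simp: hom_dist_le_iff compose_Hom)
qed

text \<open>If every point of \<open>L X\<close> comes from a finite discrete space, then a map out of \<open>L X\<close> is
  determined by the cocone it induces, and so is the distance of two such maps. Conversely, a cocone
  induces a map out of \<open>L X\<close> if its value at a point does not depend on how the point is
  represented. The bound \<open>sep\<close>, applied to two representations of the same point, shows this; applied
  to different points, it shows that the induced map is nonexpanding.\<close>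

lemma strongly_finitaryI:
  fixes L :: "'u met_functor"
  assumes L: "enriched_functor Met L"
    and gen: "\<And>X p. X \<in> Met \<Longrightarrow> p \<in> pts (Ob L X) \<Longrightarrow>
      \<exists>N\<in>Set_fp. \<exists>x\<in>Hom N X. \<exists>t\<in>pts (Ob L N). p = Ar L N X x t"
    and sep: "\<And>X B \<alpha> M N x y s t. X \<in> Met \<Longrightarrow> B \<in> Met \<Longrightarrow> \<alpha> \<in> cocones L X B \<Longrightarrow>
      M \<in> Set_fp \<Longrightarrow> N \<in> Set_fp \<Longrightarrow> x \<in> Hom M X \<Longrightarrow> y \<in> Hom N X \<Longrightarrow>
      s \<in> pts (Ob L M) \<Longrightarrow> t \<in> pts (Ob L N) \<Longrightarrow>
      edist B (\<alpha> M x s) (\<alpha> N y t) \<le> edist (Ob L X) (Ar L M X x s) (Ar L N X y t)"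
  shows "strongly_finitary L"
proof -
  define K :: "'u emet \<Rightarrow> ('u \<Rightarrow> 'u) \<Rightarrow> 'u emet \<Rightarrow> ('u \<Rightarrow> 'u) \<Rightarrow> 'u \<Rightarrow> 'u" where
    "K = kan_comparison Set_fp Incl (L \<circ>\<^sub>F Incl) L (\<lambda>N. Id_on_space (Ob L N))"
  have K: "K X f N x t = f (Ar L N X x t)"
    if "N \<in> Set_fp" "x \<in> Hom N X" "t \<in> pts (Ob L N)" for X f N x t
    using that by (simp add: K_def kan_comparison_def compose_app Id_on_space_app)
  have Lx: "Ar L N X x \<in> Hom (Ob L N) (Ob L X)" if "X \<in> Met" "N \<in> Set_fp" "x \<in> Hom N X" for X N x
    using functor_Hom[OF L] that by (simp add: Set_fp_Met)
  have Lfp: "enriched_functor Set_fp L"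
    using L enriched_functor_subset Set_fp_Met by blast
  have K_cocone: "K X f \<in> cocones L X B"
    if X: "X \<in> Met" and B: "B \<in> Met" and f: "f \<in> Hom (Ob L X) B" for X B f
  proof -
    have "(\<lambda>N\<in>Set_fp. \<lambda>x\<in>Hom N X. \<lambda>t\<in>pts (Ob L N). f (Ar L N X x t)) \<in> cocones L X B"
    proof (rule coconesI[OF Lfp])
      fix N :: "'u emet" and x assume *: "N \<in> Set_fp" "x \<in> Hom N X"
      show "(\<lambda>t\<in>pts (Ob L N). f (Ar L N X x t)) \<in> Hom (Ob L N) B"
        using compose_Hom[OF Lx[OF X *] f] by (simp add: compose_def)
    next
      fix N :: "'u emet" and x y t assume *: "N \<in> Set_fp" "x \<in> Hom N X" "y \<in> Hom N X" "t \<in> pts (Ob L N)"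
      show "edist B (f (Ar L N X x t)) (f (Ar L N X y t)) \<le> hom_dist N X x y"
        using * X
        by (intro order_trans[OF Hom_edist[OF f] functor_edist[OF L]])
          (auto intro: Hom_pts[OF Lx] Set_fp_Met)
    next
      fix M N :: "'u emet" and h x t
      assume "M \<in> Set_fp" "N \<in> Set_fp" "h \<in> Hom M N" "x \<in> Hom N X" "t \<in> pts (Ob L M)"
      then show "f (Ar L M X (compose (pts M) x h) t) = f (Ar L N X x (Ar L M N h t))"
        using functor_compose[OF L, of M N X h x t] X by (simp add: Set_fp_Met)
    qed
    also have "(\<lambda>N\<in>Set_fp. \<lambda>x\<in>Hom N X. \<lambda>t\<in>pts (Ob L N). f (Ar L N X x t)) = K X f"
      by (simp add: K_def kan_comparison_def compose_def Id_on_space_def fun_eq_iff)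
    finally show ?thesis .
  qed
  have onto: "\<exists>f\<in>Hom (Ob L X) B. \<alpha> = K X f"
    if X: "X \<in> Met" and B: "B \<in> Met" and \<alpha>: "\<alpha> \<in> cocones L X B" for X B \<alpha>
  proof -
    define V where "V p v \<longleftrightarrow> (\<exists>N\<in>Set_fp. \<exists>x\<in>Hom N X. \<exists>t\<in>pts (Ob L N).
      p = Ar L N X x t \<and> v = \<alpha> N x t)" for p v
    define f where "f p = (SOME v. V p v)" for p
    have V: "V p (f p)" if "p \<in> pts (Ob L X)" for p
      unfolding f_def by (rule someI_ex) (use gen[OF X that] in \<open>auto simp: V_def\<close>)
    have V_dist: "edist B v w \<le> edist (Ob L X) p q \<and> v \<in> pts B" if "V p v" "V q w" for p q v w
      using that sep[OF X B \<alpha>] Hom_pts[OF cocones_Hom[OF \<alpha>]] unfolding V_def by blast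
    have f_Hom: "restrict f (pts (Ob L X)) \<in> Hom (Ob L X) B"
      by (rule HomI) (use V V_dist in blast)+
    moreover have "\<alpha> = K X (restrict f (pts (Ob L X)))"
    proof (rule cocones_ext[OF \<alpha> K_cocone[OF X B f_Hom]])
      fix N :: "'u emet" and x t assume *: "N \<in> Set_fp" "x \<in> Hom N X" "t \<in> pts (Ob L N)"
      let ?p = "Ar L N X x t"
      have p: "?p \<in> pts (Ob L X)" using Hom_pts[OF Lx[OF X]] * by blast
      have v: "V ?p (\<alpha> N x t)" using * by (auto simp: V_def)
      have "edist B (\<alpha> N x t) (f ?p) \<le> edist (Ob L X) ?p ?p"
        using V_dist[OF v V[OF p]] by blast
      then have "edist B (\<alpha> N x t) (f ?p) = 0"
        using edist_self[OF functor_Met[OF L X] p] by simp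
      then have "\<alpha> N x t = f ?p"
        using edist_eq_0[OF B] V_dist[OF v v] V_dist[OF V[OF p] v] by blast
      then show "\<alpha> N x t = K X (restrict f (pts (Ob L X))) N x t"
        using * p by (simp add: K)
    qed
    ultimately show ?thesis by blast
  qed
  have inj: "f p = g p"
    if X: "X \<in> Met" and eq: "K X f = K X g" and p: "p \<in> pts (Ob L X)" for X f g p
  proof -
    obtain N x t where "N \<in> Set_fp" "x \<in> Hom N X" "t \<in> pts (Ob L N)" "p = Ar L N X x t"
      using gen[OF X p] by blast
    then show ?thesis using K[of N x X t f] K[of N x X t g] eq by simp
  qed
  have isometry: "presheaf_hom_dist Set_fp Incl (L \<circ>\<^sub>F Incl) X B (K X f) (K X g)
      = hom_dist (Ob L X) B f g" if X: "X \<in> Met" for X B f g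
  proof (rule antisym)
    show "presheaf_hom_dist Set_fp Incl (L \<circ>\<^sub>F Incl) X B (K X f) (K X g) \<le> hom_dist (Ob L X) B f g"
      using X Hom_pts[OF Lx]
      by (auto simp: presheaf_hom_dist_def hom_dist_le_iff SUP_le_iff K edist_le_hom_dist)
    show "hom_dist (Ob L X) B f g \<le> presheaf_hom_dist Set_fp Incl (L \<circ>\<^sub>F Incl) X B (K X f) (K X g)"
      unfolding hom_dist_le_iff
    proof
      fix p assume "p \<in> pts (Ob L X)"
      then obtain N x t where *: "N \<in> Set_fp" "x \<in> Hom N X" "t \<in> pts (Ob L N)" "p = Ar L N X x t"
        using gen X by blast
      have "edist B (f p) (g p) \<le> hom_dist (Ob (L \<circ>\<^sub>F Incl) N) B (K X f N x) (K X g N x)"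
        using edist_le_hom_dist[of t "Ob L N" B "K X f N x" "K X g N x"] * by (simp add: K)
      also have "\<dots> \<le> presheaf_hom_dist Set_fp Incl (L \<circ>\<^sub>F Incl) X B (K X f) (K X g)"
        unfolding presheaf_hom_dist_def using * by (auto intro!: SUP_upper2[of N] SUP_upper2[of x])
      finally show "edist B (f p) (g p)
          \<le> presheaf_hom_dist Set_fp Incl (L \<circ>\<^sub>F Incl) X B (K X f) (K X g)" .
    qed
  qed
  have "bij_betw (K X) (Hom (Ob L X) B) (cocones L X B)" if "X \<in> Met" "B \<in> Met" for X B
    unfolding bij_betw_def
  proof
    show "inj_on (K X) (Hom (Ob L X) B)"
      by (rule inj_onI, rule Hom_eqI) (use inj that in auto)
    show "K X ` Hom (Ob L X) B = cocones L X B"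
      using K_cocone onto that by blast
  qed
  moreover have "nat_trans Set_fp (L \<circ>\<^sub>F Incl) (L \<circ>\<^sub>F Incl) (\<lambda>N. Id_on_space (Ob L N))"
    unfolding nat_trans_def using Hom_pts[OF functor_Hom[OF Lfp]]
    by (auto simp: Id_Hom compose_def Id_on_space_app fun_eq_iff)
  moreover have "enriched_functor Set_fp (Incl :: 'u met_functor)"
    by (rule enriched_functor_Incl) (auto simp: Set_fp_Met)
  ultimately show ?thesis
    unfolding strongly_finitary_def left_kan_extension_def cocones_restrict_Incl K_def[symmetric]
    using L Lfp isometry by (simp add: enriched_functor_restrict_Incl)
qed

lemma strongly_finitary_functor: "strongly_finitary L \<Longrightarrow> enriched_functor Met L"
  by (simp add: strongly_finitary_def)

lemma strongly_finitary_comparison: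
  assumes "N \<in> Set_fp" "x \<in> Hom N X" "t \<in> pts (Ob L N)"
  shows "kan_comparison Set_fp Incl (L \<circ>\<^sub>F Incl) L (\<lambda>N. Id_on_space (Ob L N)) X f N x t
    = f (Ar L N X x t)"
  using assms by (simp add: kan_comparison_def compose_app Id_on_space_app)

lemma strongly_finitary_extend:
  assumes L: "strongly_finitary L" and "X \<in> Met" "B \<in> Met" "\<alpha> \<in> cocones L X B"
  obtains f where "f \<in> Hom (Ob L X) B"
    "\<And>N x t. N \<in> Set_fp \<Longrightarrow> x \<in> Hom N X \<Longrightarrow> t \<in> pts (Ob L N) \<Longrightarrow> f (Ar L N X x t) = \<alpha> N x t"
proof -
  let ?K = "kan_comparison Set_fp Incl (L \<circ>\<^sub>F Incl) L (\<lambda>N. Id_on_space (Ob L N)) X"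
  have "bij_betw ?K (Hom (Ob L X) B) (cocones L X B)"
    using assms unfolding strongly_finitary_def left_kan_extension_def cocones_restrict_Incl by blast
  then have "\<alpha> \<in> ?K ` Hom (Ob L X) B"
    using assms(4) by (simp add: bij_betw_def)
  then obtain f where "\<alpha> = ?K f" "f \<in> Hom (Ob L X) B" by (rule imageE)
  then show ?thesis using that[of f] strongly_finitary_comparison[of _ _ X _ L f] by simp
qed

text \<open>The isometry of a left Kan extension lets one bound the distance of two maps out of \<open>L X\<close> on
  the points that come from finite discrete spaces.\<close>

lemma strongly_finitary_edist_le:
  fixes X B :: "'u emet"
  assumes L: "strongly_finitary L" and "X \<in> Met" "B \<in> Met"
    and fg: "f \<in> Hom (Ob L X) B" "g \<in> Hom (Ob L X) B"
    and le: "\<And>N x t. N \<in> Set_fp \<Longrightarrow> x \<in> Hom N X \<Longrightarrow> t \<in> pts (Ob L N) \<Longrightarrow>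
      edist B (f (Ar L N X x t)) (g (Ar L N X x t)) \<le> c"
    and p: "p \<in> pts (Ob L X)"
  shows "edist B (f p) (g p) \<le> c"
proof -
  let ?K = "kan_comparison Set_fp Incl (L \<circ>\<^sub>F Incl) L (\<lambda>N. Id_on_space (Ob L N)) X"
  have "edist B (f p) (g p) \<le> hom_dist (Ob L X) B f g"
    using p by (rule edist_le_hom_dist)
  also have "\<dots> = presheaf_hom_dist Set_fp Incl (L \<circ>\<^sub>F Incl) X B (?K f) (?K g)"
    using assms(1-5) by (simp add: strongly_finitary_def left_kan_extension_def)
  also have "\<dots> \<le> c"
    unfolding presheaf_hom_dist_def using le
    by (auto intro!: SUP_least simp: hom_dist_le_iff strongly_finitary_comparison)
  finally show ?thesis .
qed


section \<open>Left Kan extensions along finite discrete spaces\<close>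

lemma small_inj_on:
  assumes "inj_on g A" "small TYPE('u) (g ` A)"
  shows "small TYPE('u) A"
  using small_image[OF assms(2), of "inv_into A g"] assms(1) by simp

lemma small_Hom:
  fixes N X :: "'u emet"
  assumes U: "universe TYPE('u)" and N: "N \<in> Set_fp" and X: "X \<in> Met"
  shows "small TYPE('u) (Hom N X)"
proof -
  obtain xs where xs: "set xs = pts N"
    using N finite_list[of "pts N"] by (auto simp: Set_fp_def)
  have "inj_on (\<lambda>f. map f xs) (Hom N X)"
    by (rule inj_onI, rule Hom_eqI) (auto simp: xs)
  moreover have "(\<lambda>f. map f xs) ` Hom N X \<subseteq> {ys. length ys = length xs \<and> set ys \<subseteq> pts X}"
    using xs by (auto simp: Hom_pts)
  moreover have "small TYPE('u) {ys. length ys = length xs \<and> set ys \<subseteq> pts X}"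
    by (rule small_lists[OF U]) (use X in \<open>simp add: Met_def\<close>)
  ultimately show ?thesis by (blast intro: small_inj_on small_subset)
qed

text \<open>The value at \<open>X\<close> is glued from the triples \<open>(N, x, t)\<close>, read as \<open>L x\<close> applied to the image
  of \<open>t \<in> F N\<close> in \<open>L N\<close>, with the least distance for which all cocones are nonexpanding; every
  cocone then factors through the quotient. The finite discrete spaces form a proper class, but each
  is isomorphic to one with points in a fixed countable set, so that the quotient is small. Since
  \<open>Set_fp\<close> is a full subcategory, the unit \<open>\<kappa>\<close> is an isomorphism.\<close>

lemma left_kan_extension_exists:
  fixes F :: "'u met_functor"
  assumes U: "universe TYPE('u)" and F: "enriched_functor Set_fp F"
  obtains L \<kappa> where "strongly_finitary L"
    "\<And>N. N \<in> Set_fp \<Longrightarrow> \<kappa> N ` pts (Ob F N) = pts (Ob L N)"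
    "\<And>N s t. N \<in> Set_fp \<Longrightarrow> s \<in> pts (Ob F N) \<Longrightarrow> t \<in> pts (Ob F N) \<Longrightarrow>
      edist (Ob L N) (\<kappa> N s) (\<kappa> N t) = edist (Ob F N) s t"
    "\<And>M N h t. M \<in> Set_fp \<Longrightarrow> N \<in> Set_fp \<Longrightarrow> h \<in> Hom M N \<Longrightarrow> t \<in> pts (Ob F M) \<Longrightarrow>
      Ar L M N h (\<kappa> M t) = \<kappa> N (Ar F M N h t)"
    "\<And>X B \<alpha>. X \<in> Met \<Longrightarrow> B \<in> Met \<Longrightarrow> \<alpha> \<in> cocones F X B \<Longrightarrow>
      \<exists>f\<in>Hom (Ob L X) B. \<forall>N\<in>Set_fp. \<forall>x\<in>Hom N X. \<forall>t\<in>pts (Ob F N).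
        f (Ar L N X x (\<kappa> N t)) = \<alpha> N x t"
proof -
  define P :: "'u emet \<Rightarrow> ('u emet \<times> ('u \<Rightarrow> 'u) \<times> 'u) set" where
    "P X = {(N, x, t). N \<in> Set_fp \<and> x \<in> Hom N X \<and> t \<in> pts (Ob F N)}" for X
  define I :: "'u emet \<Rightarrow> ('u emet \<times> ('u emet \<times> ('u \<Rightarrow> 'u) \<times> 'u \<Rightarrow> 'u)) set" where
    "I X = {(B, \<lambda>(N, x, t). \<alpha> N x t) | B \<alpha>. B \<in> Met \<and> \<alpha> \<in> cocones F X B}" for X
  obtain \<iota> :: "nat \<Rightarrow> 'u" where \<iota>: "inj \<iota>"
    using infinite_countable_subset[OF infinite_universe[OF U]] by blast
  define Sk where "Sk = range (\<lambda>n. discrete (\<iota> ` {..<n}))"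
  have Sk: "N \<in> Set_fp" if "N \<in> Sk" for N
    using that discrete_Set_fp[OF U] by (auto simp: Sk_def)
  define G :: "'u emet \<Rightarrow> 'u emet \<Rightarrow> ('u emet \<times> ('u \<Rightarrow> 'u) \<times> 'u \<Rightarrow> 'u) \<Rightarrow> bool" where
    "G X Q q \<longleftrightarrow> Q \<in> Met \<and> q ` P X = pts Q \<and>
      (\<forall>a\<in>P X. \<forall>b\<in>P X. edist Q (q a) (q b) = (SUP (B, v)\<in>I X. edist B (v a) (v b)))" for X Q q
  have "\<exists>Q q. G X Q q" if X: "X \<in> Met" for X
    unfolding G_def
  proof (rule metric_quotient)
    fix B v assume "(B, v) \<in> I X"
    then show "B \<in> Met \<and> v \<in> P X \<rightarrow> pts B"
      by (auto simp: I_def P_def Hom_pts[OF cocones_Hom])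
  next
    have "{a \<in> P X. fst a \<in> Sk} \<subseteq> (\<Union>N\<in>Sk. Pair N ` (Hom N X \<times> pts (Ob F N)))"
      by (auto simp: P_def)
    moreover have "small TYPE('u) (\<Union>N\<in>Sk. Pair N ` (Hom N X \<times> pts (Ob F N)))"
    proof (rule small_UN[OF U])
      show "small TYPE('u) Sk"
        unfolding Sk_def by (intro small_image small_nat U)
      fix N assume "N \<in> Sk"
      then have N: "N \<in> Set_fp" by (rule Sk)
      then have "small TYPE('u) (pts (Ob F N))"
        using functor_Met[OF F] by (auto simp: Met_def)
      then show "small TYPE('u) (Pair N ` (Hom N X \<times> pts (Ob F N)))"
        by (intro small_image small_Times U small_Hom N X)
    qed
    ultimately show "small TYPE('u) {a \<in> P X. fst a \<in> Sk}"
      by (rule small_subset[rotated])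
  next
    fix a assume "a \<in> P X"
    then obtain N x t where a: "a = (N, x, t)"
      and N: "N \<in> Set_fp" and x: "x \<in> Hom N X" and t: "t \<in> pts (Ob F N)"
      by (auto simp: P_def)
    \<comment> \<open>\<open>N\<close> is replaced by the isomorphic space \<open>M\<close> in \<open>Sk\<close>, and naturality of the cocones along
      the inverse \<open>k\<close> of the isomorphism \<open>h\<close> shows that they take the same value\<close>
    define M where "M = discrete (\<iota> ` {..<card (pts N)})"
    have "M \<in> Sk" by (auto simp: Sk_def M_def)
    then have M: "M \<in> Set_fp" by (rule Sk)
    have "finite (pts N)" "finite (pts M)" "card (pts M) = card (pts N)"
      using N \<iota> by (auto simp: Set_fp_def M_def card_image inj_on_subset)
    then obtain b where b: "bij_betw b (pts M) (pts N)"
      using finite_same_card_bij by blast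
    define h where "h = restrict b (pts M)"
    define k where "k = restrict (inv_into (pts M) b) (pts N)"
    have h: "h \<in> Hom M N"
      unfolding h_def by (rule Hom_discrete) (use M N b in \<open>auto simp: Set_fp_Met bij_betw_apply\<close>)
    have k: "k \<in> Hom N M"
      unfolding k_def using bij_betw_apply[OF bij_betw_inv_into[OF b]]
      by (intro Hom_discrete) (use M N in \<open>auto simp: Set_fp_Met\<close>)
    have hk: "h (k i) = i" if "i \<in> pts N" for i
      using that Hom_pts[OF k that] bij_betw_inv_into_right[OF b that] by (simp add: h_def k_def)
    have x': "compose (pts M) x h \<in> Hom M X" using h x by (rule compose_Hom)
    have "compose (pts N) (compose (pts M) x h) k \<in> Hom N X" using k x' by (rule compose_Hom)
    then have eq: "compose (pts N) (compose (pts M) x h) k = x"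
      by (rule Hom_eqI[OF _ x]) (simp add: compose_app Hom_pts[OF k] hk)
    define a0 where "a0 = (M, compose (pts M) x h, Ar F N M k t)"
    have "a0 \<in> {a \<in> P X. fst a \<in> Sk}"
      using M x' \<open>M \<in> Sk\<close> Hom_pts[OF functor_Hom[OF F N M k] t] by (simp add: a0_def P_def)
    moreover have "\<alpha> N x t = \<alpha> M (compose (pts M) x h) (Ar F N M k t)"
      if "\<alpha> \<in> cocones F X B" for B \<alpha>
      using cocones_natural[OF that N M k x' t] by (simp add: eq)
    then have "\<forall>(B, v)\<in>I X. v a = v a0"
      by (auto simp: I_def a a0_def)
    ultimately show "\<exists>a0\<in>{a \<in> P X. fst a \<in> Sk}. \<forall>(B, v)\<in>I X. v a = v a0" by blast
  qed auto
  then have "\<exists>Q q. \<forall>X\<in>Met. G X (Q X) (q X)" by metis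
  then obtain Q q where "\<forall>X\<in>Met. G X (Q X) (q X)" by blast
  then have Q: "\<And>X. X \<in> Met \<Longrightarrow> Q X \<in> Met" and
    q: "\<And>X. X \<in> Met \<Longrightarrow> q X ` P X = pts (Q X)" and
    dist: "\<And>X a b. X \<in> Met \<Longrightarrow> a \<in> P X \<Longrightarrow> b \<in> P X \<Longrightarrow>
      edist (Q X) (q X a) (q X b) = (SUP (B, v)\<in>I X. edist B (v a) (v b))"
    by (simp_all add: G_def)
  have PI: "(N, x, t) \<in> P X" if "N \<in> Set_fp" "x \<in> Hom N X" "t \<in> pts (Ob F N)" for X N x t
    using that by (simp add: P_def)
  have q_pts: "q X a \<in> pts (Q X)" if "X \<in> Met" "a \<in> P X" for X a
    using q[OF that(1)] that(2) by blast
  have q_cases: "\<exists>N\<in>Set_fp. \<exists>x\<in>Hom N X. \<exists>t\<in>pts (Ob F N). p = q X (N, x, t)"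
    if "X \<in> Met" "p \<in> pts (Q X)" for X p
  proof -
    have "p \<in> q X ` P X" using q[OF that(1)] that(2) by simp
    then show ?thesis by (auto simp: P_def)
  qed
  have dist_le: "edist (Q X) (q X (M, x, s)) (q X (N, y, t)) \<le> c"
    if "X \<in> Met" "(M, x, s) \<in> P X" "(N, y, t) \<in> P X"
      "\<And>B \<alpha>. B \<in> Met \<Longrightarrow> \<alpha> \<in> cocones F X B \<Longrightarrow> edist B (\<alpha> M x s) (\<alpha> N y t) \<le> c"
    for X M N x y s t c
    unfolding dist[OF that(1-3)] using that(4) by (auto simp: I_def intro!: SUP_least)
  have dist_ge: "edist B (\<alpha> M x s) (\<alpha> N y t) \<le> edist (Q X) (q X (M, x, s)) (q X (N, y, t))"
    if "X \<in> Met" "(M, x, s) \<in> P X" "(N, y, t) \<in> P X" "B \<in> Met" "\<alpha> \<in> cocones F X B"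
    for X M N x y s t B \<alpha>
  proof -
    have "(B, \<lambda>(N, x, t). \<alpha> N x t) \<in> I X" using that by (auto simp: I_def)
    then show ?thesis unfolding dist[OF that(1-3)] by (rule SUP_upper2) simp
  qed
  have q_eqI: "q X (M, x, s) = q X (N, y, t)"
    if X: "X \<in> Met" and P: "(M, x, s) \<in> P X" "(N, y, t) \<in> P X"
      and eq: "\<And>B \<alpha>. B \<in> Met \<Longrightarrow> \<alpha> \<in> cocones F X B \<Longrightarrow> \<alpha> M x s = \<alpha> N y t"
    for X M N x y s t
  proof (rule edist_eq_0[OF Q[OF X] q_pts[OF X P(1)] q_pts[OF X P(2)]])
    have "edist (Q X) (q X (M, x, s)) (q X (N, y, t)) \<le> 0"
    proof (rule dist_le[OF X P])
      fix B \<alpha> assume B: "B \<in> Met" "\<alpha> \<in> cocones F X B"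
      have "\<alpha> N y t \<in> pts B" using P B by (auto simp: P_def Hom_pts[OF cocones_Hom])
      then show "edist B (\<alpha> M x s) (\<alpha> N y t) \<le> 0" using eq[OF B] edist_self[OF B(1)] by simp
    qed
    then show "edist (Q X) (q X (M, x, s)) (q X (N, y, t)) = 0" by simp
  qed
  \<comment> \<open>a cocone on \<open>Y\<close> pulls back along a map \<open>X \<rightarrow> Y\<close>\<close>
  have pull: "(\<lambda>N\<in>Set_fp. \<lambda>x\<in>Hom N X. \<lambda>t\<in>pts (Ob F N). \<alpha> N (compose (pts N) f x) t) \<in> cocones F X B"
    if f: "f \<in> Hom X Y" and \<alpha>: "\<alpha> \<in> cocones F Y B" for X Y B f \<alpha>
  proof (rule coconesI[OF F])
    fix N :: "'u emet" and x assume N: "N \<in> Set_fp" and x: "x \<in> Hom N X"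
    from cocones_Hom[OF \<alpha> N compose_Hom[OF x f]]
    show "restrict (\<alpha> N (compose (pts N) f x)) (pts (Ob F N)) \<in> Hom (Ob F N) B"
      by (simp add: restrict_Hom)
    fix y t assume y: "y \<in> Hom N X" and t: "t \<in> pts (Ob F N)"
    have "hom_dist N Y (compose (pts N) f x) (compose (pts N) f y) \<le> hom_dist N X x y"
      using f x y by (rule hom_dist_postcompose_le)
    then show "edist B (\<alpha> N (compose (pts N) f x) t) (\<alpha> N (compose (pts N) f y) t) \<le> hom_dist N X x y"
      using cocones_edist[OF \<alpha> N compose_Hom[OF x f] compose_Hom[OF y f] t] by (rule order_trans[rotated])
  next
    fix M N :: "'u emet" and h x t
    assume *: "M \<in> Set_fp" "N \<in> Set_fp" "h \<in> Hom M N" "x \<in> Hom N X" "t \<in> pts (Ob F M)"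
    have "compose (pts M) f (compose (pts M) x h) = compose (pts M) (compose (pts N) f x) h"
      using Hom_pts[OF *(3)] by (auto simp: compose_def fun_eq_iff)
    then show "\<alpha> M (compose (pts M) f (compose (pts M) x h)) t
        = \<alpha> N (compose (pts N) f x) (Ar F M N h t)"
      using cocones_natural[OF \<alpha> *(1-3) compose_Hom[OF *(4) f] *(5)] by simp
  qed
  have map_dist: "edist (Q Y) (q Y (M, compose (pts M) f x, s)) (q Y (N, compose (pts N) f y, t))
      \<le> edist (Q X) (q X (M, x, s)) (q X (N, y, t))"
    if "X \<in> Met" "Y \<in> Met" "f \<in> Hom X Y" "(M, x, s) \<in> P X" "(N, y, t) \<in> P X" for X Y f M N x y s t
  proof (rule dist_le[OF that(2)])
    show "(M, compose (pts M) f x, s) \<in> P Y" "(N, compose (pts N) f y, t) \<in> P Y"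
      using that compose_Hom by (auto simp: P_def)
    fix B \<alpha> assume B: "B \<in> Met" and \<alpha>: "\<alpha> \<in> cocones F Y B"
    show "edist B (\<alpha> M (compose (pts M) f x) s) (\<alpha> N (compose (pts N) f y) t)
      \<le> edist (Q X) (q X (M, x, s)) (q X (N, y, t))"
      using dist_ge[OF that(1,4,5) B pull[OF that(3) \<alpha>]] that(4,5) by (simp add: P_def)
  qed
  define L where "L = \<lparr>Ob = Q, Ar = (\<lambda>X Y f. \<lambda>p\<in>pts (Q X).
    let (N, x, t) = inv_into (P X) (q X) p in q Y (N, compose (pts N) f x, t))\<rparr>"
  have L_Ob: "Ob L = Q" by (simp add: L_def)
  have L_Ar: "Ar L X Y f (q X (N, x, t)) = q Y (N, compose (pts N) f x, t)"
    if X: "X \<in> Met" and Y: "Y \<in> Met" and f: "f \<in> Hom X Y"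
      and Nxt: "N \<in> Set_fp" "x \<in> Hom N X" "t \<in> pts (Ob F N)" for X Y f N x t
  proof -
    obtain M y s where inv: "inv_into (P X) (q X) (q X (N, x, t)) = (M, y, s)"
      by (metis prod_cases3)
    have a: "(N, x, t) \<in> P X" using Nxt by (rule PI)
    then have b: "(M, y, s) \<in> P X" and eq: "q X (M, y, s) = q X (N, x, t)"
      using inv inv_into_into[of "q X (N, x, t)" "q X" "P X"] f_inv_into_f[of "q X (N, x, t)" "q X" "P X"]
      by auto
    have "edist (Q Y) (q Y (M, compose (pts M) f y, s)) (q Y (N, compose (pts N) f x, t)) \<le> 0"
      using map_dist[OF X Y f b a] eq edist_self[OF Q[OF X] q_pts[OF X a]] by simp
    then have "q Y (M, compose (pts M) f y, s) = q Y (N, compose (pts N) f x, t)"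
      using a b f by (intro edist_eq_0[OF Q[OF Y]] q_pts[OF Y]) (auto simp: P_def compose_Hom)
    then show ?thesis
      using q_pts[OF X a] by (simp add: L_def inv)
  qed
  have L_Hom: "Ar L X Y f \<in> Hom (Q X) (Q Y)" if X: "X \<in> Met" and Y: "Y \<in> Met" and f: "f \<in> Hom X Y" for X Y f
  proof -
    have "restrict (Ar L X Y f) (pts (Q X)) \<in> Hom (Q X) (Q Y)"
    proof (rule HomI)
      fix p assume "p \<in> pts (Q X)"
      then obtain M x s where a: "M \<in> Set_fp" "x \<in> Hom M X" "s \<in> pts (Ob F M)" "p = q X (M, x, s)"
        using q_cases[OF X] by blast
      then show "Ar L X Y f p \<in> pts (Q Y)"
        using L_Ar[OF X Y f] f by (simp add: q_pts[OF Y] PI compose_Hom)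
      fix p' assume "p' \<in> pts (Q X)"
      then obtain N y t where b: "N \<in> Set_fp" "y \<in> Hom N X" "t \<in> pts (Ob F N)" "p' = q X (N, y, t)"
        using q_cases[OF X] by blast
      show "edist (Q Y) (Ar L X Y f p) (Ar L X Y f p') \<le> edist (Q X) p p'"
        using a b by (simp add: L_Ar[OF X Y f] map_dist[OF X Y f] PI)
    qed
    moreover have "restrict (Ar L X Y f) (pts (Q X)) = Ar L X Y f"
      by (auto simp: L_def)
    ultimately show ?thesis by simp
  qed
  have L: "enriched_functor Met L"
  proof (rule enriched_functorI; unfold L_Ob)
    fix X :: "'u emet" and t assume X: "X \<in> Met" and "t \<in> pts (Q X)"
    then obtain N x s where *: "N \<in> Set_fp" "x \<in> Hom N X" "s \<in> pts (Ob F N)" "t = q X (N, x, s)"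
      using q_cases[OF X] by blast
    have "compose (pts N) (Id_on_space X) x = x"
      using *(2) by (intro Hom_eqI[OF compose_Hom[OF *(2) Id_Hom] *(2)])
        (simp add: compose_app Id_on_space_app Hom_pts)
    then show "Ar L X X (Id_on_space X) t = t"
      using L_Ar[OF X X Id_Hom *(1-3)] *(4) by simp
  next
    fix X Y Z :: "'u emet" and f g t
    assume X: "X \<in> Met" and Y: "Y \<in> Met" and Z: "Z \<in> Met"
      and f: "f \<in> Hom X Y" and g: "g \<in> Hom Y Z" and "t \<in> pts (Q X)"
    then obtain N x s where *: "N \<in> Set_fp" "x \<in> Hom N X" "s \<in> pts (Ob F N)" "t = q X (N, x, s)"
      using q_cases[OF X] by blast
    have "compose (pts N) (compose (pts X) g f) x = compose (pts N) g (compose (pts N) f x)"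
      using Hom_pts[OF *(2)] by (auto simp: compose_def fun_eq_iff)
    then show "Ar L X Z (compose (pts X) g f) t = Ar L Y Z g (Ar L X Y f t)"
      using *(1-3) by (simp add: *(4) L_Ar[OF X Z compose_Hom[OF f g]] L_Ar[OF X Y f]
        L_Ar[OF Y Z g] compose_Hom[OF _ f])
  next
    fix X Y :: "'u emet" and f g t
    assume X: "X \<in> Met" and Y: "Y \<in> Met"
      and f: "f \<in> Hom X Y" and g: "g \<in> Hom X Y" and "t \<in> pts (Q X)"
    then obtain N x s where *: "N \<in> Set_fp" "x \<in> Hom N X" "s \<in> pts (Ob F N)" "t = q X (N, x, s)"
      using q_cases[OF X] by blast
    have fx: "compose (pts N) f x \<in> Hom N Y" and gx: "compose (pts N) g x \<in> Hom N Y"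
      using * f g compose_Hom by blast+
    have "edist (Q Y) (q Y (N, compose (pts N) f x, s)) (q Y (N, compose (pts N) g x, s)) \<le> hom_dist X Y f g"
    proof (rule dist_le[OF Y PI[OF *(1) fx *(3)] PI[OF *(1) gx *(3)]])
      fix B \<alpha> assume "\<alpha> \<in> cocones F Y B"
      then show "edist B (\<alpha> N (compose (pts N) f x) s) (\<alpha> N (compose (pts N) g x) s) \<le> hom_dist X Y f g"
        using cocones_edist[OF _ *(1) fx gx *(3)] hom_dist_precompose_le[OF *(2)] order_trans by blast
    qed
    then show "edist (Q Y) (Ar L X Y f t) (Ar L X Y g t) \<le> hom_dist X Y f g"
      using *(1-3) by (simp add: *(4) L_Ar[OF X Y f] L_Ar[OF X Y g])
  qed (use Q L_Hom in auto)
  define \<kappa> where "\<kappa> N t = q N (N, Id_on_space N, t)" for N t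
  have \<kappa>_pts: "\<kappa> N t \<in> pts (Q N)" if "N \<in> Set_fp" "t \<in> pts (Ob F N)" for N t
    using that by (simp add: \<kappa>_def q_pts Set_fp_Met PI Id_Hom)
  have L_\<kappa>: "Ar L N X x (\<kappa> N t) = q X (N, x, t)"
    if X: "X \<in> Met" and *: "N \<in> Set_fp" "x \<in> Hom N X" "t \<in> pts (Ob F N)" for X N x t
  proof -
    have "compose (pts N) x (Id_on_space N) = x"
      using *(2) by (intro Hom_eqI[OF compose_Hom[OF Id_Hom *(2)] *(2)])
        (simp add: compose_app Id_on_space_app Hom_pts)
    then show ?thesis
      using L_Ar[OF Set_fp_Met[OF *(1)] X *(2) *(1) Id_Hom *(3)] by (simp add: \<kappa>_def)
  qed
  \<comment> \<open>\<open>N\<close> itself is an object of \<open>Set_fp\<close>, hence every point of \<open>L N\<close> is a value of \<open>\<kappa>\<close>\<close>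
  have q_fp: "q N (M, h, t) = \<kappa> N (Ar F M N h t)"
    if *: "M \<in> Set_fp" "N \<in> Set_fp" "h \<in> Hom M N" "t \<in> pts (Ob F M)" for M N h t
    unfolding \<kappa>_def
  proof (rule q_eqI)
    show "N \<in> Met" using * by (simp add: Set_fp_Met)
    show "(M, h, t) \<in> P N" using * by (simp add: PI)
    show "(N, Id_on_space N, Ar F M N h t) \<in> P N"
      using * Hom_pts[OF functor_Hom[OF F]] by (simp add: PI Id_Hom)
    fix B \<alpha> assume \<alpha>: "\<alpha> \<in> cocones F N B"
    have "compose (pts M) (Id_on_space N) h = h"
      using *(3) by (intro Hom_eqI[OF compose_Hom[OF *(3) Id_Hom] *(3)])
        (simp add: compose_app Id_on_space_app Hom_pts)
    then show "\<alpha> M h t = \<alpha> N (Id_on_space N) (Ar F M N h t)"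
      using cocones_natural[OF \<alpha> *(1-3) Id_Hom *(4)] by simp
  qed
  have \<kappa>_onto: "\<kappa> N ` pts (Ob F N) = pts (Q N)" if N: "N \<in> Set_fp" for N
  proof
    show "\<kappa> N ` pts (Ob F N) \<subseteq> pts (Q N)" using \<kappa>_pts N by blast
    show "pts (Q N) \<subseteq> \<kappa> N ` pts (Ob F N)"
    proof
      fix p assume "p \<in> pts (Q N)"
      then obtain M h t where *: "M \<in> Set_fp" "h \<in> Hom M N" "t \<in> pts (Ob F M)" "p = q N (M, h, t)"
        using q_cases[OF Set_fp_Met[OF N]] by blast
      then show "p \<in> \<kappa> N ` pts (Ob F N)"
        using q_fp[OF *(1) N *(2,3)] Hom_pts[OF functor_Hom[OF F *(1) N *(2)] *(3)] by blast
    qed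
  qed
  have \<kappa>_iso: "edist (Q N) (\<kappa> N s) (\<kappa> N t) = edist (Ob F N) s t"
    if N: "N \<in> Set_fp" and st: "s \<in> pts (Ob F N)" "t \<in> pts (Ob F N)" for N s t
  proof (rule antisym)
    show "edist (Q N) (\<kappa> N s) (\<kappa> N t) \<le> edist (Ob F N) s t"
      unfolding \<kappa>_def using N st
      by (intro dist_le) (auto simp: Set_fp_Met PI Id_Hom Hom_edist[OF cocones_Hom])
    \<comment> \<open>the values of \<open>F\<close> themselves form a cocone\<close>
    have "(\<lambda>M\<in>Set_fp. \<lambda>h\<in>Hom M N. \<lambda>t\<in>pts (Ob F M). Ar F M N h t) \<in> cocones F N (Ob F N)"
    proof (rule coconesI[OF F])
      fix M :: "'u emet" and h assume "M \<in> Set_fp" "h \<in> Hom M N"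
      then show "restrict (Ar F M N h) (pts (Ob F M)) \<in> Hom (Ob F M) (Ob F N)"
        using functor_Hom[OF F _ N, of M h] by (simp add: restrict_Hom)
    qed (use N functor_edist[OF F] functor_compose[OF F] in auto)
    from dist_ge[OF Set_fp_Met[OF N] PI[OF N Id_Hom st(1)] PI[OF N Id_Hom st(2)] functor_Met[OF F N] this]
    show "edist (Ob F N) s t \<le> edist (Q N) (\<kappa> N s) (\<kappa> N t)"
      using N st by (simp add: \<kappa>_def Id_Hom functor_id[OF F])
  qed
  have \<kappa>_nat: "Ar L M N h (\<kappa> M t) = \<kappa> N (Ar F M N h t)"
    if "M \<in> Set_fp" "N \<in> Set_fp" "h \<in> Hom M N" "t \<in> pts (Ob F M)" for M N h t
    using that L_\<kappa> q_fp by (simp add: Set_fp_Met)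
  have Lfp: "enriched_functor Set_fp L"
    using L enriched_functor_subset Set_fp_Met by blast
  have gen: "\<exists>N\<in>Set_fp. \<exists>x\<in>Hom N X. \<exists>t\<in>pts (Ob F N). p = Ar L N X x (\<kappa> N t)"
    if X: "X \<in> Met" and p: "p \<in> pts (Q X)" for X p
    using q_cases[OF X p] L_\<kappa>[OF X] by metis
  have sf: "strongly_finitary L"
  proof (rule strongly_finitaryI[OF L])
    fix X :: "'u emet" and p assume "X \<in> Met" "p \<in> pts (Ob L X)"
    then show "\<exists>N\<in>Set_fp. \<exists>x\<in>Hom N X. \<exists>t\<in>pts (Ob L N). p = Ar L N X x t"
      using gen \<kappa>_pts by (fastforce simp: L_Ob)
  next
    fix X B :: "'u emet" and \<beta> and M N :: "'u emet" and x y s t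
    assume X: "X \<in> Met" and B: "B \<in> Met" and \<beta>: "\<beta> \<in> cocones L X B"
      and M: "M \<in> Set_fp" and N: "N \<in> Set_fp" and x: "x \<in> Hom M X" and y: "y \<in> Hom N X"
      and "s \<in> pts (Ob L M)" and "t \<in> pts (Ob L N)"
    then have "s \<in> \<kappa> M ` pts (Ob F M)" "t \<in> \<kappa> N ` pts (Ob F N)"
      by (simp_all add: L_Ob \<kappa>_onto)
    then obtain s' t' where s: "s' \<in> pts (Ob F M)" "s = \<kappa> M s'" and t: "t' \<in> pts (Ob F N)" "t = \<kappa> N t'"
      by blast
    let ?\<alpha> = "\<lambda>N\<in>Set_fp. \<lambda>x\<in>Hom N X. \<lambda>t\<in>pts (Ob F N). \<beta> N x (\<kappa> N t)"
    have "?\<alpha> \<in> cocones F X B"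
    proof (rule coconesI[OF F])
      fix N :: "'u emet" and x assume N: "N \<in> Set_fp" and x: "x \<in> Hom N X"
      have \<beta>x: "\<beta> N x \<in> Hom (Q N) B" using cocones_Hom[OF \<beta> N x] by (simp add: L_Ob)
      show "(\<lambda>t\<in>pts (Ob F N). \<beta> N x (\<kappa> N t)) \<in> Hom (Ob F N) B"
      proof (rule HomI)
        fix t s assume "t \<in> pts (Ob F N)" "s \<in> pts (Ob F N)"
        then show "edist B (\<beta> N x (\<kappa> N t)) (\<beta> N x (\<kappa> N s)) \<le> edist (Ob F N) t s"
          using Hom_edist[OF \<beta>x, of "\<kappa> N t" "\<kappa> N s"] \<kappa>_iso \<kappa>_pts N by simp
      qed (use Hom_pts[OF \<beta>x] \<kappa>_pts N in auto)
    next
      fix N :: "'u emet" and x y t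
      assume "N \<in> Set_fp" "x \<in> Hom N X" "y \<in> Hom N X" "t \<in> pts (Ob F N)"
      then show "edist B (\<beta> N x (\<kappa> N t)) (\<beta> N y (\<kappa> N t)) \<le> hom_dist N X x y"
        using cocones_edist[OF \<beta>] \<kappa>_pts by (simp add: L_Ob)
    next
      fix M N :: "'u emet" and h x t
      assume *: "M \<in> Set_fp" "N \<in> Set_fp" "h \<in> Hom M N" "x \<in> Hom N X" "t \<in> pts (Ob F M)"
      then show "\<beta> M (compose (pts M) x h) (\<kappa> M t) = \<beta> N x (\<kappa> N (Ar F M N h t))"
        using cocones_natural[OF \<beta> *(1-4), of "\<kappa> M t"] \<kappa>_pts \<kappa>_nat by (simp add: L_Ob)
    qed
    from dist_ge[OF X PI[OF M x s(1)] PI[OF N y t(1)] B this]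
    show "edist B (\<beta> M x s) (\<beta> N y t) \<le> edist (Ob L X) (Ar L M X x s) (Ar L N X y t)"
      using M N x y s t by (simp add: L_\<kappa>[OF X] L_Ob)
  qed
  have univ: "\<exists>f\<in>Hom (Ob L X) B. \<forall>N\<in>Set_fp. \<forall>x\<in>Hom N X. \<forall>t\<in>pts (Ob F N).
      f (Ar L N X x (\<kappa> N t)) = \<alpha> N x t"
    if X: "X \<in> Met" and B: "B \<in> Met" and \<alpha>: "\<alpha> \<in> cocones F X B" for X B \<alpha>
  proof -
    define v where "v = (\<lambda>(N, x, t). \<alpha> N x t)"
    define f where "f p = v (inv_into (P X) (q X) p)" for p
    have v: "v a \<in> pts B" if "a \<in> P X" for a
      using that by (auto simp: v_def P_def Hom_pts[OF cocones_Hom[OF \<alpha>]])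
    have v_dist: "edist B (v a) (v b) \<le> edist (Q X) (q X a) (q X b)" if "a \<in> P X" "b \<in> P X" for a b
      using that dist_ge[OF X _ _ B \<alpha>] by (cases a; cases b) (simp add: v_def)
    have inv: "inv_into (P X) (q X) p \<in> P X \<and> q X (inv_into (P X) (q X) p) = p" if "p \<in> pts (Q X)" for p
      using that q[OF X] by (metis f_inv_into_f inv_into_into)
    have "restrict f (pts (Q X)) \<in> Hom (Q X) B"
    proof (rule HomI)
      fix p p' assume p: "p \<in> pts (Q X)" and p': "p' \<in> pts (Q X)"
      then show "edist B (f p) (f p') \<le> edist (Q X) p p'"
        using v_dist[OF inv[OF p, THEN conjunct1] inv[OF p', THEN conjunct1]] inv by (simp add: f_def)
    qed (use v inv in \<open>simp add: f_def\<close>)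
    moreover have "f (q X a) = v a" if a: "a \<in> P X" for a
    proof -
      have "edist B (f (q X a)) (v a) \<le> 0"
        using v_dist[of "inv_into (P X) (q X) (q X a)" a] inv[OF q_pts[OF X a]] a
          edist_self[OF Q[OF X] q_pts[OF X a]] by (simp add: f_def)
      then show ?thesis
        using edist_eq_0[OF B] v inv[OF q_pts[OF X a]] a by (simp add: f_def)
    qed
    ultimately show ?thesis
      by (intro bexI[of _ "restrict f (pts (Q X))"])
        (auto simp: L_Ob L_\<kappa>[OF X] PI q_pts[OF X] v_def)
  qed
  show thesis
    by (rule that[of L \<kappa>]) (use sf \<kappa>_onto \<kappa>_iso \<kappa>_nat univ in \<open>auto simp: L_Ob\<close>)
qed


section \<open>Finite powers\<close>

lemma power_space_edist_le_iff:
  "edist (power_space A n) xs ys \<le> c \<longleftrightarrow> (\<forall>i<n. edist A (xs ! i) (ys ! i) \<le> c)"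
  by (auto simp: power_space_def SUP_le_iff)

lemma pts_power_space: "pts (power_space A n) = {xs. length xs = n \<and> set xs \<subseteq> pts A}"
  by (simp add: power_space_def)

lemma nth_in_pts: "xs \<in> pts (power_space A n) \<Longrightarrow> i < n \<Longrightarrow> xs ! i \<in> pts A"
  by (auto simp: pts_power_space)

lemma extended_metric_power_space:
  assumes A: "extended_metric A"
  shows "extended_metric (power_space A n)"
  unfolding extended_metric_def
proof (intro conjI ballI)
  fix xs ys assume xy: "xs \<in> pts (power_space A n)" "ys \<in> pts (power_space A n)"
  have "edist (power_space A n) xs ys \<le> 0 \<longleftrightarrow> (\<forall>i<n. xs ! i = ys ! i)"
    unfolding power_space_edist_le_iff using A nth_in_pts[OF xy(1)] nth_in_pts[OF xy(2)]
    by (simp add: extended_metric_def)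
  then show "edist (power_space A n) xs ys = 0 \<longleftrightarrow> xs = ys"
    using xy by (auto simp: pts_power_space intro: nth_equalityI)
  have "edist A (xs ! i) (ys ! i) = edist A (ys ! i) (xs ! i)" if "i < n" for i
    using A nth_in_pts[OF xy(1) that] nth_in_pts[OF xy(2) that] unfolding extended_metric_def by blast
  then show "edist (power_space A n) xs ys = edist (power_space A n) ys xs"
    by (simp add: power_space_def)
  fix zs assume z: "zs \<in> pts (power_space A n)"
  show "edist (power_space A n) xs zs \<le> edist (power_space A n) xs ys + edist (power_space A n) ys zs"
    unfolding power_space_edist_le_iff
  proof (intro allI impI)
    fix i assume i: "i < n"
    have "edist A (xs ! i) (zs ! i) \<le> edist A (xs ! i) (ys ! i) + edist A (ys ! i) (zs ! i)"
      using A nth_in_pts[OF xy(1) i] nth_in_pts[OF xy(2) i] nth_in_pts[OF z i]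
      unfolding extended_metric_def by blast
    also have "\<dots> \<le> edist (power_space A n) xs ys + edist (power_space A n) ys zs"
      using i by (auto simp: power_space_def intro!: add_mono SUP_upper)
    finally show "edist A (xs ! i) (zs ! i)
        \<le> edist (power_space A n) xs ys + edist (power_space A n) ys zs" .
  qed
qed

text \<open>A functor on \<open>Met\<close> takes values in spaces of elements of \<open>'u\<close>, so the lists that form a
  power are coded as such elements.\<close>

lemma tuple_code_exists:
  assumes U: "universe TYPE('u)"
  shows "\<exists>e :: 'u list \<Rightarrow> 'u. \<forall>n. inj_on e {xs. length xs = n}"
proof -
  have "|UNIV :: ('u \<times> 'u) set| \<le>o |UNIV :: 'u set|"
    using card_of_Times_same_infinite[OF infinite_universe[OF U]] ordIso_iff_ordLeq by auto
  then obtain p :: "'u \<times> 'u \<Rightarrow> 'u" where p: "inj p"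
    unfolding card_of_ordLeq[symmetric] by blast
  define e where "e = (\<lambda>xs. foldr (\<lambda>x r. p (x, r)) xs undefined)"
  have "inj_on e {xs. length xs = n}" for n
  proof (induction n)
    case (Suc n)
    show ?case
    proof (rule inj_onI, clarsimp)
      fix xs ys assume "length xs = Suc n" "length ys = Suc n" "e xs = e ys"
      moreover from this obtain x xs' y ys' where
        xs: "xs = x # xs'" "length xs' = n" and ys: "ys = y # ys'" "length ys' = n"
        by (auto simp: length_Suc_conv)
      ultimately have "p (x, e xs') = p (y, e ys')" by (simp add: e_def)
      then have "x = y" "e xs' = e ys'" using injD[OF p] by blast+
      then show "xs = ys" using inj_onD[OF Suc, of xs' ys'] xs ys by simp
    qed
  qed (auto intro: inj_onI)
  then show ?thesis by blast
qed

definition tuple_code :: "'u list \<Rightarrow> 'u" where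
  "tuple_code = (SOME e. \<forall>n. inj_on e {xs. length xs = n})"

definition tuple_decode :: "nat \<Rightarrow> 'u \<Rightarrow> 'u list" where
  "tuple_decode n = inv_into {xs. length xs = n} tuple_code"

lemma tuple_decode_code:
  fixes xs :: "'u list"
  assumes "universe TYPE('u)" "length xs = n"
  shows "tuple_decode n (tuple_code xs) = xs"
proof -
  have "\<forall>n. inj_on (tuple_code :: 'u list \<Rightarrow> 'u) {xs. length xs = n}"
    unfolding tuple_code_def using tuple_code_exists[OF assms(1)] by (rule someI_ex)
  then show ?thesis unfolding tuple_decode_def using assms(2) by (simp add: inv_into_f_f)
qed

definition power_functor :: "nat \<Rightarrow> 'u met_functor" where
  "power_functor n =
     \<lparr>Ob = (\<lambda>A. \<lparr>pts = tuple_code ` pts (power_space A n),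
                  edist = (\<lambda>p q. edist (power_space A n) (tuple_decode n p) (tuple_decode n q))\<rparr>),
      Ar = (\<lambda>A B f. \<lambda>p\<in>tuple_code ` pts (power_space A n). tuple_code (map f (tuple_decode n p)))\<rparr>"

lemma pts_power_functor: "pts (Ob (power_functor n) A) = tuple_code ` pts (power_space A n)"
  by (simp add: power_functor_def)

lemma edist_power_functor:
  fixes A :: "'u emet"
  assumes "universe TYPE('u)" "length xs = n" "length ys = n"
  shows "edist (Ob (power_functor n) A) (tuple_code xs) (tuple_code ys) = edist (power_space A n) xs ys"
  using assms by (simp add: power_functor_def tuple_decode_code)

lemma Ar_power_functor:
  fixes A :: "'u emet"
  assumes "universe TYPE('u)" "xs \<in> pts (power_space A n)"
  shows "Ar (power_functor n) A B f (tuple_code xs) = tuple_code (map f xs)"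
  using assms by (auto simp: power_functor_def tuple_decode_code pts_power_space)

lemma map_in_power_space:
  assumes "f \<in> Hom A B" "xs \<in> pts (power_space A n)"
  shows "map f xs \<in> pts (power_space B n)"
  using assms by (auto simp: pts_power_space Hom_pts subset_iff)

lemma enriched_functor_power:
  assumes U: "universe TYPE('u)"
  shows "enriched_functor Met (power_functor n :: 'u met_functor)"
proof (rule enriched_functorI; (unfold pts_power_functor)?)
  fix A :: "'u emet" assume A: "A \<in> Met"
  have "small TYPE('u) (pts (Ob (power_functor n) A))"
    using A by (auto simp: pts_power_functor pts_power_space Met_def intro!: small_image small_lists U)
  moreover have "extended_metric (Ob (power_functor n) A)"
  proof -
    have "extended_metric (power_space A n)"
      using A by (intro extended_metric_power_space) (simp add: Met_def)
    moreover have "inj_on tuple_code (pts (power_space A n))"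
      by (rule inj_on_inverseI[of _ "tuple_decode n"])
        (simp add: tuple_decode_code[OF U] pts_power_space)
    then have "tuple_code xs = tuple_code ys \<longleftrightarrow> xs = ys"
      if "xs \<in> pts (power_space A n)" "ys \<in> pts (power_space A n)" for xs ys
      using that by (rule inj_on_eq_iff)
    moreover have "edist (Ob (power_functor n) A) (tuple_code xs) (tuple_code ys) = edist (power_space A n) xs ys"
      if "xs \<in> pts (power_space A n)" "ys \<in> pts (power_space A n)" for xs ys
      using that by (simp add: edist_power_functor[OF U] pts_power_space)
    ultimately show ?thesis
      unfolding extended_metric_def pts_power_functor ball_simps by simp
  qed
  ultimately show "Ob (power_functor n) A \<in> Met" by (simp add: Met_def)
next
  fix A B :: "'u emet" and f assume f: "f \<in> Hom A B"
  have "restrict (Ar (power_functor n) A B f) (pts (Ob (power_functor n) A))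
      \<in> Hom (Ob (power_functor n) A) (Ob (power_functor n) B)"
  proof (rule HomI; unfold pts_power_functor; elim imageE; hypsubst)
    fix xs assume x: "xs \<in> pts (power_space A n)"
    then show "Ar (power_functor n) A B f (tuple_code xs) \<in> tuple_code ` pts (power_space B n)"
      using map_in_power_space[OF f] by (simp add: Ar_power_functor[OF U])
    fix ys assume y: "ys \<in> pts (power_space A n)"
    have "edist (power_space B n) (map f xs) (map f ys) \<le> edist (power_space A n) xs ys"
      unfolding power_space_edist_le_iff
    proof (intro allI impI)
      fix i assume i: "i < n"
      have "edist B (f (xs ! i)) (f (ys ! i)) \<le> edist A (xs ! i) (ys ! i)"
        using Hom_edist[OF f nth_in_pts[OF x i] nth_in_pts[OF y i]] .
      also have "\<dots> \<le> edist (power_space A n) xs ys"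
        using i by (auto simp: power_space_def intro!: SUP_upper)
      finally show "edist B (map f xs ! i) (map f ys ! i) \<le> edist (power_space A n) xs ys"
        using x y i by (simp add: pts_power_space)
    qed
    then show "edist (Ob (power_functor n) B) (Ar (power_functor n) A B f (tuple_code xs))
        (Ar (power_functor n) A B f (tuple_code ys)) \<le> edist (Ob (power_functor n) A) (tuple_code xs) (tuple_code ys)"
      using x y by (simp add: Ar_power_functor[OF U] edist_power_functor[OF U] pts_power_space)
  qed
  moreover have "restrict (Ar (power_functor n) A B f) (pts (Ob (power_functor n) A)) = Ar (power_functor n) A B f"
    by (simp add: pts_power_functor) (auto simp: power_functor_def)
  ultimately show "Ar (power_functor n) A B f \<in> Hom (Ob (power_functor n) A) (Ob (power_functor n) B)"
    by simp
next
  fix A :: "'u emet" and t assume "t \<in> tuple_code ` pts (power_space A n)"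
  then obtain xs where x: "xs \<in> pts (power_space A n)" and t: "t = tuple_code xs" by blast
  have "map (Id_on_space A) xs = xs"
    using x by (intro map_idI) (auto simp: pts_power_space Id_on_space_app)
  then show "Ar (power_functor n) A A (Id_on_space A) t = t"
    by (simp add: t Ar_power_functor[OF U x])
next
  fix A B C :: "'u emet" and f g :: "'u \<Rightarrow> 'u" and t :: 'u
  assume f: "f \<in> Hom A B" and "t \<in> tuple_code ` pts (power_space A n)"
  then obtain xs where x: "xs \<in> pts (power_space A n)" and t: "t = tuple_code xs" by blast
  have "map (compose (pts A) g f) xs = map g (map f xs)"
    using x by (auto simp: pts_power_space compose_app subset_iff)
  then show "Ar (power_functor n) A C (compose (pts A) g f) t
      = Ar (power_functor n) B C g (Ar (power_functor n) A B f t)"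
    by (simp add: t Ar_power_functor[OF U x] Ar_power_functor[OF U map_in_power_space[OF f x]]
        del: map_map)
next
  fix A B :: "'u emet" and f g :: "'u \<Rightarrow> 'u" and t :: 'u
  assume "t \<in> tuple_code ` pts (power_space A n)"
  then obtain xs where x: "xs \<in> pts (power_space A n)" and t: "t = tuple_code xs" by blast
  have "edist (power_space B n) (map f xs) (map g xs) \<le> hom_dist A B f g"
    unfolding power_space_edist_le_iff
    using x by (auto simp: pts_power_space intro!: edist_le_hom_dist)
  then show "edist (Ob (power_functor n) B) (Ar (power_functor n) A B f t) (Ar (power_functor n) A B g t)
      \<le> hom_dist A B f g"
    using x by (simp add: t Ar_power_functor[OF U x] edist_power_functor[OF U] pts_power_space)
qed

text \<open>The \<open>n\<close>-th power is represented by the discrete space \<open>D\<close> on \<open>n\<close> points, with the list \<open>g\<close>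
  of these points as the universal element. By the Yoneda lemma a cocone \<open>\<alpha>\<close> is given by the values
  \<open>\<alpha> D u g\<close> for \<open>u : D \<rightarrow> X\<close>, and as a cocone it separates these values by at most the distance
  of the maps \<open>u\<close>, which is the distance in \<open>X\<^sup>n\<close>.\<close>

lemma strongly_finitary_power:
  assumes U: "universe TYPE('u)"
  shows "strongly_finitary (power_functor n :: 'u met_functor)"
proof -
  obtain \<iota> :: "nat \<Rightarrow> 'u" where \<iota>: "inj \<iota>"
    using infinite_countable_subset[OF infinite_universe[OF U]] by blast
  define D where "D = discrete (\<iota> ` {..<n})"
  define g where "g = map \<iota> [0..<n]"
  define tuple where "tuple xs = (\<lambda>i\<in>pts D. xs ! inv \<iota> i)" for xs :: "'u list"
  have D: "D \<in> Set_fp" unfolding D_def by (intro discrete_Set_fp U) simp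
  have g: "g \<in> pts (power_space D n)" by (auto simp: g_def D_def pts_power_space)
  have tuple_app: "tuple xs (\<iota> i) = xs ! i" if "i < n" for xs i
    using that \<iota> by (simp add: tuple_def D_def)
  have tuple: "tuple xs \<in> Hom D X" "Ar (power_functor n) D X (tuple xs) (tuple_code g) = tuple_code xs"
    if X: "X \<in> Met" and xs: "xs \<in> pts (power_space X n)" for X xs
  proof -
    show "tuple xs \<in> Hom D X"
      unfolding tuple_def using D X xs \<iota>
      by (intro Hom_discrete) (auto simp: D_def pts_power_space)
    have "map (tuple xs) g = xs"
      using xs by (intro nth_equalityI) (auto simp: g_def tuple_app pts_power_space)
    then show "Ar (power_functor n) D X (tuple xs) (tuple_code g) = tuple_code xs"
      by (simp add: Ar_power_functor[OF U g])
  qed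
  show ?thesis
  proof (rule strongly_finitaryI[OF enriched_functor_power[OF U]]; unfold pts_power_functor; (elim imageE; hypsubst)?)
    fix X :: "'u emet" and xs assume "X \<in> Met" "xs \<in> pts (power_space X n)"
    then show "\<exists>N\<in>Set_fp. \<exists>x\<in>Hom N X. \<exists>t\<in>tuple_code ` pts (power_space N n).
        tuple_code xs = Ar (power_functor n) N X x t"
      using tuple[of X xs] D g by (intro bexI[of _ D] bexI[of _ "tuple xs"] bexI[of _ "tuple_code g"]) auto
  next
    fix X B M N :: "'u emet" and \<alpha> x y ss ts
    assume \<alpha>: "\<alpha> \<in> cocones (power_functor n) X B" and M: "M \<in> Set_fp" and N: "N \<in> Set_fp"
      and x: "x \<in> Hom M X" and y: "y \<in> Hom N X"
      and ss: "ss \<in> pts (power_space M n)" and ts: "ts \<in> pts (power_space N n)"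
    have \<alpha>_eq: "\<alpha> N y (tuple_code ts) = \<alpha> D (compose (pts D) y (tuple ts)) (tuple_code g)"
      if "N \<in> Set_fp" "y \<in> Hom N X" "ts \<in> pts (power_space N n)" for N y ts
      using tuple[OF Set_fp_Met[OF that(1)] that(3)] cocones_natural[OF \<alpha> D that(1) _ that(2)] g
      by (simp add: pts_power_functor)
    have Hom: "compose (pts D) y (tuple ts) \<in> Hom D X"
      if "N \<in> Set_fp" "y \<in> Hom N X" "ts \<in> pts (power_space N n)" for N y ts
      using tuple(1)[OF Set_fp_Met[OF that(1)] that(3)] that(2) by (rule compose_Hom)
    have "edist B (\<alpha> M x (tuple_code ss)) (\<alpha> N y (tuple_code ts))
        \<le> hom_dist D X (compose (pts D) x (tuple ss)) (compose (pts D) y (tuple ts))"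
      using cocones_edist[OF \<alpha> D Hom[OF M x ss] Hom[OF N y ts]] g
      by (simp add: \<alpha>_eq[OF M x ss] \<alpha>_eq[OF N y ts] pts_power_functor)
    also have "\<dots> \<le> edist (power_space X n) (map x ss) (map y ts)"
      unfolding hom_dist_le_iff
    proof
      fix a assume "a \<in> pts D"
      then obtain i where i: "i < n" "a = \<iota> i" by (auto simp: D_def)
      have "edist X (map x ss ! i) (map y ts ! i) \<le> edist (power_space X n) (map x ss) (map y ts)"
        using i power_space_edist_le_iff by blast
      then show "edist X (compose (pts D) x (tuple ss) a) (compose (pts D) y (tuple ts) a)
          \<le> edist (power_space X n) (map x ss) (map y ts)"
        using i ss ts \<open>a \<in> pts D\<close> by (simp add: compose_app tuple_app pts_power_space)
    qed
    finally show "edist B (\<alpha> M x (tuple_code ss)) (\<alpha> N y (tuple_code ts))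
        \<le> edist (Ob (power_functor n) X) (Ar (power_functor n) M X x (tuple_code ss))
             (Ar (power_functor n) N X y (tuple_code ts))"
      using ss ts by (simp add: Ar_power_functor[OF U] edist_power_functor[OF U] pts_power_space)
  qed
qed


section \<open>Terms and homomorphisms\<close>

definition terms_in :: "'s signature \<Rightarrow> 'v set \<Rightarrow> ('s, 'v) trm set" where
  "terms_in \<Sigma> X = {t \<in> terms \<Sigma>. set2_trm t \<subseteq> X}"

lemma Var_in_terms_in: "v \<in> X \<Longrightarrow> Var v \<in> terms_in \<Sigma> X"
  by (auto simp: terms_in_def intro: terms.intros)

lemma App_in_terms_in:
  "\<sigma> \<in> ops \<Sigma> \<Longrightarrow> length ts = arity \<Sigma> \<sigma> \<Longrightarrow> set ts \<subseteq> terms_in \<Sigma> X \<Longrightarrow> App \<sigma> ts \<in> terms_in \<Sigma> X"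
  by (auto simp: terms_in_def intro: terms.intros)

lemma terms_in_induct [consumes 1, case_names Var App]:
  assumes "t \<in> terms_in \<Sigma> X"
    and "\<And>v. v \<in> X \<Longrightarrow> P (Var v)"
    and "\<And>\<sigma> ts. \<sigma> \<in> ops \<Sigma> \<Longrightarrow> length ts = arity \<Sigma> \<sigma> \<Longrightarrow> set ts \<subseteq> terms_in \<Sigma> X \<Longrightarrow>
      (\<And>t. t \<in> set ts \<Longrightarrow> P t) \<Longrightarrow> P (App \<sigma> ts)"
  shows "P t"
proof -
  have "t \<in> terms \<Sigma>" "set2_trm t \<subseteq> X" using assms(1) by (auto simp: terms_in_def)
  then show ?thesis
  proof (induction rule: terms.induct)
    case (2 \<sigma> ts)
    then show ?case by (intro assms(3)) (auto simp: terms_in_def)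
  qed (auto intro: assms(2))
qed

lemma finite_vars: "finite (set2_trm t)"
  by (induction t) auto

lemma small_terms_in:
  assumes U: "universe TYPE('u)" and ops: "small TYPE('u) (ops \<Sigma>)" and X: "small TYPE('u) X"
  shows "small TYPE('u) (terms_in \<Sigma> X)"
proof -
  \<comment> \<open>\<open>W k\<close> contains the terms of depth at most \<open>k\<close>\<close>
  define W where "W = rec_nat (Var ` X)
    (\<lambda>_ W. W \<union> (\<Union>\<sigma>\<in>ops \<Sigma>. App \<sigma> ` {ts. length ts = arity \<Sigma> \<sigma> \<and> set ts \<subseteq> W}))"
  have W_Suc: "W (Suc k) = W k \<union> (\<Union>\<sigma>\<in>ops \<Sigma>. App \<sigma> ` {ts. length ts = arity \<Sigma> \<sigma> \<and> set ts \<subseteq> W k})" for k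
    by (simp add: W_def)
  have small_Un: "small TYPE('u) (A \<union> B)" if "small TYPE('u) A" "small TYPE('u) B" for A B :: "('a, 'b) trm set"
    using small_UN[OF U, of "{True, False}" "\<lambda>b. if b then A else B"] that
    by (simp add: small_finite[OF U] Un_commute)
  have "small TYPE('u) (W k)" for k
  proof (induction k)
    case 0
    then show ?case by (simp add: W_def small_image X)
  next
    case (Suc k)
    then show ?case
      unfolding W_Suc by (intro small_Un small_UN small_image small_lists U ops)
  qed
  then have "small TYPE('u) (\<Union>k. W k)"
    by (intro small_UN U small_nat)
  moreover have "terms_in \<Sigma> X \<subseteq> (\<Union>k. W k)"
  proof
    fix t assume "t \<in> terms_in \<Sigma> X"
    then show "t \<in> (\<Union>k. W k)"
    proof (induction rule: terms_in_induct)
      case (Var v)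
      then show ?case by (auto simp: W_def intro: exI[of _ 0])
    next
      case (App \<sigma> ts)
      have mono: "W k \<subseteq> W l" if "k \<le> l" for k l
        using that by (induction rule: dec_induct) (auto simp: W_Suc)
      from App(4) have "\<forall>t. \<exists>k. t \<in> set ts \<longrightarrow> t \<in> W k" by blast
      then obtain k where k: "\<And>t. t \<in> set ts \<Longrightarrow> t \<in> W (k t)" by metis
      have "set ts \<subseteq> W (Max (k ` set ts))"
      proof
        fix t assume t: "t \<in> set ts"
        then have "k t \<le> Max (k ` set ts)" by simp
        then show "t \<in> W (Max (k ` set ts))" using k[OF t] mono by blast
      qed
      then have "App \<sigma> ts \<in> W (Suc (Max (k ` set ts)))"
        using App(1,2) by (auto simp: W_Suc)
      then show ?case by blast
    qed
  qed
  ultimately show ?thesis by (rule small_subset)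
qed

lemma qalg_Met: "quantitative_algebra \<Sigma> A \<Longrightarrow> und A \<in> Met"
  by (simp add: quantitative_algebra_def)

lemma qalg_opr_pts:
  "quantitative_algebra \<Sigma> A \<Longrightarrow> \<sigma> \<in> ops \<Sigma> \<Longrightarrow> xs \<in> pts (power_space (und A) (arity \<Sigma> \<sigma>)) \<Longrightarrow>
   opr A \<sigma> xs \<in> pts (und A)"
  by (auto simp: quantitative_algebra_def nonexpanding_def)

lemma qalg_opr_edist:
  assumes "quantitative_algebra \<Sigma> A" "\<sigma> \<in> ops \<Sigma>"
    "xs \<in> pts (power_space (und A) (arity \<Sigma> \<sigma>))" "ys \<in> pts (power_space (und A) (arity \<Sigma> \<sigma>))"
    "\<And>i. i < arity \<Sigma> \<sigma> \<Longrightarrow> edist (und A) (xs ! i) (ys ! i) \<le> c"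
  shows "edist (und A) (opr A \<sigma> xs) (opr A \<sigma> ys) \<le> c"
proof -
  have "edist (und A) (opr A \<sigma> xs) (opr A \<sigma> ys) \<le> edist (power_space (und A) (arity \<Sigma> \<sigma>)) xs ys"
    using assms by (simp add: quantitative_algebra_def nonexpanding_def)
  also have "\<dots> \<le> c" using assms(5) by (simp add: power_space_edist_le_iff)
  finally show ?thesis .
qed

lemma alg_hom_Hom: "h \<in> alg_hom \<Sigma> A B \<Longrightarrow> h \<in> Hom (und A) (und B)"
  by (simp add: alg_hom_def)

lemma alg_hom_opr:
  "h \<in> alg_hom \<Sigma> A B \<Longrightarrow> \<sigma> \<in> ops \<Sigma> \<Longrightarrow> xs \<in> pts (power_space (und A) (arity \<Sigma> \<sigma>)) \<Longrightarrow>
   h (opr A \<sigma> xs) = opr B \<sigma> (map h xs)"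
  by (simp add: alg_hom_def)

lemma alg_homI:
  assumes "h \<in> Hom (und A) (und B)"
    and "\<And>\<sigma> xs. \<sigma> \<in> ops \<Sigma> \<Longrightarrow> xs \<in> pts (power_space (und A) (arity \<Sigma> \<sigma>)) \<Longrightarrow>
      h (opr A \<sigma> xs) = opr B \<sigma> (map h xs)"
  shows "h \<in> alg_hom \<Sigma> A B"
  using assms by (simp add: alg_hom_def)

lemma alg_hom_Id:
  assumes "quantitative_algebra \<Sigma> A"
  shows "Id_on_space (und A) \<in> alg_hom \<Sigma> A A"
proof (rule alg_homI[OF Id_Hom])
  fix \<sigma> xs assume *: "\<sigma> \<in> ops \<Sigma>" "xs \<in> pts (power_space (und A) (arity \<Sigma> \<sigma>))"
  have "map (Id_on_space (und A)) xs = xs"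
    using *(2) by (intro map_idI) (auto simp: pts_power_space Id_on_space_app)
  then show "Id_on_space (und A) (opr A \<sigma> xs) = opr A \<sigma> (map (Id_on_space (und A)) xs)"
    using qalg_opr_pts[OF assms *] by (simp add: Id_on_space_app)
qed

lemma alg_hom_compose:
  assumes A: "quantitative_algebra \<Sigma> A" and g: "g \<in> alg_hom \<Sigma> A B" and h: "h \<in> alg_hom \<Sigma> B C"
  shows "compose (pts (und A)) h g \<in> alg_hom \<Sigma> A C"
proof (rule alg_homI[OF compose_Hom[OF alg_hom_Hom[OF g] alg_hom_Hom[OF h]]])
  fix \<sigma> xs assume *: "\<sigma> \<in> ops \<Sigma>" "xs \<in> pts (power_space (und A) (arity \<Sigma> \<sigma>))"
  have "map (compose (pts (und A)) h g) xs = map h (map g xs)"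
    using *(2) by (auto simp: pts_power_space compose_app subset_iff)
  then show "compose (pts (und A)) h g (opr A \<sigma> xs) = opr C \<sigma> (map (compose (pts (und A)) h g) xs)"
    using alg_hom_opr[OF h *(1) map_in_power_space[OF alg_hom_Hom[OF g] *(2)]]
    by (simp add: compose_app qalg_opr_pts[OF A *] alg_hom_opr[OF g *] del: map_map)
qed

lemma sharp_pts:
  assumes A: "quantitative_algebra \<Sigma> A" and t: "t \<in> terms_in \<Sigma> X" and f: "f \<in> X \<rightarrow> pts (und A)"
  shows "sharp A f t \<in> pts (und A)"
  using t
proof (induction rule: terms_in_induct)
  case (App \<sigma> ts)
  then show ?case
    by (auto intro!: qalg_opr_pts[OF A] simp: pts_power_space)
qed (use f in auto)

lemma sharp_cong: "(\<And>v. v \<in> set2_trm t \<Longrightarrow> f v = g v) \<Longrightarrow> sharp A f t = sharp A g t"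
proof (induction t)
  case (App \<sigma> ts)
  have "map (sharp A f) ts = map (sharp A g) ts"
  proof (rule map_cong[OF refl])
    fix t assume "t \<in> set ts"
    then show "sharp A f t = sharp A g t" using App by auto
  qed
  then show ?case by (simp del: map_eq_conv)
qed simp

lemma alg_hom_sharp:
  assumes A: "quantitative_algebra \<Sigma> A" and h: "h \<in> alg_hom \<Sigma> A B"
    and t: "t \<in> terms_in \<Sigma> X" and f: "f \<in> X \<rightarrow> pts (und A)"
  shows "h (sharp A f t) = sharp B (\<lambda>v. h (f v)) t"
  using t
proof (induction rule: terms_in_induct)
  case (App \<sigma> ts)
  have "map (sharp A f) ts \<in> pts (power_space (und A) (arity \<Sigma> \<sigma>))"
    using App sharp_pts[OF A _ f] by (auto simp: pts_power_space)
  moreover have "map h (map (sharp A f) ts) = map (sharp B (\<lambda>v. h (f v))) ts"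
    using App(4) by simp
  ultimately show ?case
    using alg_hom_opr[OF h App(1)] by (simp del: map_map)
qed simp

lemma sharp_edist_le:
  assumes A: "quantitative_algebra \<Sigma> A" and t: "t \<in> terms_in \<Sigma> X"
    and f: "f \<in> X \<rightarrow> pts (und A)" and g: "g \<in> X \<rightarrow> pts (und A)"
    and le: "\<And>v. v \<in> X \<Longrightarrow> edist (und A) (f v) (g v) \<le> c"
  shows "edist (und A) (sharp A f t) (sharp A g t) \<le> c"
  using t
proof (induction rule: terms_in_induct)
  case (App \<sigma> ts)
  have "map (sharp A k) ts \<in> pts (power_space (und A) (arity \<Sigma> \<sigma>))" if "k \<in> X \<rightarrow> pts (und A)" for k
    using App sharp_pts[OF A _ that] by (auto simp: pts_power_space)
  then show ?case
    using App f g by (auto intro!: qalg_opr_edist[OF A App(1)])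
qed (use le in simp)

primrec subst :: "('v \<Rightarrow> ('s, 'w) trm) \<Rightarrow> ('s, 'v) trm \<Rightarrow> ('s, 'w) trm" where
  "subst g (Var v) = g v"
| "subst g (App \<sigma> ts) = App \<sigma> (map (subst g) ts)"

lemma sharp_subst: "sharp A f (subst g t) = sharp A (\<lambda>v. sharp A f (g v)) t"
  by (induction t) (simp_all cong: map_cong)

lemma subst_in_terms_in:
  assumes "t \<in> terms_in \<Sigma> Y" "g \<in> Y \<rightarrow> terms_in \<Sigma> X"
  shows "subst g t \<in> terms_in \<Sigma> X"
  using assms(1)
proof (induction rule: terms_in_induct)
  case (App \<sigma> ts)
  then show ?case by (auto intro!: App_in_terms_in)
qed (use assms(2) in auto)


section \<open>Free algebras of a variety\<close>

locale quantitative_variety =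
  fixes \<Sigma> :: "'s signature" and E :: "'s qequation set" and \<V> :: "('s, 'u) qalg set"
  assumes universe: "universe TYPE('u)"
    and small_ops: "small TYPE('u) (ops \<Sigma>)"
    and equations: "E \<subseteq> quantitative_equations \<Sigma>"
    and models: "\<V> = {A. quantitative_algebra \<Sigma> A \<and> (\<forall>e\<in>E. satisfies A e)}"
begin

lemma model_qalg: "A \<in> \<V> \<Longrightarrow> quantitative_algebra \<Sigma> A"
  by (simp add: models)

lemma model_satisfies:
  "A \<in> \<V> \<Longrightarrow> (l, \<epsilon>, r) \<in> E \<Longrightarrow> f \<in> UNIV \<rightarrow> pts (und A) \<Longrightarrow>
   edist (und A) (sharp A f l) (sharp A f r) \<le> ennreal (real_of_rat \<epsilon>)"
  by (force simp: models)

lemma modelI: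
  assumes "quantitative_algebra \<Sigma> A"
    and "\<And>l \<epsilon> r f. (l, \<epsilon>, r) \<in> E \<Longrightarrow> l \<in> terms \<Sigma> \<Longrightarrow> r \<in> terms \<Sigma> \<Longrightarrow> f \<in> UNIV \<rightarrow> pts (und A) \<Longrightarrow>
      edist (und A) (sharp A f l) (sharp A f r) \<le> ennreal (real_of_rat \<epsilon>)"
  shows "A \<in> \<V>"
proof -
  have "satisfies A e" if "e \<in> E" for e
    using that equations assms(2) by (cases e) (auto simp: quantitative_equations_def)
  then show ?thesis using assms(1) by (simp add: models)
qed

text \<open>The free algebra consists of the terms, modulo distance \<open>0\<close>, with the least distance for which
  all interpretations in models are nonexpanding. As a supremum of distances in models, it satisfies the equations and makes
  the operations nonexpanding because this holds in every model.\<close>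

lemma free_algebra_exists:
  assumes X: "X \<in> Met"
  shows "\<exists>A \<eta>. free_algebra_on \<Sigma> \<V> X A \<eta>"
proof -
  let ?P = "terms_in \<Sigma> (pts X)"
  define I where "I = {(und B, sharp B f) | B f. B \<in> \<V> \<and> f \<in> Hom X (und B)}"
  have "\<exists>(Q :: 'u emet) q. Q \<in> Met \<and> q ` ?P = pts Q \<and>
      (\<forall>s\<in>?P. \<forall>t\<in>?P. edist Q (q s) (q t) = (SUP (B, v)\<in>I. edist B (v s) (v t)))"
  proof (rule metric_quotient)
    fix B v assume "(B, v) \<in> I"
    then show "B \<in> Met \<and> v \<in> ?P \<rightarrow> pts B"
      by (auto simp: I_def Hom_pts intro!: sharp_pts[OF model_qalg] qalg_Met[OF model_qalg])
  next
    show "small TYPE('u) ?P"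
      using X by (intro small_terms_in universe small_ops) (simp add: Met_def)
  qed auto
  then obtain Q :: "'u emet" and q where Q: "Q \<in> Met" and q: "q ` ?P = pts Q"
    and dist: "\<forall>s\<in>?P. \<forall>t\<in>?P. edist Q (q s) (q t) = (SUP (B, v)\<in>I. edist B (v s) (v t))"
    by blast
  have dist_le: "edist Q (q s) (q t) \<le> c"
    if "s \<in> ?P" "t \<in> ?P"
      "\<And>B f. B \<in> \<V> \<Longrightarrow> f \<in> Hom X (und B) \<Longrightarrow> edist (und B) (sharp B f s) (sharp B f t) \<le> c" for s t c
    unfolding dist[rule_format, OF that(1,2)] using that(3) by (auto simp: I_def intro!: SUP_least)
  have dist_ge: "edist (und B) (sharp B f s) (sharp B f t) \<le> edist Q (q s) (q t)"
    if "s \<in> ?P" "t \<in> ?P" "B \<in> \<V>" "f \<in> Hom X (und B)" for s t B f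
  proof -
    have "(und B, sharp B f) \<in> I" using that by (auto simp: I_def)
    then show ?thesis unfolding dist[rule_format, OF that(1,2)] by (rule SUP_upper2) simp
  qed
  define rep where "rep = inv_into ?P q"
  have rep: "rep p \<in> ?P" "q (rep p) = p" if "p \<in> pts Q" for p
    unfolding rep_def using that q by (simp_all add: inv_into_into f_inv_into_f)
  have q_pts: "q t \<in> pts Q" if "t \<in> ?P" for t using that q by blast
  define A where "A = \<lparr>und = Q, opr = (\<lambda>\<sigma> ps. q (App \<sigma> (map rep ps)))\<rparr>"
  have und: "und A = Q" by (simp add: A_def)
  have App_dist: "edist Q (q (App \<sigma> ss)) (q (App \<sigma> ts)) \<le> c"
    if \<sigma>: "\<sigma> \<in> ops \<Sigma>" and ss: "length ss = arity \<Sigma> \<sigma>" "set ss \<subseteq> ?P"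
      and ts: "length ts = arity \<Sigma> \<sigma>" "set ts \<subseteq> ?P"
      and le: "\<And>i. i < arity \<Sigma> \<sigma> \<Longrightarrow> edist Q (q (ss ! i)) (q (ts ! i)) \<le> c" for \<sigma> ss ts c
  proof (rule dist_le)
    fix B f assume B: "B \<in> \<V>" and f: "f \<in> Hom X (und B)"
    have *: "map (sharp B f) us \<in> pts (power_space (und B) (arity \<Sigma> \<sigma>))"
      if "length us = arity \<Sigma> \<sigma>" "set us \<subseteq> ?P" for us
      using that Hom_pts[OF f] by (auto simp: pts_power_space intro!: sharp_pts[OF model_qalg[OF B]])
    show "edist (und B) (sharp B f (App \<sigma> ss)) (sharp B f (App \<sigma> ts)) \<le> c"
      unfolding sharp.simps
    proof (rule qalg_opr_edist[OF model_qalg[OF B] \<sigma> *[OF ss] *[OF ts]])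
      fix i assume i: "i < arity \<Sigma> \<sigma>"
      then have "ss ! i \<in> ?P" "ts ! i \<in> ?P" using ss ts by (auto simp: subset_iff)
      then have "edist (und B) (sharp B f (ss ! i)) (sharp B f (ts ! i)) \<le> c"
        using dist_ge[OF _ _ B f] le[OF i] order_trans by blast
      then show "edist (und B) (map (sharp B f) ss ! i) (map (sharp B f) ts ! i) \<le> c"
        using i ss ts by simp
    qed
  qed (use \<sigma> ss ts in \<open>auto intro!: App_in_terms_in\<close>)
  have rep_list: "set (map rep ps) \<subseteq> ?P \<and> map q (map rep ps) = ps" if "set ps \<subseteq> pts Q" for ps
    using that rep by (auto intro!: map_idI)
  have A: "quantitative_algebra \<Sigma> A"
    unfolding quantitative_algebra_def nonexpanding_def und
  proof (intro conjI ballI funcsetI Q)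
    fix \<sigma> ps assume \<sigma>: "\<sigma> \<in> ops \<Sigma>" and ps: "ps \<in> pts (power_space Q (arity \<Sigma> \<sigma>))"
    then show "opr A \<sigma> ps \<in> pts Q"
      using rep(1) by (auto simp: A_def pts_power_space subset_iff intro!: q_pts App_in_terms_in)
    fix ps' assume ps': "ps' \<in> pts (power_space Q (arity \<Sigma> \<sigma>))"
    have "edist Q (q (App \<sigma> (map rep ps))) (q (App \<sigma> (map rep ps')))
        \<le> edist (power_space Q (arity \<Sigma> \<sigma>)) ps ps'"
    proof (rule App_dist[OF \<sigma>])
      fix i assume i: "i < arity \<Sigma> \<sigma>"
      then have "edist Q (ps ! i) (ps' ! i) \<le> edist (power_space Q (arity \<Sigma> \<sigma>)) ps ps'"
        using power_space_edist_le_iff by blast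
      then show "edist Q (q (map rep ps ! i)) (q (map rep ps' ! i))
          \<le> edist (power_space Q (arity \<Sigma> \<sigma>)) ps ps'"
        using i ps ps' rep(2) by (auto simp: pts_power_space subset_iff)
    qed (use ps ps' rep_list in \<open>auto simp: pts_power_space\<close>)
    then show "edist Q (opr A \<sigma> ps) (opr A \<sigma> ps') \<le> edist (power_space Q (arity \<Sigma> \<sigma>)) ps ps'"
      by (simp add: A_def)
  qed
  have opr_q: "opr A \<sigma> (map q ts) = q (App \<sigma> ts)"
    if \<sigma>: "\<sigma> \<in> ops \<Sigma>" and ts: "length ts = arity \<Sigma> \<sigma>" "set ts \<subseteq> ?P" for \<sigma> ts
  proof -
    have ps: "set (map q ts) \<subseteq> pts Q" using ts q_pts by auto
    have "edist Q (q (App \<sigma> (map rep (map q ts)))) (q (App \<sigma> ts)) \<le> 0"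
    proof (rule App_dist[OF \<sigma> _ _ ts])
      fix i assume i: "i < arity \<Sigma> \<sigma>"
      then have "ts ! i \<in> set ts" using ts(1) by simp
      then have "q (ts ! i) \<in> pts Q" using ts(2) q_pts by blast
      then show "edist Q (q (map rep (map q ts) ! i)) (q (ts ! i)) \<le> 0"
        using i ts rep(2) by (simp add: edist_self[OF Q])
    qed (use ts rep_list[OF ps] in auto)
    then show ?thesis
      using rep_list[OF ps] ts
      by (intro edist_eq_0[OF Q]) (auto simp: A_def \<sigma> intro!: q_pts App_in_terms_in)
  qed
  have sharp_q: "sharp A (\<lambda>v. q (g v)) t = q (subst g t)"
    if "t \<in> terms_in \<Sigma> Y" "g \<in> Y \<rightarrow> ?P" for t :: "('s, nat) trm" and g Y
    using that(1)
  proof (induction rule: terms_in_induct)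
    case (App \<sigma> ts)
    have "map (sharp A (\<lambda>v. q (g v))) ts = map q (map (subst g) ts)"
      using App(4) by simp
    moreover have "set (map (subst g) ts) \<subseteq> ?P"
      using App(3) subst_in_terms_in[OF _ that(2)] by auto
    ultimately show ?case
      using opr_q[OF App(1), of "map (subst g) ts"] App(2) by (simp del: map_map)
  qed simp
  have model: "A \<in> \<V>"
  proof (rule modelI[OF A]; unfold und)
    fix l \<epsilon> r and f :: "nat \<Rightarrow> 'u" assume e: "(l, \<epsilon>, r) \<in> E" and lr: "l \<in> terms \<Sigma>" "r \<in> terms \<Sigma>"
      and f: "f \<in> UNIV \<rightarrow> pts Q"
    define g where "g = (\<lambda>v. rep (f v))"
    have g: "g \<in> UNIV \<rightarrow> ?P" "f = (\<lambda>v. q (g v))"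
      using f rep by (auto simp: g_def fun_eq_iff Pi_iff)
    have lr': "l \<in> terms_in \<Sigma> UNIV" "r \<in> terms_in \<Sigma> UNIV" using lr by (auto simp: terms_in_def)
    have "edist Q (q (subst g l)) (q (subst g r)) \<le> ennreal (real_of_rat \<epsilon>)"
    proof (rule dist_le)
      fix B k assume B: "B \<in> \<V>" and k: "k \<in> Hom X (und B)"
      have "(\<lambda>v. sharp B k (g v)) \<in> UNIV \<rightarrow> pts (und B)"
        using g Hom_pts[OF k] by (auto intro!: sharp_pts[OF model_qalg[OF B]])
      then show "edist (und B) (sharp B k (subst g l)) (sharp B k (subst g r)) \<le> ennreal (real_of_rat \<epsilon>)"
        unfolding sharp_subst by (rule model_satisfies[OF B e])
    qed (use subst_in_terms_in[OF _ g(1)] lr' in auto)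
    then show "edist Q (sharp A f l) (sharp A f r) \<le> ennreal (real_of_rat \<epsilon>)"
      using sharp_q[OF lr'(1) g(1)] sharp_q[OF lr'(2) g(1)] g(2) by simp
  qed
  define \<eta> where "\<eta> = (\<lambda>x\<in>pts X. q (Var x))"
  have \<eta>: "\<eta> \<in> Hom X (und A)"
    unfolding und \<eta>_def
    by (intro HomI dist_le q_pts Var_in_terms_in) (auto simp: Hom_edist)
  have sharp_\<eta>: "sharp A \<eta> t = q t" if "t \<in> ?P" for t
    using that
  proof (induction rule: terms_in_induct)
    case (App \<sigma> ts)
    then have "map (sharp A \<eta>) ts = map q ts" by simp
    then show ?case using opr_q[OF App(1-3)] by (simp del: map_eq_conv)
  qed (simp add: \<eta>_def)
  have "\<exists>!h. h \<in> alg_hom \<Sigma> A B \<and> compose (pts X) h \<eta> = f"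
    if B: "B \<in> \<V>" and f: "f \<in> Hom X (und B)" for B f
  proof
    define h where "h = (\<lambda>p\<in>pts Q. sharp B f (rep p))"
    have hq: "h (q t) = sharp B f t" if t: "t \<in> ?P" for t
    proof -
      have "edist (und B) (sharp B f (rep (q t))) (sharp B f t) \<le> edist Q (q t) (q t)"
        using dist_ge[OF rep(1)[OF q_pts[OF t]] t B f] rep(2)[OF q_pts[OF t]] by simp
      then have "edist (und B) (sharp B f (rep (q t))) (sharp B f t) = 0"
        using edist_self[OF Q q_pts[OF t]] by simp
      then have "sharp B f (rep (q t)) = sharp B f t"
        using t rep(1)[OF q_pts[OF t]] Hom_pts[OF f] qalg_Met[OF model_qalg[OF B]]
        by (intro edist_eq_0[of "und B"]) (auto intro!: sharp_pts[OF model_qalg[OF B]])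
      then show ?thesis using q_pts[OF t] by (simp add: h_def)
    qed
    have h_Hom: "h \<in> Hom (und A) (und B)"
      unfolding h_def und
    proof (rule HomI)
      fix p p' assume p: "p \<in> pts Q" "p' \<in> pts Q"
      show "sharp B f (rep p) \<in> pts (und B)"
        using rep(1)[OF p(1)] Hom_pts[OF f] by (auto intro!: sharp_pts[OF model_qalg[OF B]])
      show "edist (und B) (sharp B f (rep p)) (sharp B f (rep p')) \<le> edist Q p p'"
        using dist_ge[OF rep(1)[OF p(1)] rep(1)[OF p(2)] B f] rep(2) p by simp
    qed
    have h: "h \<in> alg_hom \<Sigma> A B"
    proof (rule alg_homI[OF h_Hom])
      fix \<sigma> ps assume \<sigma>: "\<sigma> \<in> ops \<Sigma>" and ps: "ps \<in> pts (power_space (und A) (arity \<Sigma> \<sigma>))"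
      then have r: "set (map rep ps) \<subseteq> ?P" "map q (map rep ps) = ps"
        using rep_list[of ps] by (auto simp: pts_power_space und)
      have "map h ps = map (sharp B f) (map rep ps)"
        using ps by (auto simp: h_def pts_power_space und)
      moreover have "App \<sigma> (map rep ps) \<in> ?P"
        using r ps \<sigma> by (intro App_in_terms_in) (auto simp: pts_power_space)
      ultimately show "h (opr A \<sigma> ps) = opr B \<sigma> (map h ps)"
        by (simp add: A_def hq del: map_map)
    qed
    have "compose (pts X) h \<eta> = f"
      using compose_Hom[OF \<eta> h_Hom] f
      by (rule Hom_eqI) (simp add: compose_app \<eta>_def hq Var_in_terms_in)
    then show "h \<in> alg_hom \<Sigma> A B \<and> compose (pts X) h \<eta> = f" using h by simp
    fix h' assume h': "h' \<in> alg_hom \<Sigma> A B \<and> compose (pts X) h' \<eta> = f"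
    show "h' = h"
    proof (rule Hom_eqI[OF alg_hom_Hom h_Hom])
      show "h' \<in> alg_hom \<Sigma> A B" using h' by simp
      fix p assume "p \<in> pts (und A)"
      then obtain t where t: "t \<in> ?P" "p = q t" using q by (auto simp: und)
      have "h' p = sharp B (\<lambda>v. h' (\<eta> v)) t"
        using alg_hom_sharp[OF A _ t(1), of h' B \<eta>] h' Hom_pts[OF \<eta>] sharp_\<eta> t by auto
      also have "\<dots> = sharp B f t"
        using t(1) h' by (intro sharp_cong) (auto simp: terms_in_def compose_app)
      finally show "h' p = h p" using hq t by simp
    qed
  qed
  then show ?thesis
    using model \<eta> unfolding free_algebra_on_def by blast
qed

end


section \<open>The free-algebra monad\<close>

context quantitative_variety
begin

abbreviation F :: "'u emet \<Rightarrow> ('s, 'u) qalg" where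
  "F \<equiv> free_algebra \<Sigma> \<V>"

abbreviation \<eta> :: "'u emet \<Rightarrow> 'u \<Rightarrow> 'u" where
  "\<eta> \<equiv> free_unit \<Sigma> \<V>"

abbreviation ext :: "'u emet \<Rightarrow> ('s, 'u) qalg \<Rightarrow> ('u \<Rightarrow> 'u) \<Rightarrow> 'u \<Rightarrow> 'u" where
  "ext \<equiv> free_extension \<Sigma> \<V>"

abbreviation T :: "'u met_functor" where
  "T \<equiv> free_algebra_functor \<Sigma> \<V>"

abbreviation \<mu> :: "'u emet \<Rightarrow> 'u \<Rightarrow> 'u" where
  "\<mu> \<equiv> mult_of (free_algebra_monad \<Sigma> \<V>)"

lemma free_algebra_on_F:
  assumes "X \<in> Met"
  shows "free_algebra_on \<Sigma> \<V> X (F X) (\<eta> X)"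
proof -
  obtain A \<theta> where "free_algebra_on \<Sigma> \<V> X A \<theta>"
    using free_algebra_exists[OF assms] by blast
  then have "\<exists>c. case c of (A, \<theta>) \<Rightarrow> free_algebra_on \<Sigma> \<V> X A \<theta>" by auto
  from someI_ex[OF this] show ?thesis
    by (simp add: free_algebra_def free_unit_def free_choice_def case_prod_unfold)
qed

lemma F_model: "X \<in> Met \<Longrightarrow> F X \<in> \<V>"
  using free_algebra_on_F by (simp add: free_algebra_on_def)

lemma F_qalg: "X \<in> Met \<Longrightarrow> quantitative_algebra \<Sigma> (F X)"
  by (simp add: F_model model_qalg)

lemma \<eta>_Hom: "X \<in> Met \<Longrightarrow> \<eta> X \<in> Hom X (und (F X))"
  using free_algebra_on_F by (simp add: free_algebra_on_def)

lemma \<eta>_pts: "X \<in> Met \<Longrightarrow> x \<in> pts X \<Longrightarrow> \<eta> X x \<in> pts (und (F X))"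
  using \<eta>_Hom by (rule Hom_pts)

lemma ext_spec:
  assumes "X \<in> Met" "B \<in> \<V>" "f \<in> Hom X (und B)"
  shows "ext X B f \<in> alg_hom \<Sigma> (F X) B \<and> compose (pts X) (ext X B f) (\<eta> X) = f"
proof -
  have "\<exists>!h. h \<in> alg_hom \<Sigma> (F X) B \<and> compose (pts X) h (\<eta> X) = f"
    using free_algebra_on_F[OF assms(1)] assms(2,3) by (simp add: free_algebra_on_def)
  from theI'[OF this] show ?thesis by (simp add: free_extension_def)
qed

lemma ext_hom:
  "X \<in> Met \<Longrightarrow> B \<in> \<V> \<Longrightarrow> f \<in> Hom X (und B) \<Longrightarrow> ext X B f \<in> alg_hom \<Sigma> (F X) B"
  using ext_spec by blast

lemma ext_\<eta>:
  assumes "X \<in> Met" "B \<in> \<V>" "f \<in> Hom X (und B)" "x \<in> pts X"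
  shows "ext X B f (\<eta> X x) = f x"
  using ext_spec[OF assms(1-3)] compose_app[OF assms(4)] by metis

lemma hom_eq:
  assumes X: "X \<in> Met" and B: "B \<in> \<V>" and h: "h \<in> alg_hom \<Sigma> (F X) B" and k: "k \<in> alg_hom \<Sigma> (F X) B"
    and eq: "\<And>x. x \<in> pts X \<Longrightarrow> h (\<eta> X x) = k (\<eta> X x)"
  shows "h = k"
proof -
  have hf: "compose (pts X) h (\<eta> X) \<in> Hom X (und B)"
    using \<eta>_Hom[OF X] alg_hom_Hom[OF h] by (rule compose_Hom)
  have "compose (pts X) k (\<eta> X) = compose (pts X) h (\<eta> X)"
    using eq by (auto simp: compose_def)
  then show ?thesis
    using free_algebra_on_F[OF X] B hf h k unfolding free_algebra_on_def by blast
qed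

text \<open>The values of terms form a subalgebra, which is again a model. The extension of \<open>\<eta>\<close> to this
  subalgebra is an endomorphism of \<open>F X\<close> that fixes the generators, hence the identity.\<close>

lemma F_generated:
  assumes X: "X \<in> Met" and p: "p \<in> pts (und (F X))"
  shows "\<exists>t\<in>terms_in \<Sigma> (pts X). p = sharp (F X) (\<eta> X) t"
proof -
  define G where "G = sharp (F X) (\<eta> X) ` terms_in \<Sigma> (pts X)"
  have "\<eta> X \<in> pts X \<rightarrow> pts (und (F X))" using \<eta>_pts[OF X] by blast
  then have G: "G \<subseteq> pts (und (F X))"
    using sharp_pts[OF F_qalg[OF X]] by (auto simp: G_def)
  define S where "S = \<lparr>und = \<lparr>pts = G, edist = edist (und (F X))\<rparr>, opr = opr (F X)\<rparr>"
  have S [simp]: "pts (und S) = G" "edist (und S) = edist (und (F X))" "opr S = opr (F X)"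
    by (simp_all add: S_def)
  have pow: "pts (power_space (und S) n) \<subseteq> pts (power_space (und (F X)) n)" for n
    using G by (auto simp: pts_power_space)
  have pow_dist: "edist (power_space (und S) n) = edist (power_space (und (F X)) n)" for n
    by (simp add: power_space_def)
  have "und S \<in> Met"
  proof -
    have "small TYPE('u) G"
      using G qalg_Met[OF F_qalg[OF X]] by (auto simp: Met_def intro: small_subset)
    moreover have "extended_metric (und S)"
      using qalg_Met[OF F_qalg[OF X]] G unfolding Met_def extended_metric_def S by blast
    ultimately show ?thesis by (simp add: Met_def)
  qed
  moreover have "opr (F X) \<sigma> ps \<in> G" if "\<sigma> \<in> ops \<Sigma>" "ps \<in> pts (power_space (und S) (arity \<Sigma> \<sigma>))" for \<sigma> ps
  proof -
    have "\<forall>q. \<exists>t. q \<in> G \<longrightarrow> t \<in> terms_in \<Sigma> (pts X) \<and> q = sharp (F X) (\<eta> X) t"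
      by (auto simp: G_def)
    then obtain t where t: "\<And>q. q \<in> G \<Longrightarrow> t q \<in> terms_in \<Sigma> (pts X) \<and> q = sharp (F X) (\<eta> X) (t q)"
      by metis
    have ps: "set ps \<subseteq> G" "length ps = arity \<Sigma> \<sigma>" using that(2) by (auto simp: pts_power_space)
    then have "map (sharp (F X) (\<eta> X)) (map t ps) = ps"
      using t by (auto simp: subset_iff intro!: map_idI)
    then have "opr (F X) \<sigma> ps = sharp (F X) (\<eta> X) (App \<sigma> (map t ps))" by simp
    moreover have "App \<sigma> (map t ps) \<in> terms_in \<Sigma> (pts X)"
      using that(1) ps t by (intro App_in_terms_in) (auto simp: subset_iff)
    ultimately show ?thesis unfolding G_def by (rule image_eqI)
  qed
  moreover have "edist (und (F X)) (opr (F X) \<sigma> ps) (opr (F X) \<sigma> qs) \<le> edist (power_space (und (F X)) (arity \<Sigma> \<sigma>)) ps qs"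
    if "\<sigma> \<in> ops \<Sigma>" "ps \<in> pts (power_space (und S) (arity \<Sigma> \<sigma>))"
      "qs \<in> pts (power_space (und S) (arity \<Sigma> \<sigma>))" for \<sigma> ps qs
    using F_qalg[OF X] that pow unfolding quantitative_algebra_def nonexpanding_def by blast
  ultimately have S_qalg: "quantitative_algebra \<Sigma> S"
    by (simp add: quantitative_algebra_def nonexpanding_def pow_dist)
  have "sharp S f t = sharp (F X) f t" for f :: "nat \<Rightarrow> 'u" and t
    by (induction t) (simp_all cong: map_cong)
  then have S_model: "S \<in> \<V>"
    using model_satisfies[OF F_model[OF X]] G by (intro modelI[OF S_qalg]) (auto simp: Pi_iff subset_iff)
  have \<eta>_G: "\<eta> X x \<in> G" if "x \<in> pts X" for x
    unfolding G_def by (rule image_eqI[OF _ Var_in_terms_in[OF that]]) simp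
  then have "\<eta> X \<in> Hom X (und S)"
    using \<eta>_Hom[OF X] by (auto simp: Hom_def nonexpanding_def)
  note h = ext_hom[OF X S_model this] ext_\<eta>[OF X S_model this]
  have h_G: "ext X S (\<eta> X) q \<in> G" if "q \<in> pts (und (F X))" for q
    using Hom_pts[OF alg_hom_Hom[OF h(1)] that] by simp
  have "ext X S (\<eta> X) \<in> alg_hom \<Sigma> (F X) (F X)"
    using h(1) G by (auto simp: alg_hom_def Hom_def nonexpanding_def)
  then have "ext X S (\<eta> X) = Id_on_space (und (F X))"
    using alg_hom_Id[OF F_qalg[OF X]]
    by (rule hom_eq[OF X F_model[OF X]]) (simp add: h(2) Id_on_space_app \<eta>_pts[OF X])
  then have "p \<in> G" using h_G[OF p] p by (simp add: Id_on_space_app)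
  then show ?thesis by (auto simp: G_def)
qed

text \<open>Terms are nonexpanding as functions of their variables, and homomorphisms preserve them. This
  bound makes the free-algebra functor enriched.\<close>

lemma hom_edist_le:
  assumes X: "X \<in> Met" and B: "B \<in> \<V>" and h: "h \<in> alg_hom \<Sigma> (F X) B" and k: "k \<in> alg_hom \<Sigma> (F X) B"
    and le: "\<And>x. x \<in> pts X \<Longrightarrow> edist (und B) (h (\<eta> X x)) (k (\<eta> X x)) \<le> c"
    and p: "p \<in> pts (und (F X))"
  shows "edist (und B) (h p) (k p) \<le> c"
proof -
  obtain t where t: "t \<in> terms_in \<Sigma> (pts X)" and pt: "p = sharp (F X) (\<eta> X) t"
    using F_generated[OF X p] by blast
  have \<eta>: "\<eta> X \<in> pts X \<rightarrow> pts (und (F X))" using \<eta>_pts[OF X] by blast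
  have *: "(\<lambda>x. g (\<eta> X x)) \<in> pts X \<rightarrow> pts (und B)" if "g \<in> alg_hom \<Sigma> (F X) B" for g
    using Hom_pts[OF alg_hom_Hom[OF that]] \<eta> by blast
  show ?thesis
    unfolding pt alg_hom_sharp[OF F_qalg[OF X] h t \<eta>] alg_hom_sharp[OF F_qalg[OF X] k t \<eta>]
    using le by (rule sharp_edist_le[OF model_qalg[OF B] t *[OF h] *[OF k]])
qed

lemma T_Ob: "Ob T X = und (F X)"
  by (simp add: free_algebra_functor_def)

lemma T_Met: "X \<in> Met \<Longrightarrow> und (F X) \<in> Met"
  by (rule qalg_Met[OF F_qalg])

lemma T_hom:
  assumes "X \<in> Met" "Y \<in> Met" "f \<in> Hom X Y"
  shows "Ar T X Y f \<in> alg_hom \<Sigma> (F X) (F Y)"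
  using ext_hom[OF assms(1) F_model[OF assms(2)] compose_Hom[OF assms(3) \<eta>_Hom[OF assms(2)]]]
  by (simp add: free_algebra_functor_def)

lemma T_\<eta>:
  assumes "X \<in> Met" "Y \<in> Met" "f \<in> Hom X Y" "x \<in> pts X"
  shows "Ar T X Y f (\<eta> X x) = \<eta> Y (f x)"
  using ext_\<eta>[OF assms(1) F_model[OF assms(2)] compose_Hom[OF assms(3) \<eta>_Hom[OF assms(2)]] assms(4)] assms(4)
  by (simp add: free_algebra_functor_def compose_app)

lemma enriched_functor_T: "enriched_functor Met T"
proof (rule enriched_functorI; (unfold T_Ob)?)
  fix X :: "'u emet" and t assume X: "X \<in> Met" and t: "t \<in> pts (und (F X))"
  have "Ar T X X (Id_on_space X) = Id_on_space (und (F X))"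
    using T_hom[OF X X Id_Hom] alg_hom_Id[OF F_qalg[OF X]]
    by (rule hom_eq[OF X F_model[OF X]]) (simp add: T_\<eta>[OF X X Id_Hom] Id_on_space_app \<eta>_pts[OF X])
  then show "Ar T X X (Id_on_space X) t = t" using t by (simp add: Id_on_space_app)
next
  fix X Y Z :: "'u emet" and f g :: "'u \<Rightarrow> 'u" and t
  assume X: "X \<in> Met" and Y: "Y \<in> Met" and Z: "Z \<in> Met" and f: "f \<in> Hom X Y" and g: "g \<in> Hom Y Z"
    and t: "t \<in> pts (und (F X))"
  have "Ar T X Z (compose (pts X) g f) = compose (pts (und (F X))) (Ar T Y Z g) (Ar T X Y f)"
    using T_hom[OF X Z compose_Hom[OF f g]] alg_hom_compose[OF F_qalg[OF X] T_hom[OF X Y f] T_hom[OF Y Z g]]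
    by (rule hom_eq[OF X F_model[OF Z]])
      (simp add: T_\<eta>[OF X Z compose_Hom[OF f g]] T_\<eta>[OF X Y f] T_\<eta>[OF Y Z g] compose_app \<eta>_pts[OF X] Hom_pts[OF f])
  then show "Ar T X Z (compose (pts X) g f) t = Ar T Y Z g (Ar T X Y f t)"
    using t by (simp add: compose_app)
next
  fix X Y :: "'u emet" and f g :: "'u \<Rightarrow> 'u" and t
  assume X: "X \<in> Met" and Y: "Y \<in> Met" and f: "f \<in> Hom X Y" and g: "g \<in> Hom X Y"
    and t: "t \<in> pts (und (F X))"
  show "edist (und (F Y)) (Ar T X Y f t) (Ar T X Y g t) \<le> hom_dist X Y f g"
  proof (rule hom_edist_le[OF X F_model[OF Y] T_hom[OF X Y f] T_hom[OF X Y g] _ t])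
    fix x assume x: "x \<in> pts X"
    have "edist (und (F Y)) (\<eta> Y (f x)) (\<eta> Y (g x)) \<le> edist Y (f x) (g x)"
      using Hom_edist[OF \<eta>_Hom[OF Y] Hom_pts[OF f x] Hom_pts[OF g x]] .
    also have "\<dots> \<le> hom_dist X Y f g" using x by (rule edist_le_hom_dist)
    finally show "edist (und (F Y)) (Ar T X Y f (\<eta> X x)) (Ar T X Y g (\<eta> X x)) \<le> hom_dist X Y f g"
      using x by (simp add: T_\<eta>[OF X Y f] T_\<eta>[OF X Y g])
  qed
qed (use T_Met alg_hom_Hom[OF T_hom] in auto)

lemma \<mu>_hom: "X \<in> Met \<Longrightarrow> \<mu> X \<in> alg_hom \<Sigma> (F (und (F X))) (F X)"
  using ext_hom[OF T_Met F_model Id_Hom] by (simp add: free_algebra_monad_def)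

lemma \<mu>_\<eta>: "X \<in> Met \<Longrightarrow> p \<in> pts (und (F X)) \<Longrightarrow> \<mu> X (\<eta> (und (F X)) p) = p"
  using ext_\<eta>[OF T_Met F_model Id_Hom] by (simp add: free_algebra_monad_def Id_on_space_app)

text \<open>Naturality of \<open>\<mu>\<close>, the right unit law and associativity compare homomorphisms out of a free
  algebra, which agree on the generators; the other laws hold by the definitions of \<open>\<mu>\<close> and \<open>T\<close>.\<close>

lemma enriched_monad_free: "enriched_monad (free_algebra_monad \<Sigma> \<V>)"
proof -
  have sel: "fun_of (free_algebra_monad \<Sigma> \<V>) = T" "unit_of (free_algebra_monad \<Sigma> \<V>) = \<eta>"
    by (simp_all add: free_algebra_monad_def)
  have "nat_trans Met Incl T \<eta>"
    unfolding nat_trans_def Incl_simps T_Ob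
    using \<eta>_Hom T_\<eta> by (auto simp: compose_def fun_eq_iff)
  moreover have "nat_trans Met (T \<circ>\<^sub>F T) T \<mu>"
    unfolding nat_trans_def functor_comp_simps T_Ob
  proof (intro conjI ballI)
    fix X Y :: "'u emet" and f assume X: "X \<in> Met" and Y: "Y \<in> Met" and f: "f \<in> Hom X Y"
    note TX = T_Met[OF X] and TY = T_Met[OF Y]
    note Tf = alg_hom_Hom[OF T_hom[OF X Y f]]
    show "compose (pts (und (F (und (F X))))) (\<mu> Y) (Ar T (und (F X)) (und (F Y)) (Ar T X Y f))
        = compose (pts (und (F (und (F X))))) (Ar T X Y f) (\<mu> X)"
      using alg_hom_compose[OF F_qalg[OF TX] T_hom[OF TX TY Tf] \<mu>_hom[OF Y]]
        alg_hom_compose[OF F_qalg[OF TX] \<mu>_hom[OF X] T_hom[OF X Y f]]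
      by (rule hom_eq[OF TX F_model[OF Y]])
        (simp add: compose_app \<eta>_pts[OF TX] T_\<eta>[OF TX TY Tf] \<mu>_\<eta> X Y Hom_pts[OF Tf])
  qed (use alg_hom_Hom[OF \<mu>_hom] in auto)
  moreover have "compose (pts (und (F X))) (\<mu> X) (\<eta> (und (F X))) = Id_on_space (und (F X))"
    if X: "X \<in> Met" for X
    using \<mu>_\<eta>[OF X] by (auto simp: compose_def Id_on_space_def fun_eq_iff)
  moreover have "compose (pts (und (F X))) (\<mu> X) (Ar T X (und (F X)) (\<eta> X)) = Id_on_space (und (F X))"
    if X: "X \<in> Met" for X
    using alg_hom_compose[OF F_qalg[OF X] T_hom[OF X T_Met[OF X] \<eta>_Hom[OF X]] \<mu>_hom[OF X]]
      alg_hom_Id[OF F_qalg[OF X]]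
    by (rule hom_eq[OF X F_model[OF X]])
      (simp add: compose_app \<eta>_pts[OF X] T_\<eta>[OF X T_Met[OF X] \<eta>_Hom[OF X]] \<mu>_\<eta>[OF X] Id_on_space_app)
  moreover have "compose (pts (und (F (und (F (und (F X))))))) (\<mu> X) (\<mu> (und (F X)))
      = compose (pts (und (F (und (F (und (F X))))))) (\<mu> X) (Ar T (und (F (und (F X)))) (und (F X)) (\<mu> X))"
    if X: "X \<in> Met" for X
  proof -
    note TX = T_Met[OF X]
    note TTX = T_Met[OF TX]
    note \<mu>X = alg_hom_Hom[OF \<mu>_hom[OF X]]
    show ?thesis
      using alg_hom_compose[OF F_qalg[OF TTX] \<mu>_hom[OF TX] \<mu>_hom[OF X]]
        alg_hom_compose[OF F_qalg[OF TTX] T_hom[OF TTX TX \<mu>X] \<mu>_hom[OF X]]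
      by (rule hom_eq[OF TTX F_model[OF X]])
        (simp add: compose_app \<eta>_pts[OF TTX] T_\<eta>[OF TTX TX \<mu>X] \<mu>_\<eta> X TX Hom_pts[OF \<mu>X])
  qed
  ultimately show ?thesis
    unfolding enriched_monad_def Let_def sel T_Ob using enriched_functor_T by blast
qed

end


section \<open>The free-algebra functor is a left Kan extension\<close>

text \<open>Here \<open>L\<close> is the left Kan extension of the restriction of \<open>T\<close> to finite discrete spaces, with
  the invertible unit \<open>\<kappa>\<close>. Thus \<open>L\<close> is the coreflection of \<open>T\<close> into strongly finitary functors.\<close>

locale free_kan_extension = quantitative_variety \<Sigma> E \<V>
  for \<Sigma> :: "'s signature" and E :: "'s qequation set" and \<V> :: "('s, 'u) qalg set" +
  fixes L :: "'u met_functor" and \<kappa> :: "'u emet \<Rightarrow> 'u \<Rightarrow> 'u"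
  assumes composites: "\<And>S S' :: 'u met_functor.
      strongly_finitary S \<Longrightarrow> strongly_finitary S' \<Longrightarrow> strongly_finitary (S' \<circ>\<^sub>F S)"
    and L: "strongly_finitary L"
    and \<kappa>_onto: "\<And>N. N \<in> Set_fp \<Longrightarrow> \<kappa> N ` pts (Ob T N) = pts (Ob L N)"
    and \<kappa>_edist: "\<And>N s t. N \<in> Set_fp \<Longrightarrow> s \<in> pts (Ob T N) \<Longrightarrow> t \<in> pts (Ob T N) \<Longrightarrow>
      edist (Ob L N) (\<kappa> N s) (\<kappa> N t) = edist (Ob T N) s t"
    and \<kappa>_natural: "\<And>M N h t. M \<in> Set_fp \<Longrightarrow> N \<in> Set_fp \<Longrightarrow> h \<in> Hom M N \<Longrightarrow> t \<in> pts (Ob T M) \<Longrightarrow>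
      Ar L M N h (\<kappa> M t) = \<kappa> N (Ar T M N h t)"
    and universal: "\<And>X B \<alpha>. X \<in> Met \<Longrightarrow> B \<in> Met \<Longrightarrow> \<alpha> \<in> cocones T X B \<Longrightarrow>
      \<exists>f\<in>Hom (Ob L X) B. \<forall>N\<in>Set_fp. \<forall>x\<in>Hom N X. \<forall>t\<in>pts (Ob T N).
        f (Ar L N X x (\<kappa> N t)) = \<alpha> N x t"
begin

lemmas L_functor = strongly_finitary_functor[OF L]

lemma L_Hom: "X \<in> Met \<Longrightarrow> Y \<in> Met \<Longrightarrow> f \<in> Hom X Y \<Longrightarrow> Ar L X Y f \<in> Hom (Ob L X) (Ob L Y)"
  by (rule functor_Hom[OF L_functor])

lemma L_Met: "X \<in> Met \<Longrightarrow> Ob L X \<in> Met"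
  by (rule functor_Met[OF L_functor])

lemma \<kappa>_pts: "N \<in> Set_fp \<Longrightarrow> t \<in> pts (Ob T N) \<Longrightarrow> \<kappa> N t \<in> pts (Ob L N)"
  using \<kappa>_onto by blast

text \<open>The points of the glued space \<open>L X\<close>: the element \<open>t\<close> of \<open>T N\<close>, at the place \<open>x : N \<rightarrow> X\<close>.\<close>

definition gen :: "'u emet \<Rightarrow> 'u emet \<Rightarrow> ('u \<Rightarrow> 'u) \<Rightarrow> 'u \<Rightarrow> 'u" where
  "gen X N x t = Ar L N X x (\<kappa> N t)"

lemma gen_pts:
  "X \<in> Met \<Longrightarrow> N \<in> Set_fp \<Longrightarrow> x \<in> Hom N X \<Longrightarrow> t \<in> pts (Ob T N) \<Longrightarrow> gen X N x t \<in> pts (Ob L X)"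
  unfolding gen_def by (rule Hom_pts[OF L_Hom[OF Set_fp_Met] \<kappa>_pts])

lemma gen_edist:
  assumes "X \<in> Met" "N \<in> Set_fp" "x \<in> Hom N X" "s \<in> pts (Ob T N)" "t \<in> pts (Ob T N)"
  shows "edist (Ob L X) (gen X N x s) (gen X N x t) \<le> edist (Ob T N) s t"
  unfolding gen_def using assms Hom_edist[OF L_Hom[OF Set_fp_Met]] \<kappa>_pts \<kappa>_edist by metis

lemma gen_edist_hom_dist:
  assumes "X \<in> Met" "N \<in> Set_fp" "x \<in> Hom N X" "y \<in> Hom N X" "t \<in> pts (Ob T N)"
  shows "edist (Ob L X) (gen X N x t) (gen X N y t) \<le> hom_dist N X x y"
  unfolding gen_def by (rule functor_edist[OF L_functor Set_fp_Met assms(1,3,4) \<kappa>_pts]) (use assms in auto)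

lemma gen_compose:
  assumes X: "X \<in> Met" and M: "M \<in> Set_fp" and N: "N \<in> Set_fp" and h: "h \<in> Hom M N"
    and x: "x \<in> Hom N X" and t: "t \<in> pts (Ob T M)"
  shows "gen X M (compose (pts M) x h) t = gen X N x (Ar T M N h t)"
  unfolding gen_def
  using functor_compose[OF L_functor Set_fp_Met[OF M] Set_fp_Met[OF N] X h x \<kappa>_pts[OF M t]]
    \<kappa>_natural[OF M N h t] by simp

text \<open>A cocone on the composite of \<open>L\<close> with a finite power is induced by maps out of the powers of
  the spaces \<open>T N\<close>. Since the composite is strongly finitary, the operations of the algebras \<open>F N\<close>
  therefore determine an operation on \<open>L X\<close>.\<close>

lemma operation_exists:
  assumes X: "X \<in> Met" and \<sigma>: "\<sigma> \<in> ops \<Sigma>"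
  shows "\<exists>op. nonexpanding (power_space (Ob L X) (arity \<Sigma> \<sigma>)) (Ob L X) op \<and>
    (\<forall>N\<in>Set_fp. \<forall>x\<in>Hom N X. \<forall>ts\<in>pts (power_space (Ob T N) (arity \<Sigma> \<sigma>)).
      op (map (gen X N x) ts) = gen X N x (opr (F N) \<sigma> ts))"
proof -
  define n where "n = arity \<Sigma> \<sigma>"
  let ?P = "power_functor n :: 'u met_functor"
  have sf: "strongly_finitary (?P \<circ>\<^sub>F L)"
    by (intro composites L strongly_finitary_power universe)
  have op_pts: "opr (F N) \<sigma> ts \<in> pts (Ob T N)"
    if "N \<in> Set_fp" "ts \<in> pts (power_space (Ob T N) n)" for N ts
    using qalg_opr_pts[OF F_qalg[OF Set_fp_Met[OF that(1)]] \<sigma>] that(2) by (simp add: T_Ob n_def)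
  define unpack where "unpack N q = map (inv_into (pts (Ob T N)) (\<kappa> N)) (tuple_decode n q)" for N q
  define \<alpha> where "\<alpha> N x q = gen X N x (opr (F N) \<sigma> (unpack N q))" for N x q
  have inj: "inj_on (\<kappa> N) (pts (Ob T N))" if N: "N \<in> Set_fp" for N
  proof (rule inj_onI)
    fix s t assume st: "s \<in> pts (Ob T N)" "t \<in> pts (Ob T N)" "\<kappa> N s = \<kappa> N t"
    then have "edist (Ob T N) s t = 0"
      using \<kappa>_edist[OF N st(1,2)] edist_self[OF L_Met[OF Set_fp_Met[OF N]] \<kappa>_pts[OF N st(2)]] by simp
    then show "s = t"
      using edist_eq_0 st(1,2) T_Met[OF Set_fp_Met[OF N]] by (simp add: T_Ob)
  qed
  have unpack: "unpack N (tuple_code (map (\<kappa> N) ts)) = ts"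
    if "N \<in> Set_fp" "ts \<in> pts (power_space (Ob T N) n)" for N ts
    using that inj[OF that(1)]
    by (auto simp: unpack_def pts_power_space tuple_decode_code[OF universe] subset_iff intro!: map_idI)
  have pack: "\<exists>ts\<in>pts (power_space (Ob T N) n). q = tuple_code (map (\<kappa> N) ts)"
    if N: "N \<in> Set_fp" and q: "q \<in> pts (Ob (?P \<circ>\<^sub>F L) N)" for N q
  proof -
    obtain ps where ps: "length ps = n" "set ps \<subseteq> pts (Ob L N)" "q = tuple_code ps"
      using q by (auto simp: pts_power_functor pts_power_space)
    let ?g = "inv_into (pts (Ob T N)) (\<kappa> N)"
    have "map (\<kappa> N) (map ?g ps) = ps"
      using ps(2) \<kappa>_onto[OF N] by (auto simp: f_inv_into_f subset_iff intro!: map_idI)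
    moreover have "map ?g ps \<in> pts (power_space (Ob T N) n)"
      using ps(1,2) \<kappa>_onto[OF N] by (auto simp: pts_power_space inv_into_into subset_iff)
    ultimately show ?thesis using ps(3) by metis
  qed
  have \<alpha>_eq: "\<alpha> N x (tuple_code (map (\<kappa> N) ts)) = gen X N x (opr (F N) \<sigma> ts)"
    if "N \<in> Set_fp" "ts \<in> pts (power_space (Ob T N) n)" for N x ts
    using unpack[OF that] by (simp add: \<alpha>_def)
  have map_\<kappa>: "map (\<kappa> N) ts \<in> pts (power_space (Ob L N) n)"
    if "N \<in> Set_fp" "ts \<in> pts (power_space (Ob T N) n)" for N ts
    using that \<kappa>_pts by (auto simp: pts_power_space)
  have "(\<lambda>N\<in>Set_fp. \<lambda>x\<in>Hom N X. \<lambda>q\<in>pts (Ob (?P \<circ>\<^sub>F L) N). \<alpha> N x q) \<in> cocones (?P \<circ>\<^sub>F L) X (Ob L X)"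
  proof (rule coconesI)
    show "enriched_functor Set_fp (?P \<circ>\<^sub>F L)"
      using strongly_finitary_functor[OF sf] enriched_functor_subset Set_fp_Met by blast
  next
    fix N :: "'u emet" and x assume N: "N \<in> Set_fp" and x: "x \<in> Hom N X"
    show "restrict (\<alpha> N x) (pts (Ob (?P \<circ>\<^sub>F L) N)) \<in> Hom (Ob (?P \<circ>\<^sub>F L) N) (Ob L X)"
    proof (rule HomI)
      fix p q assume "p \<in> pts (Ob (?P \<circ>\<^sub>F L) N)" "q \<in> pts (Ob (?P \<circ>\<^sub>F L) N)"
      then obtain ss ts where ss: "ss \<in> pts (power_space (Ob T N) n)" "p = tuple_code (map (\<kappa> N) ss)"
        and ts: "ts \<in> pts (power_space (Ob T N) n)" "q = tuple_code (map (\<kappa> N) ts)"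
        using pack[OF N] by metis
      show "\<alpha> N x p \<in> pts (Ob L X)"
        using ss gen_pts[OF X N x op_pts[OF N]] by (simp add: \<alpha>_eq[OF N])
      have "edist (Ob L X) (\<alpha> N x p) (\<alpha> N x q) \<le> edist (Ob T N) (opr (F N) \<sigma> ss) (opr (F N) \<sigma> ts)"
        using ss ts by (simp add: \<alpha>_eq[OF N] gen_edist[OF X N x] op_pts[OF N])
      also have "\<dots> \<le> edist (power_space (Ob L N) n) (map (\<kappa> N) ss) (map (\<kappa> N) ts)"
        unfolding T_Ob
      proof (rule qalg_opr_edist[OF F_qalg[OF Set_fp_Met[OF N]] \<sigma>])
        fix i assume i: "i < arity \<Sigma> \<sigma>"
        have "edist (Ob L N) (map (\<kappa> N) ss ! i) (map (\<kappa> N) ts ! i)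
            \<le> edist (power_space (Ob L N) n) (map (\<kappa> N) ss) (map (\<kappa> N) ts)"
          using i power_space_edist_le_iff n_def by blast
        then show "edist (und (F N)) (ss ! i) (ts ! i)
            \<le> edist (power_space (Ob L N) n) (map (\<kappa> N) ss) (map (\<kappa> N) ts)"
          using i ss(1) ts(1) \<kappa>_edist[OF N nth_in_pts[OF ss(1)] nth_in_pts[OF ts(1)]]
          by (simp add: pts_power_space T_Ob n_def)
      qed (use ss ts in \<open>simp_all add: T_Ob n_def\<close>)
      finally show "edist (Ob L X) (\<alpha> N x p) (\<alpha> N x q) \<le> edist (Ob (?P \<circ>\<^sub>F L) N) p q"
        using ss ts by (simp add: edist_power_functor[OF universe] pts_power_space)
    qed
  next
    fix N :: "'u emet" and x y q
    assume N: "N \<in> Set_fp" and x: "x \<in> Hom N X" and y: "y \<in> Hom N X" and "q \<in> pts (Ob (?P \<circ>\<^sub>F L) N)"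
    then obtain ts where ts: "ts \<in> pts (power_space (Ob T N) n)" "q = tuple_code (map (\<kappa> N) ts)"
      using pack by blast
    then show "edist (Ob L X) (\<alpha> N x q) (\<alpha> N y q) \<le> hom_dist N X x y"
      using gen_edist_hom_dist[OF X N x y op_pts[OF N ts(1)]] by (simp add: \<alpha>_eq[OF N])
  next
    fix M N :: "'u emet" and h x q
    assume M: "M \<in> Set_fp" and N: "N \<in> Set_fp" and h: "h \<in> Hom M N" and x: "x \<in> Hom N X"
      and "q \<in> pts (Ob (?P \<circ>\<^sub>F L) M)"
    then obtain ts where ts: "ts \<in> pts (power_space (Ob T M) n)" "q = tuple_code (map (\<kappa> M) ts)"
      using pack by blast
    note Th = T_hom[OF Set_fp_Met[OF M] Set_fp_Met[OF N] h]
    have Tts: "map (Ar T M N h) ts \<in> pts (power_space (Ob T N) n)"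
      using map_in_power_space[OF alg_hom_Hom[OF Th]] ts(1) by (simp add: T_Ob)
    have "map (Ar L M N h) (map (\<kappa> M) ts) = map (\<kappa> N) (map (Ar T M N h) ts)"
      using ts(1) \<kappa>_natural[OF M N h] by (auto simp: pts_power_space)
    then have "Ar (?P \<circ>\<^sub>F L) M N h q = tuple_code (map (\<kappa> N) (map (Ar T M N h) ts))"
      using Ar_power_functor[OF universe map_\<kappa>[OF M ts(1)]] by (simp add: ts(2) del: map_map)
    moreover have "opr (F N) \<sigma> (map (Ar T M N h) ts) = Ar T M N h (opr (F M) \<sigma> ts)"
      using alg_hom_opr[OF Th \<sigma>] ts(1) by (simp add: T_Ob n_def)
    ultimately show "\<alpha> M (compose (pts M) x h) q = \<alpha> N x (Ar (?P \<circ>\<^sub>F L) M N h q)"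
      using \<alpha>_eq[OF N Tts] \<alpha>_eq[OF M ts(1)] gen_compose[OF X M N h x op_pts[OF M ts(1)]]
      by (simp add: ts(2))
  qed
  then obtain f where f: "f \<in> Hom (Ob (?P \<circ>\<^sub>F L) X) (Ob L X)"
    and f_eq: "\<And>N x q. N \<in> Set_fp \<Longrightarrow> x \<in> Hom N X \<Longrightarrow> q \<in> pts (Ob (?P \<circ>\<^sub>F L) N) \<Longrightarrow>
      f (Ar (?P \<circ>\<^sub>F L) N X x q) = \<alpha> N x q"
    by (rule strongly_finitary_extend[OF sf X L_Met[OF X]]) simp
  have "nonexpanding (power_space (Ob L X) n) (Ob L X) (\<lambda>ps. f (tuple_code ps))"
    unfolding nonexpanding_def
  proof (intro conjI ballI funcsetI)
    fix ps assume ps: "ps \<in> pts (power_space (Ob L X) n)"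
    then show "f (tuple_code ps) \<in> pts (Ob L X)"
      by (intro Hom_pts[OF f]) (simp add: pts_power_functor)
    fix qs assume qs: "qs \<in> pts (power_space (Ob L X) n)"
    show "edist (Ob L X) (f (tuple_code ps)) (f (tuple_code qs)) \<le> edist (power_space (Ob L X) n) ps qs"
      using Hom_edist[OF f, of "tuple_code ps" "tuple_code qs"] ps qs
      by (simp add: pts_power_functor edist_power_functor[OF universe] pts_power_space)
  qed
  moreover have "f (tuple_code (map (gen X N x) ts)) = gen X N x (opr (F N) \<sigma> ts)"
    if N: "N \<in> Set_fp" and x: "x \<in> Hom N X" and ts: "ts \<in> pts (power_space (Ob T N) n)" for N x ts
  proof -
    have "map (gen X N x) ts = map (Ar L N X x) (map (\<kappa> N) ts)"
      by (simp add: gen_def)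
    then have "tuple_code (map (gen X N x) ts) = Ar (?P \<circ>\<^sub>F L) N X x (tuple_code (map (\<kappa> N) ts))"
      using Ar_power_functor[OF universe map_\<kappa>[OF N ts]] by (simp del: map_map map_eq_conv)
    then show ?thesis
      using f_eq[OF N x, of "tuple_code (map (\<kappa> N) ts)"] map_\<kappa>[OF N ts] \<alpha>_eq[OF N ts]
      by (simp add: pts_power_functor)
  qed
  ultimately show ?thesis unfolding n_def by blast
qed

definition operation :: "'u emet \<Rightarrow> 's \<Rightarrow> 'u list \<Rightarrow> 'u" where
  "operation X \<sigma> = (SOME op. nonexpanding (power_space (Ob L X) (arity \<Sigma> \<sigma>)) (Ob L X) op \<and>
    (\<forall>N\<in>Set_fp. \<forall>x\<in>Hom N X. \<forall>ts\<in>pts (power_space (Ob T N) (arity \<Sigma> \<sigma>)).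
      op (map (gen X N x) ts) = gen X N x (opr (F N) \<sigma> ts)))"

definition alg :: "'u emet \<Rightarrow> ('s, 'u) qalg" where
  "alg X = \<lparr>und = Ob L X, opr = operation X\<rparr>"

lemma und_alg: "und (alg X) = Ob L X"
  by (simp add: alg_def)

lemma alg_qalg:
  assumes X: "X \<in> Met"
  shows "quantitative_algebra \<Sigma> (alg X)"
  unfolding quantitative_algebra_def und_alg
proof (intro conjI ballI L_Met X)
  fix \<sigma> assume "\<sigma> \<in> ops \<Sigma>"
  from someI_ex[OF operation_exists[OF X this]]
  show "nonexpanding (power_space (Ob L X) (arity \<Sigma> \<sigma>)) (Ob L X) (opr (alg X) \<sigma>)"
    by (simp add: alg_def operation_def)
qed

lemma gen_hom:
  assumes X: "X \<in> Met" and N: "N \<in> Set_fp" and x: "x \<in> Hom N X"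
  shows "restrict (gen X N x) (pts (Ob T N)) \<in> alg_hom \<Sigma> (F N) (alg X)"
proof (rule alg_homI)
  show "restrict (gen X N x) (pts (Ob T N)) \<in> Hom (und (F N)) (und (alg X))"
    unfolding und_alg T_Ob[symmetric]
    using gen_pts[OF X N x] gen_edist[OF X N x] by (rule HomI)
  fix \<sigma> ts assume \<sigma>: "\<sigma> \<in> ops \<Sigma>" and ts: "ts \<in> pts (power_space (und (F N)) (arity \<Sigma> \<sigma>))"
  have "map (restrict (gen X N x) (pts (Ob T N))) ts = map (gen X N x) ts"
    using ts by (auto simp: pts_power_space T_Ob)
  then show "restrict (gen X N x) (pts (Ob T N)) (opr (F N) \<sigma> ts)
      = opr (alg X) \<sigma> (map (restrict (gen X N x) (pts (Ob T N))) ts)"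
    using someI_ex[OF operation_exists[OF X \<sigma>]] N x ts qalg_opr_pts[OF F_qalg[OF Set_fp_Met[OF N]] \<sigma> ts]
    by (simp add: alg_def operation_def T_Ob del: map_eq_conv)
qed

text \<open>Both sides of an equation \<open>l =\<^sub>\<epsilon> r\<close> in at most \<open>m\<close> variables are maps from the \<open>m\<close>-th power of
  \<open>L X\<close> to \<open>L X\<close>, and their distance is determined on the spaces \<open>L N \<cong> T N\<close>, which are models.\<close>

lemma alg_model:
  assumes X: "X \<in> Met"
  shows "alg X \<in> \<V>"
proof (rule modelI[OF alg_qalg[OF X]]; unfold und_alg)
  fix l \<epsilon> r and f :: "nat \<Rightarrow> 'u"
  assume e: "(l, \<epsilon>, r) \<in> E" and lr: "l \<in> terms \<Sigma>" "r \<in> terms \<Sigma>" and f: "f \<in> UNIV \<rightarrow> pts (Ob L X)"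
  have "finite (set2_trm l \<union> set2_trm r)" by (simp add: finite_vars)
  then obtain k where k: "set2_trm l \<union> set2_trm r \<subseteq> {..<k}"
    using finite_nat_iff_bounded by blast
  \<comment> \<open>\<open>m\<close> is positive, for the first entry of a tuple is the default value of a valuation\<close>
  define m where "m = Suc k"
  have vars: "l \<in> terms_in \<Sigma> {..<m}" "r \<in> terms_in \<Sigma> {..<m}"
    using k lr by (force simp: terms_in_def m_def)+
  define val :: "'u list \<Rightarrow> nat \<Rightarrow> 'u" where "val xs i = (if i < m then xs ! i else xs ! 0)" for xs i
  have val: "val xs \<in> UNIV \<rightarrow> pts A" if "xs \<in> pts (power_space A m)" for xs and A :: "'u emet"
    using that nth_in_pts[OF that] by (auto simp: val_def m_def)
  let ?P = "power_functor m :: 'u met_functor"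
  have sf: "strongly_finitary (?P \<circ>\<^sub>F L)"
    by (intro composites L strongly_finitary_power universe)
  define ev where "ev t = (\<lambda>q\<in>pts (Ob (?P \<circ>\<^sub>F L) X). sharp (alg X) (val (tuple_decode m q)) t)" for t
  have ev_code: "ev t (tuple_code ps) = sharp (alg X) (val ps) t"
    if "ps \<in> pts (power_space (Ob L X) m)" for ps t
    using that tuple_decode_code[OF universe, of ps m]
    by (simp add: ev_def pts_power_functor) (simp add: pts_power_space)
  have ev: "ev t \<in> Hom (Ob (?P \<circ>\<^sub>F L) X) (Ob L X)" if t: "t \<in> terms_in \<Sigma> {..<m}" for t
  proof -
    have "restrict (ev t) (pts (Ob (?P \<circ>\<^sub>F L) X)) \<in> Hom (Ob (?P \<circ>\<^sub>F L) X) (Ob L X)"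
    proof (rule HomI; unfold functor_comp_simps pts_power_functor; elim imageE; hypsubst)
      fix ps assume ps: "ps \<in> pts (power_space (Ob L X) m)"
      then have vps: "val ps \<in> {..<m} \<rightarrow> pts (und (alg X))" using val by (auto simp: und_alg Pi_iff)
      then show "ev t (tuple_code ps) \<in> pts (Ob L X)"
        using sharp_pts[OF alg_qalg[OF X] t] ps by (simp add: ev_code und_alg)
      fix qs assume qs: "qs \<in> pts (power_space (Ob L X) m)"
      then have vqs: "val qs \<in> {..<m} \<rightarrow> pts (und (alg X))" using val by (auto simp: und_alg Pi_iff)
      have "edist (und (alg X)) (sharp (alg X) (val ps) t) (sharp (alg X) (val qs) t)
          \<le> edist (power_space (Ob L X) m) ps qs"
      proof (rule sharp_edist_le[OF alg_qalg[OF X] t vps vqs])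
        fix i assume "i \<in> {..<m}"
        then show "edist (und (alg X)) (val ps i) (val qs i) \<le> edist (power_space (Ob L X) m) ps qs"
          using power_space_edist_le_iff[of "Ob L X" m ps qs] by (auto simp: val_def und_alg)
      qed
      then show "edist (Ob L X) (ev t (tuple_code ps)) (ev t (tuple_code qs))
          \<le> edist (Ob ?P (Ob L X)) (tuple_code ps) (tuple_code qs)"
        using ps qs
        by (simp add: ev_code und_alg) (simp add: edist_power_functor[OF universe] pts_power_space)
    qed
    then show ?thesis by (simp add: ev_def)
  qed
  define xs where "xs = map f [0..<m]"
  have xs: "xs \<in> pts (power_space (Ob L X) m)" using f by (auto simp: xs_def pts_power_space)
  have f_val: "sharp (alg X) f t = ev t (tuple_code xs)" if "t \<in> terms_in \<Sigma> {..<m}" for t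
    unfolding ev_code[OF xs]
    by (rule sharp_cong) (use that in \<open>auto simp: terms_in_def val_def xs_def\<close>)
  have "edist (Ob L X) (ev l (tuple_code xs)) (ev r (tuple_code xs)) \<le> ennreal (real_of_rat \<epsilon>)"
  proof (rule strongly_finitary_edist_le[OF sf X L_Met[OF X] ev[OF vars(1)] ev[OF vars(2)]])
    show "tuple_code xs \<in> pts (Ob (?P \<circ>\<^sub>F L) X)" using xs by (simp add: pts_power_functor)
    fix N x q assume N: "N \<in> Set_fp" and x: "x \<in> Hom N X" and "q \<in> pts (Ob (?P \<circ>\<^sub>F L) N)"
    then obtain ps where ps: "length ps = m" "set ps \<subseteq> pts (Ob L N)" "q = tuple_code ps"
      by (auto simp: pts_power_functor pts_power_space)
    define ts where "ts = map (inv_into (pts (Ob T N)) (\<kappa> N)) ps"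
    have ts: "ts \<in> pts (power_space (und (F N)) m)"
      using ps \<kappa>_onto[OF N] by (auto simp: ts_def pts_power_space inv_into_into subset_iff T_Ob)
    have "map (\<kappa> N) ts = ps"
      using ps(2) \<kappa>_onto[OF N] by (auto simp: ts_def f_inv_into_f subset_iff intro!: map_idI)
    then have "map (Ar L N X x) ps = map (gen X N x) ts"
      by (auto simp: gen_def)
    moreover have "ps \<in> pts (power_space (Ob L N) m)" using ps by (simp add: pts_power_space)
    ultimately have Aq: "Ar (?P \<circ>\<^sub>F L) N X x q = tuple_code (map (gen X N x) ts)"
      by (simp add: ps(3) Ar_power_functor[OF universe])
    have map_ts: "map (gen X N x) ts \<in> pts (power_space (Ob L X) m)"
      using ts gen_pts[OF X N x] by (auto simp: pts_power_space T_Ob)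
    have ev_gen: "ev t (Ar (?P \<circ>\<^sub>F L) N X x q) = gen X N x (sharp (F N) (val ts) t)"
      if t: "t \<in> terms_in \<Sigma> {..<m}" for t
    proof -
      have v: "val ts \<in> {..<m} \<rightarrow> pts (und (F N))" using val[OF ts] by auto
      have "sharp (alg X) (val (map (gen X N x) ts)) t
          = sharp (alg X) (\<lambda>i. restrict (gen X N x) (pts (Ob T N)) (val ts i)) t"
      proof (rule sharp_cong)
        fix i
        have "val ts i \<in> pts (Ob T N)" using val[OF ts] by (auto simp: T_Ob)
        moreover have "val (map (gen X N x) ts) i = gen X N x (val ts i)"
          using ts by (simp add: val_def pts_power_space m_def)
        ultimately show "val (map (gen X N x) ts) i = restrict (gen X N x) (pts (Ob T N)) (val ts i)"
          by simp
      qed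
      also have "\<dots> = restrict (gen X N x) (pts (Ob T N)) (sharp (F N) (val ts) t)"
        using alg_hom_sharp[OF F_qalg[OF Set_fp_Met[OF N]] gen_hom[OF X N x] t v] by simp
      also have "\<dots> = gen X N x (sharp (F N) (val ts) t)"
        using sharp_pts[OF F_qalg[OF Set_fp_Met[OF N]] t v] by (simp add: T_Ob)
      finally show ?thesis unfolding Aq ev_code[OF map_ts] .
    qed
    have pts: "sharp (F N) (val ts) t \<in> pts (Ob T N)" if "t \<in> terms_in \<Sigma> {..<m}" for t
      unfolding T_Ob using val[OF ts] by (intro sharp_pts[OF F_qalg[OF Set_fp_Met[OF N]] that]) auto
    have "edist (Ob L X) (ev l (Ar (?P \<circ>\<^sub>F L) N X x q)) (ev r (Ar (?P \<circ>\<^sub>F L) N X x q))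
        \<le> edist (Ob T N) (sharp (F N) (val ts) l) (sharp (F N) (val ts) r)"
      unfolding ev_gen[OF vars(1)] ev_gen[OF vars(2)]
      by (rule gen_edist[OF X N x pts[OF vars(1)] pts[OF vars(2)]])
    also have "\<dots> \<le> ennreal (real_of_rat \<epsilon>)"
      unfolding T_Ob by (rule model_satisfies[OF F_model[OF Set_fp_Met[OF N]] e val[OF ts]])
    finally show "edist (Ob L X) (ev l (Ar (?P \<circ>\<^sub>F L) N X x q)) (ev r (Ar (?P \<circ>\<^sub>F L) N X x q))
        \<le> ennreal (real_of_rat \<epsilon>)" .
  qed
  then show "edist (Ob L X) (sharp (alg X) f l) (sharp (alg X) f r) \<le> ennreal (real_of_rat \<epsilon>)"
    by (simp add: f_val vars)
qed

text \<open>A point of \<open>X\<close> is a map from a one-point space, which \<open>L\<close> applies to the generator of the free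
  algebra on that space.\<close>

definition point :: "'u emet" where
  "point = discrete {undefined}"

definition insertion :: "'u emet \<Rightarrow> 'u \<Rightarrow> 'u" where
  "insertion X = (\<lambda>p\<in>pts X. gen X point (\<lambda>_\<in>pts point. p) (\<eta> point undefined))"

lemma point: "point \<in> Set_fp" "pts point = {undefined}"
  by (simp_all add: point_def discrete_Set_fp universe)

lemma point_Hom: "X \<in> Met \<Longrightarrow> p \<in> pts X \<Longrightarrow> (\<lambda>_\<in>pts point. p) \<in> Hom point X"
  using point(1) by (rule Hom_discrete)

lemma \<eta>_point: "\<eta> point undefined \<in> pts (Ob T point)"
  unfolding T_Ob by (rule \<eta>_pts) (simp_all add: point Set_fp_Met)

lemma insertion_Hom:
  assumes X: "X \<in> Met"
  shows "insertion X \<in> Hom X (und (alg X))"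
  unfolding insertion_def und_alg
proof (rule HomI)
  fix p q assume p: "p \<in> pts X" and q: "q \<in> pts X"
  show "gen X point (\<lambda>_\<in>pts point. p) (\<eta> point undefined) \<in> pts (Ob L X)"
    by (rule gen_pts[OF X point(1) point_Hom[OF X p] \<eta>_point])
  have "edist (Ob L X) (gen X point (\<lambda>_\<in>pts point. p) (\<eta> point undefined))
      (gen X point (\<lambda>_\<in>pts point. q) (\<eta> point undefined))
      \<le> hom_dist point X (\<lambda>_\<in>pts point. p) (\<lambda>_\<in>pts point. q)"
    by (rule gen_edist_hom_dist[OF X point(1) point_Hom[OF X p] point_Hom[OF X q] \<eta>_point])
  also have "\<dots> \<le> edist X p q" by (simp add: hom_dist_le_iff)
  finally show "edist (Ob L X) (gen X point (\<lambda>_\<in>pts point. p) (\<eta> point undefined))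
      (gen X point (\<lambda>_\<in>pts point. q) (\<eta> point undefined)) \<le> edist X p q" .
qed

lemma insertion_gen:
  assumes X: "X \<in> Met" and N: "N \<in> Set_fp" and x: "x \<in> Hom N X" and i: "i \<in> pts N"
  shows "insertion X (x i) = gen X N x (\<eta> N i)"
proof -
  let ?h = "\<lambda>_\<in>pts point. i"
  have h: "?h \<in> Hom point N" using point_Hom[OF Set_fp_Met[OF N] i] .
  have "compose (pts point) x ?h = (\<lambda>_\<in>pts point. x i)"
    by (auto simp: compose_def)
  moreover have "Ar T point N ?h (\<eta> point undefined) = \<eta> N i"
    using T_\<eta>[OF Set_fp_Met[OF point(1)] Set_fp_Met[OF N] h, of undefined] by (simp add: point(2))
  ultimately show ?thesis
    using gen_compose[OF X point(1) N h x \<eta>_point] Hom_pts[OF x i] by (simp add: insertion_def)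
qed

text \<open>The section of the comparison from \<open>L X\<close> to \<open>T X\<close>.\<close>

definition section_map :: "'u emet \<Rightarrow> 'u \<Rightarrow> 'u" where
  "section_map X = ext X (alg X) (insertion X)"

lemma section_map_hom: "X \<in> Met \<Longrightarrow> section_map X \<in> alg_hom \<Sigma> (F X) (alg X)"
  unfolding section_map_def by (rule ext_hom[OF _ alg_model insertion_Hom])

lemma section_map_T:
  assumes X: "X \<in> Met" and N: "N \<in> Set_fp" and x: "x \<in> Hom N X" and t: "t \<in> pts (Ob T N)"
  shows "section_map X (Ar T N X x t) = gen X N x t"
proof -
  note N' = Set_fp_Met[OF N]
  have "compose (pts (und (F N))) (section_map X) (Ar T N X x) = restrict (gen X N x) (pts (Ob T N))"
    using alg_hom_compose[OF F_qalg[OF N'] T_hom[OF N' X x] section_map_hom[OF X]] gen_hom[OF X N x]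
  proof (rule hom_eq[OF N' alg_model[OF X]])
    fix i assume i: "i \<in> pts N"
    then have "section_map X (\<eta> X (x i)) = gen X N x (\<eta> N i)"
      using ext_\<eta>[OF X alg_model[OF X] insertion_Hom[OF X] Hom_pts[OF x i]] insertion_gen[OF X N x i]
      by (simp add: section_map_def)
    then show "compose (pts (und (F N))) (section_map X) (Ar T N X x) (\<eta> N i)
        = restrict (gen X N x) (pts (Ob T N)) (\<eta> N i)"
      by (simp add: compose_app T_Ob \<eta>_pts[OF N' i] T_\<eta>[OF N' X x i])
  qed
  from fun_cong[OF this, of t] show ?thesis using t by (simp add: compose_app T_Ob)
qed

text \<open>Cocones separate points of \<open>T X\<close> as they separate points of \<open>L X\<close>, and the nonexpanding map
  \<open>section_map\<close> from \<open>T X\<close> to \<open>L X\<close> bounds the latter by the distance in \<open>T X\<close>. Every element of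
  \<open>T X\<close> is the value of a term, which has finitely many variables.\<close>

theorem strongly_finitary_T: "strongly_finitary T"
proof (rule strongly_finitaryI[OF enriched_functor_T])
  fix X :: "'u emet" and p assume X: "X \<in> Met" and "p \<in> pts (Ob T X)"
  then obtain t where t: "t \<in> terms_in \<Sigma> (pts X)" and p: "p = sharp (F X) (\<eta> X) t"
    using F_generated[OF X] by (auto simp: T_Ob)
  define N where "N = discrete (set2_trm t)"
  have N: "N \<in> Set_fp" unfolding N_def by (rule discrete_Set_fp[OF universe finite_vars])
  note N' = Set_fp_Met[OF N]
  have tN: "t \<in> terms_in \<Sigma> (pts N)" using t by (simp add: N_def terms_in_def)
  have vars: "pts N \<subseteq> pts X" using t by (auto simp: N_def terms_in_def)
  have x: "restrict (\<lambda>v. v) (pts N) \<in> Hom N X"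
    by (rule Hom_discrete[OF N X]) (use vars in auto)
  have "\<eta> N \<in> pts N \<rightarrow> pts (und (F N))" using \<eta>_pts[OF N'] by blast
  note s = sharp_pts[OF F_qalg[OF N'] tN this] alg_hom_sharp[OF F_qalg[OF N'] T_hom[OF N' X x] tN this]
  have "Ar T N X (restrict (\<lambda>v. v) (pts N)) (sharp (F N) (\<eta> N) t) = sharp (F X) (\<eta> X) t"
    unfolding s(2)
  proof (rule sharp_cong)
    fix v assume "v \<in> set2_trm t"
    then have v: "v \<in> pts N" by (simp add: N_def)
    then show "Ar T N X (restrict (\<lambda>v. v) (pts N)) (\<eta> N v) = \<eta> X v"
      using T_\<eta>[OF N' X x v] by simp
  qed
  then show "\<exists>N\<in>Set_fp. \<exists>x\<in>Hom N X. \<exists>t\<in>pts (Ob T N). p = Ar T N X x t"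
    using N x s(1) p unfolding T_Ob by metis
next
  fix X B M N :: "'u emet" and \<alpha> x y s t
  assume X: "X \<in> Met" and B: "B \<in> Met" and \<alpha>: "\<alpha> \<in> cocones T X B"
    and M: "M \<in> Set_fp" and N: "N \<in> Set_fp" and x: "x \<in> Hom M X" and y: "y \<in> Hom N X"
    and s: "s \<in> pts (Ob T M)" and t: "t \<in> pts (Ob T N)"
  obtain f where f: "f \<in> Hom (Ob L X) B"
    and f_eq: "\<forall>N\<in>Set_fp. \<forall>x\<in>Hom N X. \<forall>t\<in>pts (Ob T N). f (Ar L N X x (\<kappa> N t)) = \<alpha> N x t"
    using universal[OF X B \<alpha>] by blast
  have Tx: "Ar T M X x s \<in> pts (Ob T X)" "Ar T N X y t \<in> pts (Ob T X)"
    using Hom_pts[OF functor_Hom[OF enriched_functor_T]] X M N x y s t Set_fp_Met by blast+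
  have "edist B (\<alpha> M x s) (\<alpha> N y t) = edist B (f (gen X M x s)) (f (gen X N y t))"
    using f_eq M N x y s t by (simp add: gen_def)
  also have "\<dots> \<le> edist (Ob L X) (gen X M x s) (gen X N y t)"
    by (rule Hom_edist[OF f gen_pts[OF X M x s] gen_pts[OF X N y t]])
  also have "\<dots> = edist (Ob L X) (section_map X (Ar T M X x s)) (section_map X (Ar T N X y t))"
    by (simp add: section_map_T[OF X] M N x y s t)
  also have "\<dots> \<le> edist (Ob T X) (Ar T M X x s) (Ar T N X y t)"
    using Hom_edist[OF alg_hom_Hom[OF section_map_hom[OF X]]] Tx by (simp add: T_Ob und_alg)
  finally show "edist B (\<alpha> M x s) (\<alpha> N y t) \<le> edist (Ob T X) (Ar T M X x s) (Ar T N X y t)" .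
qed

end

theorem corollary4p31:
  fixes \<Sigma> :: "'s signature"
    and \<V> :: "('s, 'u) qalg set"
  assumes "universe TYPE('u)"
    and "\<forall>S T :: 'u met_functor.
           strongly_finitary S \<longrightarrow> strongly_finitary T \<longrightarrow> strongly_finitary (T \<circ>\<^sub>F S)"
    and "finitary_variety \<Sigma> \<V>"
  shows "strongly_finitary_monad (free_algebra_monad \<Sigma> \<V>)"
proof -
  obtain E where "E \<subseteq> quantitative_equations \<Sigma>"
    "\<V> = {A. quantitative_algebra \<Sigma> A \<and> (\<forall>e\<in>E. satisfies A e)}"
    using assms(3) by (auto simp: finitary_variety_def)
  then interpret quantitative_variety \<Sigma> E \<V>
    using assms(1,3) by unfold_locales (auto simp: finitary_variety_def)
  have "enriched_functor Set_fp T"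
    using enriched_functor_T by (rule enriched_functor_subset) (auto simp: Set_fp_Met)
  from left_kan_extension_exists[OF assms(1) this] obtain L \<kappa> where Lan:
    "strongly_finitary L"
    "\<And>N. N \<in> Set_fp \<Longrightarrow> \<kappa> N ` pts (Ob T N) = pts (Ob L N)"
    "\<And>N s t. N \<in> Set_fp \<Longrightarrow> s \<in> pts (Ob T N) \<Longrightarrow> t \<in> pts (Ob T N) \<Longrightarrow>
      edist (Ob L N) (\<kappa> N s) (\<kappa> N t) = edist (Ob T N) s t"
    "\<And>M N h t. M \<in> Set_fp \<Longrightarrow> N \<in> Set_fp \<Longrightarrow> h \<in> Hom M N \<Longrightarrow> t \<in> pts (Ob T M) \<Longrightarrow>
      Ar L M N h (\<kappa> M t) = \<kappa> N (Ar T M N h t)"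
    "\<And>X B \<alpha>. X \<in> Met \<Longrightarrow> B \<in> Met \<Longrightarrow> \<alpha> \<in> cocones T X B \<Longrightarrow>
      \<exists>f\<in>Hom (Ob L X) B. \<forall>N\<in>Set_fp. \<forall>x\<in>Hom N X. \<forall>t\<in>pts (Ob T N).
        f (Ar L N X x (\<kappa> N t)) = \<alpha> N x t"
    by blast
  interpret free_kan_extension \<Sigma> E \<V> L \<kappa>
    by unfold_locales (use assms(2) Lan in simp_all)
  show ?thesis
    using enriched_monad_free strongly_finitary_T
    by (simp add: strongly_finitary_monad_def free_algebra_monad_def)
qed

end
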